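(* Let $\mathbf{B}$ be a precartesian bicategory, with $\mathbf{M}=\mathrm{Map}\,\mathbf{B}$ and associated bicategory $\mathbf{G}$. Then $\mathbf{G}$ has finite products, preserved by the pseudofunctors $\partial_0,\partial_1:\mathbf{G}\to\mathbf{M}$.
   Context: Conventions. All bicategories are normal (unit constraints are identities). Finite products in a bicategory are in the bilimit sense: a family $(p_i:P\to X_i)_{i\in I}$ ($I$ finite) is a product cone if for every object $Z$ the induced functor from the hom-category of arrows $Z\to P$ to the product over $i\in I$ of the hom-categories of arrows $Z\to X_i$ is an equivalence of categories; the bicategory has finite products if every finite family has a product cone. A map is an arrow $f$ with a right adjoint $f^*$; $\mathrm{Map}\,\mathbf{B}$ is the locally full subbicategory of $\mathbf{B}$ with all objects and with the maps as arrows. $\mathbf{B}$ is precartesian if (i) $\mathbf{M}=\mathrm{Map}\,\mathbf{B}$ has finite products, and (ii) each hom-category $\mathbf{B}(X,Y)$ has finite products. The bicategory $\mathbf{G}$: an object is a triple $(X,R,A)$ with $R:X\to A$ an arrow of $\mathbf{B}$; an arrow $(X,R,A)\to(Y,S,B)$ is a triple $(f,\alpha,u)$ with $f:X\to Y$ and $u:A\to B$ maps in $\mathbf{B}$ and $\alpha:uR\to Sf$ a 2-cell in $\mathbf{B}$; a 2-cell $(f,\alpha,u)\to(f',\alpha',u')$ is a pair of 2-cells $\phi:f\to f'$, $\psi:u\to u'$ with $(S\phi)\cdot\alpha=\alpha'\cdot(\psi R)$. Arrows are composed by pasting. The pseudofunctors $\partial_0,\partial_1:\mathbf{G}\to\mathbf{M}$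 send $(\phi,\psi):(f,\alpha,u)\to(f',\alpha',u'):(X,R,A)\to(Y,S,B)$ to $\phi:f\to f':X\to Y$ and to $\psi:u\to u':A\to B$ respectively. *)

theory Defs
  imports "HOL-Library.FuncSet"
begin

section \<open>Categories\<close>

record ('o, 'm) cat =
  objs :: "'o set"
  mors :: "'m set"
  mdom :: "'m \<Rightarrow> 'o"
  mcod :: "'m \<Rightarrow> 'o"
  ident :: "'o \<Rightarrow> 'm"
  mcomp :: "'m \<Rightarrow> 'm \<Rightarrow> 'm"

definition homset :: "('o, 'm, 'z) cat_scheme \<Rightarrow> 'o \<Rightarrow> 'o \<Rightarrow> 'm set" where
  "homset C x y = {m \<in> mors C. mdom C m = x \<and> mcod C m = y}"

definition category :: "('o, 'm, 'z) cat_scheme \<Rightarrow> bool" where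
  "category C \<longleftrightarrow>
     (\<forall>m \<in> mors C. mdom C m \<in> objs C \<and> mcod C m \<in> objs C) \<and>
     (\<forall>x \<in> objs C. ident C x \<in> homset C x x) \<and>
     (\<forall>x y z m n. m \<in> homset C x y \<and> n \<in> homset C y z \<longrightarrow> mcomp C n m \<in> homset C x z) \<and>
     (\<forall>x y m. m \<in> homset C x y \<longrightarrow> mcomp C m (ident C x) = m \<and> mcomp C (ident C y) m = m) \<and>
     (\<forall>w x y z m n k. m \<in> homset C w x \<and> n \<in> homset C x y \<and> k \<in> homset C y z \<longrightarrow>
        mcomp C (mcomp C k n) m = mcomp C k (mcomp C n m))"

definition iso_mor :: "('o, 'm, 'z) cat_scheme \<Rightarrow> 'm \<Rightarrow> bool" where
  "iso_mor C m \<longleftrightarrow> m \<in> mors C \<and>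
     (\<exists>n \<in> homset C (mcod C m) (mdom C m).
        mcomp C n m = ident C (mdom C m) \<and> mcomp C m n = ident C (mcod C m))"

text \<open>A functor is given by its object part and its morphism part.\<close>

definition is_functor ::
  "('o, 'm, 'z) cat_scheme \<Rightarrow> ('p, 'n, 'y) cat_scheme \<Rightarrow> ('o \<Rightarrow> 'p) \<Rightarrow> ('m \<Rightarrow> 'n) \<Rightarrow> bool" where
  "is_functor C D Fo Fm \<longleftrightarrow>
     (\<forall>x \<in> objs C. Fo x \<in> objs D) \<and>
     (\<forall>x y m. m \<in> homset C x y \<longrightarrow> Fm m \<in> homset D (Fo x) (Fo y)) \<and>
     (\<forall>x \<in> objs C. Fm (ident C x) = ident D (Fo x)) \<and>
     (\<forall>x y z m n. m \<in> homset C x y \<and> n \<in> homset C y z \<longrightarrow>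
        Fm (mcomp C n m) = mcomp D (Fm n) (Fm m))"

definition nat_iso ::
  "('o, 'm, 'z) cat_scheme \<Rightarrow> ('p, 'n, 'y) cat_scheme \<Rightarrow>
   ('o \<Rightarrow> 'p) \<Rightarrow> ('m \<Rightarrow> 'n) \<Rightarrow> ('o \<Rightarrow> 'p) \<Rightarrow> ('m \<Rightarrow> 'n) \<Rightarrow> ('o \<Rightarrow> 'n) \<Rightarrow> bool" where
  "nat_iso C D Fo Fm Ko Km \<tau> \<longleftrightarrow>
     (\<forall>x \<in> objs C. \<tau> x \<in> homset D (Fo x) (Ko x) \<and> iso_mor D (\<tau> x)) \<and>
     (\<forall>x y m. m \<in> homset C x y \<longrightarrow> mcomp D (\<tau> y) (Fm m) = mcomp D (Km m) (\<tau> x))"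

definition is_equivalence ::
  "('o, 'm, 'z) cat_scheme \<Rightarrow> ('p, 'n, 'y) cat_scheme \<Rightarrow> ('o \<Rightarrow> 'p) \<Rightarrow> ('m \<Rightarrow> 'n) \<Rightarrow> bool" where
  "is_equivalence C D Fo Fm \<longleftrightarrow>
     is_functor C D Fo Fm \<and>
     (\<exists>Ko Km \<eta> \<epsilon>. is_functor D C Ko Km \<and>
        nat_iso C C (\<lambda>x. x) (\<lambda>m. m) (Ko \<circ> Fo) (Km \<circ> Fm) \<eta> \<and>
        nat_iso D D (Fo \<circ> Ko) (Fm \<circ> Km) (\<lambda>x. x) (\<lambda>m. m) \<epsilon>)"

text \<open>Product categories; families are extensional functions, so that equality of families means
  equality on the index set.\<close>

definition product_cat ::
  "'i set \<Rightarrow> ('i \<Rightarrow> ('o, 'm) cat) \<Rightarrow> ('i \<Rightarrow> 'o, 'i \<Rightarrow> 'm) cat" where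
  "product_cat I C = \<lparr>
     objs = (\<Pi>\<^sub>E i\<in>I. objs (C i)),
     mors = (\<Pi>\<^sub>E i\<in>I. mors (C i)),
     mdom = (\<lambda>m. \<lambda>i\<in>I. mdom (C i) (m i)),
     mcod = (\<lambda>m. \<lambda>i\<in>I. mcod (C i) (m i)),
     ident = (\<lambda>x. \<lambda>i\<in>I. ident (C i) (x i)),
     mcomp = (\<lambda>n m. \<lambda>i\<in>I. mcomp (C i) (n i) (m i))\<rparr>"

definition cat_product_cone ::
  "('o, 'm, 'z) cat_scheme \<Rightarrow> 'i set \<Rightarrow> ('i \<Rightarrow> 'o) \<Rightarrow> 'o \<Rightarrow> ('i \<Rightarrow> 'm) \<Rightarrow> bool" where
  "cat_product_cone C I X P p \<longleftrightarrow>
     P \<in> objs C \<and> (\<forall>i \<in> I. p i \<in> homset C P (X i)) \<and>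
     (\<forall>Z \<in> objs C. \<forall>q. (\<forall>i \<in> I. q i \<in> homset C Z (X i)) \<longrightarrow>
        (\<exists>!h. h \<in> homset C Z P \<and> (\<forall>i \<in> I. mcomp C (p i) h = q i)))"

text \<open>Finite families are indexed by finite sets of natural numbers (any finite index set is in
  bijection with one of these).\<close>

definition cat_has_finite_products :: "('o, 'm, 'z) cat_scheme \<Rightarrow> bool" where
  "cat_has_finite_products C \<longleftrightarrow>
     (\<forall>(I :: nat set) X. finite I \<and> (\<forall>i \<in> I. X i \<in> objs C) \<longrightarrow>
        (\<exists>P p. cat_product_cone C I X P p))"


section \<open>Normal bicategories\<close>

text \<open>Arrows carry their source and target, and 2-cells their domain and codomain arrow.
  \<open>g \<odot> f\<close> is composition of arrows, \<open>\<psi> \<cdot> \<phi>\<close> vertical and \<open>\<psi> \<star> \<phi>\<close> horizontal composition of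
  2-cells, all written in applicative order.  The associativity constraint is
  \<open>assoc h g f : (h \<odot> g) \<odot> f \<rightarrow> h \<odot> (g \<odot> f)\<close>; its inverse \<open>assoc_inv h g f\<close> is uniquely
  determined and only carried along for convenience.\<close>

record ('o, 'a, 'c) bicat =
  Obj :: "'o set"
  Arr :: "'a set"
  Cell :: "'c set"
  src :: "'a \<Rightarrow> 'o"
  trg :: "'a \<Rightarrow> 'o"
  cdom :: "'c \<Rightarrow> 'a"
  ccod :: "'c \<Rightarrow> 'a"
  id1 :: "'o \<Rightarrow> 'a"
  comp1 :: "'a \<Rightarrow> 'a \<Rightarrow> 'a" (infixr "\<odot>\<index>" 75)
  id2 :: "'a \<Rightarrow> 'c"
  vcomp :: "'c \<Rightarrow> 'c \<Rightarrow> 'c" (infixr "\<cdot>\<index>" 70)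
  hcomp :: "'c \<Rightarrow> 'c \<Rightarrow> 'c" (infixr "\<star>\<index>" 75)
  assoc :: "'a \<Rightarrow> 'a \<Rightarrow> 'a \<Rightarrow> 'c"
  assoc_inv :: "'a \<Rightarrow> 'a \<Rightarrow> 'a \<Rightarrow> 'c"

definition arrs :: "('o, 'a, 'c, 'z) bicat_scheme \<Rightarrow> 'o \<Rightarrow> 'o \<Rightarrow> 'a set" where
  "arrs B X Y = {f \<in> Arr B. src B f = X \<and> trg B f = Y}"

definition cells :: "('o, 'a, 'c, 'z) bicat_scheme \<Rightarrow> 'a \<Rightarrow> 'a \<Rightarrow> 'c set" where
  "cells B f g = {\<phi> \<in> Cell B. cdom B \<phi> = f \<and> ccod B \<phi> = g}"

definition hom_cat :: "('o, 'a, 'c, 'z) bicat_scheme \<Rightarrow> 'o \<Rightarrow> 'o \<Rightarrow> ('a, 'c) cat" where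
  "hom_cat B X Y = \<lparr>
     objs = arrs B X Y,
     mors = {\<phi> \<in> Cell B. cdom B \<phi> \<in> arrs B X Y \<and> ccod B \<phi> \<in> arrs B X Y},
     mdom = cdom B, mcod = ccod B, ident = id2 B, mcomp = vcomp B\<rparr>"

text \<open>Whiskering: \<open>g \<rhd> \<phi>\<close> is \<open>g\<phi>\<close> and \<open>\<psi> \<lhd> f\<close> is \<open>\<psi>f\<close>.\<close>

definition lwhisker :: "('o, 'a, 'c, 'z) bicat_scheme \<Rightarrow> 'a \<Rightarrow> 'c \<Rightarrow> 'c" (infixr "\<rhd>\<index>" 75) where
  "g \<rhd>\<^bsub>B\<^esub> \<phi> = id2 B g \<star>\<^bsub>B\<^esub> \<phi>"

definition rwhisker :: "('o, 'a, 'c, 'z) bicat_scheme \<Rightarrow> 'c \<Rightarrow> 'a \<Rightarrow> 'c" (infixl "\<lhd>\<index>" 76) where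
  "\<psi> \<lhd>\<^bsub>B\<^esub> f = \<psi> \<star>\<^bsub>B\<^esub> id2 B f"

text \<open>Since the unit constraints are identities, the unit isomorphisms become equations between
  arrows, their naturality becomes \<open>unit_left_cell\<close> and \<open>unit_right_cell\<close>, and the triangle axiom
  says that \<open>assoc g 1 f\<close> is an identity.\<close>

locale normal_bicategory =
  fixes B :: "('o, 'a, 'c, 'z) bicat_scheme" (structure)
  assumes arr_obj: "f \<in> Arr B \<Longrightarrow> src B f \<in> Obj B \<and> trg B f \<in> Obj B"
    and cell_arr: "\<phi> \<in> Cell B \<Longrightarrow> cdom B \<phi> \<in> Arr B \<and> ccod B \<phi> \<in> Arr B \<and>
      src B (ccod B \<phi>) = src B (cdom B \<phi>) \<and> trg B (ccod B \<phi>) = trg B (cdom B \<phi>)"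
    and hom_category: "X \<in> Obj B \<Longrightarrow> Y \<in> Obj B \<Longrightarrow> category (hom_cat B X Y)"
    and id1_arr: "X \<in> Obj B \<Longrightarrow> id1 B X \<in> arrs B X X"
    and comp1_arr: "f \<in> arrs B X Y \<Longrightarrow> g \<in> arrs B Y Z \<Longrightarrow> g \<odot> f \<in> arrs B X Z"
    and hcomp_cell: "f \<in> arrs B X Y \<Longrightarrow> g \<in> arrs B Y Z \<Longrightarrow> \<phi> \<in> cells B f f' \<Longrightarrow> \<psi> \<in> cells B g g' \<Longrightarrow>
      \<psi> \<star> \<phi> \<in> cells B (g \<odot> f) (g' \<odot> f')"
    and hcomp_id2: "f \<in> arrs B X Y \<Longrightarrow> g \<in> arrs B Y Z \<Longrightarrow> id2 B g \<star> id2 B f = id2 B (g \<odot> f)"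
    and interchange: "f \<in> arrs B X Y \<Longrightarrow> g \<in> arrs B Y Z \<Longrightarrow>
      \<phi> \<in> cells B f f' \<Longrightarrow> \<phi>' \<in> cells B f' f'' \<Longrightarrow> \<psi> \<in> cells B g g' \<Longrightarrow> \<psi>' \<in> cells B g' g'' \<Longrightarrow>
      (\<psi>' \<cdot> \<psi>) \<star> (\<phi>' \<cdot> \<phi>) = (\<psi>' \<star> \<phi>') \<cdot> (\<psi> \<star> \<phi>)"
    and unit_left: "f \<in> arrs B X Y \<Longrightarrow> id1 B Y \<odot> f = f"
    and unit_right: "f \<in> arrs B X Y \<Longrightarrow> f \<odot> id1 B X = f"
    and unit_left_cell: "f \<in> arrs B X Y \<Longrightarrow> \<phi> \<in> cells B f f' \<Longrightarrow> id1 B Y \<rhd> \<phi> = \<phi>"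
    and unit_right_cell: "f \<in> arrs B X Y \<Longrightarrow> \<phi> \<in> cells B f f' \<Longrightarrow> \<phi> \<lhd> id1 B X = \<phi>"
    and assoc_cell: "f \<in> arrs B W X \<Longrightarrow> g \<in> arrs B X Y \<Longrightarrow> h \<in> arrs B Y Z \<Longrightarrow>
      assoc B h g f \<in> cells B ((h \<odot> g) \<odot> f) (h \<odot> (g \<odot> f))"
    and assoc_inv_cell: "f \<in> arrs B W X \<Longrightarrow> g \<in> arrs B X Y \<Longrightarrow> h \<in> arrs B Y Z \<Longrightarrow>
      assoc_inv B h g f \<in> cells B (h \<odot> (g \<odot> f)) ((h \<odot> g) \<odot> f)"
    and assoc_inverse: "f \<in> arrs B W X \<Longrightarrow> g \<in> arrs B X Y \<Longrightarrow> h \<in> arrs B Y Z \<Longrightarrow>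
      assoc_inv B h g f \<cdot> assoc B h g f = id2 B ((h \<odot> g) \<odot> f) \<and>
      assoc B h g f \<cdot> assoc_inv B h g f = id2 B (h \<odot> (g \<odot> f))"
    and assoc_natural: "f \<in> arrs B W X \<Longrightarrow> g \<in> arrs B X Y \<Longrightarrow> h \<in> arrs B Y Z \<Longrightarrow>
      \<phi> \<in> cells B f f' \<Longrightarrow> \<psi> \<in> cells B g g' \<Longrightarrow> \<chi> \<in> cells B h h' \<Longrightarrow>
      assoc B h' g' f' \<cdot> ((\<chi> \<star> \<psi>) \<star> \<phi>) = (\<chi> \<star> (\<psi> \<star> \<phi>)) \<cdot> assoc B h g f"
    and pentagon: "f \<in> arrs B V W \<Longrightarrow> g \<in> arrs B W X \<Longrightarrow> h \<in> arrs B X Y \<Longrightarrow> k \<in> arrs B Y Z \<Longrightarrow>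
      assoc B k h (g \<odot> f) \<cdot> assoc B (k \<odot> h) g f =
      (k \<rhd> assoc B h g f) \<cdot> assoc B k (h \<odot> g) f \<cdot> (assoc B k h g \<lhd> f)"
    and triangle: "f \<in> arrs B X Y \<Longrightarrow> g \<in> arrs B Y Z \<Longrightarrow>
      assoc B g (id1 B Y) f = id2 B (g \<odot> f)"

definition iso_cell :: "('o, 'a, 'c, 'z) bicat_scheme \<Rightarrow> 'c \<Rightarrow> bool" where
  "iso_cell B \<phi> \<longleftrightarrow> \<phi> \<in> Cell B \<and>
     (\<exists>\<psi> \<in> cells B (ccod B \<phi>) (cdom B \<phi>).
        \<psi> \<cdot>\<^bsub>B\<^esub> \<phi> = id2 B (cdom B \<phi>) \<and> \<phi> \<cdot>\<^bsub>B\<^esub> \<psi> = id2 B (ccod B \<phi>))"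


section \<open>Finite products in a bicategory\<close>

text \<open>The functor induced by a family \<open>p i : P \<rightarrow> X i\<close> sends \<open>h : Z \<rightarrow> P\<close> to the family
  \<open>p i \<odot> h\<close> and \<open>\<phi>\<close> to the family \<open>p i \<rhd> \<phi>\<close>.\<close>

definition product_cone ::
  "('o, 'a, 'c, 'z) bicat_scheme \<Rightarrow> 'i set \<Rightarrow> ('i \<Rightarrow> 'o) \<Rightarrow> 'o \<Rightarrow> ('i \<Rightarrow> 'a) \<Rightarrow> bool" where
  "product_cone B I X P p \<longleftrightarrow>
     P \<in> Obj B \<and> (\<forall>i \<in> I. X i \<in> Obj B \<and> p i \<in> arrs B P (X i)) \<and>
     (\<forall>Z \<in> Obj B.
        is_equivalence (hom_cat B Z P) (product_cat I (\<lambda>i. hom_cat B Z (X i)))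
          (\<lambda>h. \<lambda>i\<in>I. p i \<odot>\<^bsub>B\<^esub> h) (\<lambda>\<phi>. \<lambda>i\<in>I. p i \<rhd>\<^bsub>B\<^esub> \<phi>))"

definition has_finite_products :: "('o, 'a, 'c, 'z) bicat_scheme \<Rightarrow> bool" where
  "has_finite_products B \<longleftrightarrow>
     (\<forall>(I :: nat set) X. finite I \<and> (\<forall>i \<in> I. X i \<in> Obj B) \<longrightarrow> (\<exists>P p. product_cone B I X P p))"


section \<open>Pseudofunctors\<close>

record ('o, 'a, 'c, 'p, 'b, 'd) pfunctor =
  on_obj :: "'o \<Rightarrow> 'p"
  on_arr :: "'a \<Rightarrow> 'b"
  on_cell :: "'c \<Rightarrow> 'd"
  pf_comp :: "'a \<Rightarrow> 'a \<Rightarrow> 'd"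
  pf_unit :: "'o \<Rightarrow> 'd"

locale pseudofunctor =
  B: normal_bicategory B + C: normal_bicategory C
  for B :: "('o, 'a, 'c, 'z) bicat_scheme" (structure)
    and C :: "('p, 'b, 'd, 'y) bicat_scheme" +
  fixes F :: "('o, 'a, 'c, 'p, 'b, 'd, 'w) pfunctor_scheme"
  assumes on_obj: "X \<in> Obj B \<Longrightarrow> on_obj F X \<in> Obj C"
    and on_hom: "X \<in> Obj B \<Longrightarrow> Y \<in> Obj B \<Longrightarrow>
      is_functor (hom_cat B X Y) (hom_cat C (on_obj F X) (on_obj F Y)) (on_arr F) (on_cell F)"
    and pf_comp_cell: "f \<in> arrs B X Y \<Longrightarrow> g \<in> arrs B Y Z \<Longrightarrow>
      pf_comp F g f \<in> cells C (on_arr F g \<odot>\<^bsub>C\<^esub> on_arr F f) (on_arr F (g \<odot> f)) \<and>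
      iso_cell C (pf_comp F g f)"
    and pf_comp_natural: "f \<in> arrs B X Y \<Longrightarrow> g \<in> arrs B Y Z \<Longrightarrow>
      \<phi> \<in> cells B f f' \<Longrightarrow> \<psi> \<in> cells B g g' \<Longrightarrow>
      pf_comp F g' f' \<cdot>\<^bsub>C\<^esub> (on_cell F \<psi> \<star>\<^bsub>C\<^esub> on_cell F \<phi>) = on_cell F (\<psi> \<star> \<phi>) \<cdot>\<^bsub>C\<^esub> pf_comp F g f"
    and pf_unit_cell: "X \<in> Obj B \<Longrightarrow>
      pf_unit F X \<in> cells C (id1 C (on_obj F X)) (on_arr F (id1 B X)) \<and> iso_cell C (pf_unit F X)"
    and pf_assoc: "f \<in> arrs B W X \<Longrightarrow> g \<in> arrs B X Y \<Longrightarrow> h \<in> arrs B Y Z \<Longrightarrow>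
      on_cell F (assoc B h g f) \<cdot>\<^bsub>C\<^esub> pf_comp F (h \<odot> g) f \<cdot>\<^bsub>C\<^esub> (pf_comp F h g \<lhd>\<^bsub>C\<^esub> on_arr F f) =
      pf_comp F h (g \<odot> f) \<cdot>\<^bsub>C\<^esub> (on_arr F h \<rhd>\<^bsub>C\<^esub> pf_comp F g f) \<cdot>\<^bsub>C\<^esub>
        assoc C (on_arr F h) (on_arr F g) (on_arr F f)"
    and pf_unit_left: "f \<in> arrs B X Y \<Longrightarrow>
      pf_comp F (id1 B Y) f \<cdot>\<^bsub>C\<^esub> (pf_unit F Y \<lhd>\<^bsub>C\<^esub> on_arr F f) = id2 C (on_arr F f)"
    and pf_unit_right: "f \<in> arrs B X Y \<Longrightarrow>
      pf_comp F f (id1 B X) \<cdot>\<^bsub>C\<^esub> (on_arr F f \<rhd>\<^bsub>C\<^esub> pf_unit F X) = id2 C (on_arr F f)"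

definition preserves_finite_products ::
  "('o, 'a, 'c, 'z) bicat_scheme \<Rightarrow> ('p, 'b, 'd, 'y) bicat_scheme \<Rightarrow>
   ('o, 'a, 'c, 'p, 'b, 'd, 'w) pfunctor_scheme \<Rightarrow> bool" where
  "preserves_finite_products B C F \<longleftrightarrow>
     (\<forall>(I :: nat set) X P p. finite I \<and> product_cone B I X P p \<longrightarrow>
        product_cone C I (\<lambda>i. on_obj F (X i)) (on_obj F P) (\<lambda>i. on_arr F (p i)))"


section \<open>Maps and precartesian bicategories\<close>

text \<open>The triangle identities, for \<open>\<eta> : 1 \<rightarrow> f* f\<close> and \<open>\<epsilon> : f f* \<rightarrow> 1\<close>.  The unit constraints do not
  appear because they are identities.\<close>

definition adjunction :: "('o, 'a, 'c, 'z) bicat_scheme \<Rightarrow> 'a \<Rightarrow> 'a \<Rightarrow> 'c \<Rightarrow> 'c \<Rightarrow> bool" where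
  "adjunction B f f\<^sub>r \<eta> \<epsilon> \<longleftrightarrow>
     f \<in> Arr B \<and> f\<^sub>r \<in> arrs B (trg B f) (src B f) \<and>
     \<eta> \<in> cells B (id1 B (src B f)) (f\<^sub>r \<odot>\<^bsub>B\<^esub> f) \<and>
     \<epsilon> \<in> cells B (f \<odot>\<^bsub>B\<^esub> f\<^sub>r) (id1 B (trg B f)) \<and>
     (\<epsilon> \<lhd>\<^bsub>B\<^esub> f) \<cdot>\<^bsub>B\<^esub> assoc_inv B f f\<^sub>r f \<cdot>\<^bsub>B\<^esub> (f \<rhd>\<^bsub>B\<^esub> \<eta>) = id2 B f \<and>
     (f\<^sub>r \<rhd>\<^bsub>B\<^esub> \<epsilon>) \<cdot>\<^bsub>B\<^esub> assoc B f\<^sub>r f f\<^sub>r \<cdot>\<^bsub>B\<^esub> (\<eta> \<lhd>\<^bsub>B\<^esub> f\<^sub>r) = id2 B f\<^sub>r"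

definition is_map :: "('o, 'a, 'c, 'z) bicat_scheme \<Rightarrow> 'a \<Rightarrow> bool" where
  "is_map B f \<longleftrightarrow> (\<exists>f\<^sub>r \<eta> \<epsilon>. adjunction B f f\<^sub>r \<eta> \<epsilon>)"

definition Map_bicat :: "('o, 'a, 'c, 'z) bicat_scheme \<Rightarrow> ('o, 'a, 'c, 'z) bicat_scheme" where
  "Map_bicat B = B\<lparr>Arr := {f \<in> Arr B. is_map B f},
     Cell := {\<phi> \<in> Cell B. is_map B (cdom B \<phi>) \<and> is_map B (ccod B \<phi>)}\<rparr>"

locale precartesian_bicategory = normal_bicategory +
  assumes Map_finite_products: "has_finite_products (Map_bicat B)"
    and hom_finite_products: "X \<in> Obj B \<Longrightarrow> Y \<in> Obj B \<Longrightarrow> cat_has_finite_products (hom_cat B X Y)"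


section \<open>The bicategory \<open>G\<close>\<close>

text \<open>An arrow of \<open>G\<close> is stored as \<open>(S, (f, \<alpha>, u), T)\<close> together with its source and target objects,
  and a 2-cell as \<open>(a, (\<phi>, \<psi>), b)\<close> together with its domain and codomain arrows, because these are
  not determined by the triple \<open>(f, \<alpha>, u)\<close>, respectively by the pair \<open>(\<phi>, \<psi>)\<close>.\<close>

type_synonym ('o, 'a) gobj = "'o \<times> 'a \<times> 'o"
type_synonym ('o, 'a, 'c) garr = "('o, 'a) gobj \<times> ('a \<times> 'c \<times> 'a) \<times> ('o, 'a) gobj"
type_synonym ('o, 'a, 'c) gcell = "('o, 'a, 'c) garr \<times> ('c \<times> 'c) \<times> ('o, 'a, 'c) garr"

definition G_obj :: "('o, 'a, 'c, 'z) bicat_scheme \<Rightarrow> ('o, 'a) gobj set" where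
  "G_obj B = {(X, R, A). X \<in> Obj B \<and> A \<in> Obj B \<and> R \<in> arrs B X A}"

definition G_arr :: "('o, 'a, 'c, 'z) bicat_scheme \<Rightarrow> ('o, 'a, 'c) garr set" where
  "G_arr B = {((X, R, A), (f, \<alpha>, u), (Y, S, C)).
     (X, R, A) \<in> G_obj B \<and> (Y, S, C) \<in> G_obj B \<and>
     f \<in> arrs B X Y \<and> is_map B f \<and> u \<in> arrs B A C \<and> is_map B u \<and>
     \<alpha> \<in> cells B (u \<odot>\<^bsub>B\<^esub> R) (S \<odot>\<^bsub>B\<^esub> f)}"

definition G_cell :: "('o, 'a, 'c, 'z) bicat_scheme \<Rightarrow> ('o, 'a, 'c) gcell set" where
  "G_cell B = {(((X, R, A), (f, \<alpha>, u), (Y, S, C)), (\<phi>, \<psi>), ((X', R', A'), (f', \<alpha>', u'), (Y', S', C'))).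
     (X', R', A') = (X, R, A) \<and> (Y', S', C') = (Y, S, C) \<and>
     ((X, R, A), (f, \<alpha>, u), (Y, S, C)) \<in> G_arr B \<and> ((X, R, A), (f', \<alpha>', u'), (Y, S, C)) \<in> G_arr B \<and>
     \<phi> \<in> cells B f f' \<and> \<psi> \<in> cells B u u' \<and>
     (S \<rhd>\<^bsub>B\<^esub> \<phi>) \<cdot>\<^bsub>B\<^esub> \<alpha> = \<alpha>' \<cdot>\<^bsub>B\<^esub> (\<psi> \<lhd>\<^bsub>B\<^esub> R)}"

text \<open>The pasting of \<open>\<alpha> : u R \<rightarrow> S f\<close> and \<open>\<beta> : v S \<rightarrow> T g\<close>, namely
  \<open>(v u) R \<rightarrow> v (u R) \<rightarrow> v (S f) \<rightarrow> (v S) f \<rightarrow> (T g) f \<rightarrow> T (g f)\<close>.\<close>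

definition pasting ::
  "('o, 'a, 'c, 'z) bicat_scheme \<Rightarrow> 'a \<Rightarrow> 'a \<Rightarrow> 'a \<Rightarrow> 'a \<Rightarrow> 'c \<Rightarrow> 'a \<Rightarrow> 'a \<Rightarrow> 'c \<Rightarrow> 'a \<Rightarrow> 'c" where
  "pasting B R S T g \<beta> v f \<alpha> u =
     assoc B T g f \<cdot>\<^bsub>B\<^esub> (\<beta> \<lhd>\<^bsub>B\<^esub> f) \<cdot>\<^bsub>B\<^esub> assoc_inv B v S f \<cdot>\<^bsub>B\<^esub> (v \<rhd>\<^bsub>B\<^esub> \<alpha>) \<cdot>\<^bsub>B\<^esub> assoc B v u R"

fun G_comp1 ::
  "('o, 'a, 'c, 'z) bicat_scheme \<Rightarrow> ('o, 'a, 'c) garr \<Rightarrow> ('o, 'a, 'c) garr \<Rightarrow> ('o, 'a, 'c) garr" where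
  "G_comp1 B (_, (g, \<beta>, v), (Z, T, D)) ((X, R, A), (f, \<alpha>, u), (Y, S, C)) =
     ((X, R, A), (g \<odot>\<^bsub>B\<^esub> f, pasting B R S T g \<beta> v f \<alpha> u, v \<odot>\<^bsub>B\<^esub> u), (Z, T, D))"

fun G_id1 :: "('o, 'a, 'c, 'z) bicat_scheme \<Rightarrow> ('o, 'a) gobj \<Rightarrow> ('o, 'a, 'c) garr" where
  "G_id1 B (X, R, A) = ((X, R, A), (id1 B X, id2 B R, id1 B A), (X, R, A))"

fun G_id2 :: "('o, 'a, 'c, 'z) bicat_scheme \<Rightarrow> ('o, 'a, 'c) garr \<Rightarrow> ('o, 'a, 'c) gcell" where
  "G_id2 B (x, (f, \<alpha>, u), y) = ((x, (f, \<alpha>, u), y), (id2 B f, id2 B u), (x, (f, \<alpha>, u), y))"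

fun G_vcomp ::
  "('o, 'a, 'c, 'z) bicat_scheme \<Rightarrow> ('o, 'a, 'c) gcell \<Rightarrow> ('o, 'a, 'c) gcell \<Rightarrow> ('o, 'a, 'c) gcell" where
  "G_vcomp B (_, (\<phi>', \<psi>'), c) (a, (\<phi>, \<psi>), _) = (a, (\<phi>' \<cdot>\<^bsub>B\<^esub> \<phi>, \<psi>' \<cdot>\<^bsub>B\<^esub> \<psi>), c)"

fun G_hcomp ::
  "('o, 'a, 'c, 'z) bicat_scheme \<Rightarrow> ('o, 'a, 'c) gcell \<Rightarrow> ('o, 'a, 'c) gcell \<Rightarrow> ('o, 'a, 'c) gcell" where
  "G_hcomp B (b, (\<phi>', \<psi>'), b') (a, (\<phi>, \<psi>), a') =
     (G_comp1 B b a, (\<phi>' \<star>\<^bsub>B\<^esub> \<phi>, \<psi>' \<star>\<^bsub>B\<^esub> \<psi>), G_comp1 B b' a')"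

fun G_assoc ::
  "('o, 'a, 'c, 'z) bicat_scheme \<Rightarrow>
   ('o, 'a, 'c) garr \<Rightarrow> ('o, 'a, 'c) garr \<Rightarrow> ('o, 'a, 'c) garr \<Rightarrow> ('o, 'a, 'c) gcell" where
  "G_assoc B (r, (h, \<gamma>, w), s) (p, (g, \<beta>, v), q) (x, (f, \<alpha>, u), y) =
     (G_comp1 B (G_comp1 B (r, (h, \<gamma>, w), s) (p, (g, \<beta>, v), q)) (x, (f, \<alpha>, u), y),
      (assoc B h g f, assoc B w v u),
      G_comp1 B (r, (h, \<gamma>, w), s) (G_comp1 B (p, (g, \<beta>, v), q) (x, (f, \<alpha>, u), y)))"

fun G_assoc_inv ::
  "('o, 'a, 'c, 'z) bicat_scheme \<Rightarrow>
   ('o, 'a, 'c) garr \<Rightarrow> ('o, 'a, 'c) garr \<Rightarrow> ('o, 'a, 'c) garr \<Rightarrow> ('o, 'a, 'c) gcell" where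
  "G_assoc_inv B (r, (h, \<gamma>, w), s) (p, (g, \<beta>, v), q) (x, (f, \<alpha>, u), y) =
     (G_comp1 B (r, (h, \<gamma>, w), s) (G_comp1 B (p, (g, \<beta>, v), q) (x, (f, \<alpha>, u), y)),
      (assoc_inv B h g f, assoc_inv B w v u),
      G_comp1 B (G_comp1 B (r, (h, \<gamma>, w), s) (p, (g, \<beta>, v), q)) (x, (f, \<alpha>, u), y))"

definition G_bicat ::
  "('o, 'a, 'c, 'z) bicat_scheme \<Rightarrow> (('o, 'a) gobj, ('o, 'a, 'c) garr, ('o, 'a, 'c) gcell) bicat" where
  "G_bicat B = \<lparr>
     Obj = G_obj B, Arr = G_arr B, Cell = G_cell B,
     src = (\<lambda>(x, t, y). x), trg = (\<lambda>(x, t, y). y),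
     cdom = (\<lambda>(a, t, b). a), ccod = (\<lambda>(a, t, b). b),
     id1 = G_id1 B, comp1 = G_comp1 B,
     id2 = G_id2 B, vcomp = G_vcomp B, hcomp = G_hcomp B,
     assoc = G_assoc B, assoc_inv = G_assoc_inv B\<rparr>"

text \<open>The projections are strict: their comparison 2-cells are identities.\<close>

definition boundary0 ::
  "('o, 'a, 'c, 'z) bicat_scheme \<Rightarrow>
   (('o, 'a) gobj, ('o, 'a, 'c) garr, ('o, 'a, 'c) gcell, 'o, 'a, 'c) pfunctor" ("\<partial>\<^sub>0") where
  "\<partial>\<^sub>0 B = \<lparr>
     on_obj = (\<lambda>(X, R, A). X),
     on_arr = (\<lambda>(x, (f, \<alpha>, u), y). f),
     on_cell = (\<lambda>(a, (\<phi>, \<psi>), b). \<phi>),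
     pf_comp = (\<lambda>(_, (g, _, _), _) (_, (f, _, _), _). id2 B (g \<odot>\<^bsub>B\<^esub> f)),
     pf_unit = (\<lambda>(X, R, A). id2 B (id1 B X))\<rparr>"

definition boundary1 ::
  "('o, 'a, 'c, 'z) bicat_scheme \<Rightarrow>
   (('o, 'a) gobj, ('o, 'a, 'c) garr, ('o, 'a, 'c) gcell, 'o, 'a, 'c) pfunctor" ("\<partial>\<^sub>1") where
  "\<partial>\<^sub>1 B = \<lparr>
     on_obj = (\<lambda>(X, R, A). A),
     on_arr = (\<lambda>(x, (f, \<alpha>, u), y). u),
     on_cell = (\<lambda>(a, (\<phi>, \<psi>), b). \<psi>),
     pf_comp = (\<lambda>(_, (_, _, v), _) (_, (_, _, u), _). id2 B (v \<odot>\<^bsub>B\<^esub> u)),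
     pf_unit = (\<lambda>(X, R, A). id2 B (id1 B A))\<rparr>"


section \<open>Well-definedness\<close>

text \<open>The remainder shows that the constructions above are what they claim to be: \<open>Map_bicat B\<close> and
  \<open>G_bicat B\<close> are normal bicategories (\<open>normal_bicategory_Map\<close>, \<open>normal_bicategory_G\<close>) and the
  projections are pseudofunctors (\<open>pseudofunctor_boundary0\<close>, \<open>pseudofunctor_boundary1\<close>).\<close>

lemma arrs_iff: "f \<in> arrs B X Y \<longleftrightarrow> f \<in> Arr B \<and> src B f = X \<and> trg B f = Y"
  by (simp add: arrs_def)
lemma cells_iff: "\<phi> \<in> cells B f g \<longleftrightarrow> \<phi> \<in> Cell B \<and> cdom B \<phi> = f \<and> ccod B \<phi> = g"
  by (simp add: cells_def)

context normal_bicategory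
begin

lemma arr_simps [simp]:
  "f \<in> Arr B \<Longrightarrow> src B f \<in> Obj B" "f \<in> Arr B \<Longrightarrow> trg B f \<in> Obj B"
  using arr_obj by auto

lemma cell_simps [simp]:
  "\<phi> \<in> Cell B \<Longrightarrow> cdom B \<phi> \<in> Arr B" "\<phi> \<in> Cell B \<Longrightarrow> ccod B \<phi> \<in> Arr B"
  "\<phi> \<in> Cell B \<Longrightarrow> src B (ccod B \<phi>) = src B (cdom B \<phi>)"
  "\<phi> \<in> Cell B \<Longrightarrow> trg B (ccod B \<phi>) = trg B (cdom B \<phi>)"
  using cell_arr by auto

lemma id1_simps [simp]:
  assumes "X \<in> Obj B" shows "id1 B X \<in> Arr B" "src B (id1 B X) = X" "trg B (id1 B X) = X"
  using id1_arr[OF assms] by (auto simp: arrs_def)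

lemma comp1_simps [simp]:
  assumes "f \<in> Arr B" "g \<in> Arr B" "src B g = trg B f"
  shows "g \<odot> f \<in> Arr B" "src B (g \<odot> f) = src B f" "trg B (g \<odot> f) = trg B g"
  using comp1_arr[of f "src B f" "trg B f" g "trg B g"] assms by (auto simp: arrs_def)

lemma id2_simps [simp]:
  assumes "f \<in> Arr B" shows "id2 B f \<in> Cell B" "cdom B (id2 B f) = f" "ccod B (id2 B f) = f"
  using hom_category[of "src B f" "trg B f"] assms
  by (auto simp: category_def hom_cat_def arrs_def homset_def)

lemma vcomp_simps [simp]:
  assumes "\<phi> \<in> Cell B" "\<psi> \<in> Cell B" "cdom B \<psi> = ccod B \<phi>"
  shows "\<psi> \<cdot> \<phi> \<in> Cell B" "cdom B (\<psi> \<cdot> \<phi>) = cdom B \<phi>" "ccod B (\<psi> \<cdot> \<phi>) = ccod B \<psi>"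
proof -
  let ?H = "hom_cat B (src B (cdom B \<phi>)) (trg B (cdom B \<phi>))"
  have c: "category ?H" using assms by (intro hom_category) auto
  have "\<phi> \<in> homset ?H (cdom B \<phi>) (ccod B \<phi>)" "\<psi> \<in> homset ?H (ccod B \<phi>) (ccod B \<psi>)"
    using assms cell_simps(3,4)[OF assms(1)] cell_simps(3,4)[OF assms(2)]
    by (auto simp: homset_def hom_cat_def arrs_def)
  then have "mcomp ?H \<psi> \<phi> \<in> homset ?H (cdom B \<phi>) (ccod B \<psi>)"
    using c unfolding category_def by blast
  then show "\<psi> \<cdot> \<phi> \<in> Cell B" "cdom B (\<psi> \<cdot> \<phi>) = cdom B \<phi>" "ccod B (\<psi> \<cdot> \<phi>) = ccod B \<psi>"
    by (auto simp: homset_def hom_cat_def arrs_def)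
qed

lemma vcomp_id [simp]:
  assumes "\<phi> \<in> Cell B"
  shows "cdom B \<phi> = f \<Longrightarrow> \<phi> \<cdot> id2 B f = \<phi>" "ccod B \<phi> = g \<Longrightarrow> id2 B g \<cdot> \<phi> = \<phi>"
proof -
  let ?H = "hom_cat B (src B (cdom B \<phi>)) (trg B (cdom B \<phi>))"
  have c: "category ?H" using assms by (intro hom_category) auto
  have "\<phi> \<in> homset ?H (cdom B \<phi>) (ccod B \<phi>)"
    using assms by (auto simp: homset_def hom_cat_def arrs_def)
  then have "mcomp ?H \<phi> (ident ?H (cdom B \<phi>)) = \<phi>" "mcomp ?H (ident ?H (ccod B \<phi>)) \<phi> = \<phi>"
    using c unfolding category_def by blast+
  then show "cdom B \<phi> = f \<Longrightarrow> \<phi> \<cdot> id2 B f = \<phi>" "ccod B \<phi> = g \<Longrightarrow> id2 B g \<cdot> \<phi> = \<phi>"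
    by (auto simp: hom_cat_def)
qed

lemma vcomp_assoc [simp]:
  assumes "\<phi> \<in> Cell B" "\<psi> \<in> Cell B" "\<chi> \<in> Cell B" "cdom B \<psi> = ccod B \<phi>" "cdom B \<chi> = ccod B \<psi>"
  shows "(\<chi> \<cdot> \<psi>) \<cdot> \<phi> = \<chi> \<cdot> (\<psi> \<cdot> \<phi>)"
proof -
  let ?H = "hom_cat B (src B (cdom B \<phi>)) (trg B (cdom B \<phi>))"
  have c: "category ?H" using assms by (intro hom_category) auto
  have "\<phi> \<in> homset ?H (cdom B \<phi>) (ccod B \<phi>)" "\<psi> \<in> homset ?H (ccod B \<phi>) (ccod B \<psi>)"
     "\<chi> \<in> homset ?H (ccod B \<psi>) (ccod B \<chi>)"
    using assms cell_simps(3,4)[OF assms(1)] cell_simps(3,4)[OF assms(2)] cell_simps(3,4)[OF assms(3)]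
    by (auto simp: homset_def hom_cat_def arrs_def)
  then have "mcomp ?H (mcomp ?H \<chi> \<psi>) \<phi> = mcomp ?H \<chi> (mcomp ?H \<psi> \<phi>)"
    using c unfolding category_def by blast
  then show ?thesis by (simp add: hom_cat_def)
qed

lemma hcomp_simps [simp]:
  assumes "\<phi> \<in> Cell B" "\<psi> \<in> Cell B" "src B (cdom B \<psi>) = trg B (cdom B \<phi>)"
  shows "\<psi> \<star> \<phi> \<in> Cell B" "cdom B (\<psi> \<star> \<phi>) = cdom B \<psi> \<odot> cdom B \<phi>" "ccod B (\<psi> \<star> \<phi>) = ccod B \<psi> \<odot> ccod B \<phi>"
  using hcomp_cell[of "cdom B \<phi>" _ _ "cdom B \<psi>" _ \<phi> _ \<psi>] assms by (auto simp: arrs_def cells_def)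

lemma inter:
  assumes "\<phi> \<in> Cell B" "\<phi>' \<in> Cell B" "\<psi> \<in> Cell B" "\<psi>' \<in> Cell B"
    "src B (cdom B \<psi>) = trg B (cdom B \<phi>)" "cdom B \<phi>' = ccod B \<phi>" "cdom B \<psi>' = ccod B \<psi>"
  shows "(\<psi>' \<star> \<phi>') \<cdot> (\<psi> \<star> \<phi>) = (\<psi>' \<cdot> \<psi>) \<star> (\<phi>' \<cdot> \<phi>)"
  using interchange[of "cdom B \<phi>" "src B (cdom B \<phi>)" "trg B (cdom B \<phi>)" "cdom B \<psi>" "trg B (cdom B \<psi>)" \<phi> "ccod B \<phi>" \<phi>' "ccod B \<phi>'"
      \<psi> "ccod B \<psi>" \<psi>' "ccod B \<psi>'"] assms by (auto simp: arrs_def cells_def)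

lemma wh_simps [simp]:
  assumes "\<phi> \<in> Cell B" "g \<in> Arr B"
  shows "src B g = trg B (cdom B \<phi>) \<Longrightarrow> g \<rhd> \<phi> \<in> Cell B"
   "src B g = trg B (cdom B \<phi>) \<Longrightarrow> cdom B (g \<rhd> \<phi>) = g \<odot> cdom B \<phi>"
   "src B g = trg B (cdom B \<phi>) \<Longrightarrow> ccod B (g \<rhd> \<phi>) = g \<odot> ccod B \<phi>"
   "src B (cdom B \<phi>) = trg B g \<Longrightarrow> \<phi> \<lhd> g \<in> Cell B"
   "src B (cdom B \<phi>) = trg B g \<Longrightarrow> cdom B (\<phi> \<lhd> g) = cdom B \<phi> \<odot> g"
   "src B (cdom B \<phi>) = trg B g \<Longrightarrow> ccod B (\<phi> \<lhd> g) = ccod B \<phi> \<odot> g"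
  using assms by (auto simp: lwhisker_def rwhisker_def)

lemma hid [simp]: "f \<in> Arr B \<Longrightarrow> g \<in> Arr B \<Longrightarrow> src B g = trg B f \<Longrightarrow> id2 B g \<star> id2 B f = id2 B (g \<odot> f)"
  using hcomp_id2[of f _ _ g] by (auto simp: arrs_def)

lemma wid [simp]:
  assumes "f \<in> Arr B" "g \<in> Arr B" "src B g = trg B f"
  shows "g \<rhd> id2 B f = id2 B (g \<odot> f)" "id2 B g \<lhd> f = id2 B (g \<odot> f)"
  using assms by (auto simp: lwhisker_def rwhisker_def)

lemma whisker_vcomp:
  assumes "\<phi> \<in> Cell B" "\<psi> \<in> Cell B" "cdom B \<psi> = ccod B \<phi>" "g \<in> Arr B"
  shows "src B g = trg B (cdom B \<phi>) \<Longrightarrow> g \<rhd> (\<psi> \<cdot> \<phi>) = (g \<rhd> \<psi>) \<cdot> (g \<rhd> \<phi>)"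
   "src B (cdom B \<phi>) = trg B g \<Longrightarrow> (\<psi> \<cdot> \<phi>) \<lhd> g = (\<psi> \<lhd> g) \<cdot> (\<phi> \<lhd> g)"
  using assms by (auto simp: lwhisker_def rwhisker_def inter)

lemma unit1 [simp]:
  "f \<in> Arr B \<Longrightarrow> Y = trg B f \<Longrightarrow> id1 B Y \<odot> f = f"
  "f \<in> Arr B \<Longrightarrow> X = src B f \<Longrightarrow> f \<odot> id1 B X = f"
  using unit_left unit_right by (auto simp: arrs_def)
lemma unit2 [simp]:
  "\<phi> \<in> Cell B \<Longrightarrow> Y = trg B (cdom B \<phi>) \<Longrightarrow> id1 B Y \<rhd> \<phi> = \<phi>"
  "\<phi> \<in> Cell B \<Longrightarrow> X = src B (cdom B \<phi>) \<Longrightarrow> \<phi> \<lhd> id1 B X = \<phi>"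
  using unit_left_cell unit_right_cell by (auto simp: arrs_def cells_def)

lemma assoc_simps [simp]:
  assumes "f \<in> Arr B" "g \<in> Arr B" "h \<in> Arr B" "src B g = trg B f" "src B h = trg B g"
  shows "assoc B h g f \<in> Cell B" "cdom B (assoc B h g f) = (h \<odot> g) \<odot> f" "ccod B (assoc B h g f) = h \<odot> g \<odot> f"
   "assoc_inv B h g f \<in> Cell B" "cdom B (assoc_inv B h g f) = h \<odot> g \<odot> f" "ccod B (assoc_inv B h g f) = (h \<odot> g) \<odot> f"
   "assoc_inv B h g f \<cdot> assoc B h g f = id2 B ((h \<odot> g) \<odot> f)"
   "assoc B h g f \<cdot> assoc_inv B h g f = id2 B (h \<odot> (g \<odot> f))"
  using assms assoc_cell[of f "src B f" "trg B f" g "trg B g" h "trg B h"] assoc_inv_cell[of f "src B f" "trg B f" g "trg B g" h "trg B h"]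
   assoc_inverse[of f "src B f" "trg B f" g "trg B g" h "trg B h"]
  by (auto simp: arrs_def cells_def)

lemma reassoc:
  assumes "x \<cdot> y = z" "x \<in> Cell B" "y \<in> Cell B" "t \<in> Cell B" "cdom B x = ccod B y" "cdom B y = ccod B t"
  shows "x \<cdot> (y \<cdot> t) = z \<cdot> t"
  using assms vcomp_assoc[of t y x] by simp

lemma assoc_cancel [simp]:
  assumes "f \<in> Arr B" "g \<in> Arr B" "h \<in> Arr B" "src B g = trg B f" "src B h = trg B g" "t \<in> Cell B"
  shows "ccod B t = (h \<odot> g) \<odot> f \<Longrightarrow> assoc_inv B h g f \<cdot> (assoc B h g f \<cdot> t) = t"
   "ccod B t = h \<odot> g \<odot> f \<Longrightarrow> assoc B h g f \<cdot> (assoc_inv B h g f \<cdot> t) = t"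
  using assms by (subst reassoc[OF assoc_simps(7)] reassoc[OF assoc_simps(8)]; simp)+

lemma nat1:
  assumes "\<phi> \<in> Cell B" "\<psi> \<in> Cell B" "\<chi> \<in> Cell B" "src B (cdom B \<psi>) = trg B (cdom B \<phi>)" "src B (cdom B \<chi>) = trg B (cdom B \<psi>)"
    "f = cdom B \<phi>" "f' = ccod B \<phi>" "g = cdom B \<psi>" "g' = ccod B \<psi>" "h = cdom B \<chi>" "h' = ccod B \<chi>"
  shows "assoc B h' g' f' \<cdot> ((\<chi> \<star> \<psi>) \<star> \<phi>) = (\<chi> \<star> (\<psi> \<star> \<phi>)) \<cdot> assoc B h g f"
  using assoc_natural[of "cdom B \<phi>" "src B (cdom B \<phi>)" "trg B (cdom B \<phi>)" "cdom B \<psi>" "trg B (cdom B \<psi>)"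
    "cdom B \<chi>" "trg B (cdom B \<chi>)" \<phi> "ccod B \<phi>" \<psi> "ccod B \<psi>" \<chi> "ccod B \<chi>"] assms by (auto simp: arrs_def cells_def)

lemma conj_eq:
  assumes "a' \<cdot> x = y \<cdot> a" "x \<in> Cell B" "y \<in> Cell B" "a \<in> Cell B" "b \<in> Cell B" "a' \<in> Cell B" "b' \<in> Cell B"
    "b' \<cdot> a' = id2 B (ccod B x)" "a \<cdot> b = id2 B (cdom B y)"
    "cdom B a' = ccod B x" "cdom B a = cdom B x" "ccod B a = cdom B y" "cdom B b' = ccod B a'"
    "cdom B b = cdom B y" "ccod B b = cdom B a"
  shows "x \<cdot> b = b' \<cdot> y"
proof -
  have "x \<cdot> b = (b' \<cdot> a') \<cdot> (x \<cdot> b)" using assms by simp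
  also have "\<dots> = b' \<cdot> ((a' \<cdot> x) \<cdot> b)" using assms(2-7,9-) by simp
  also have "\<dots> = b' \<cdot> (y \<cdot> a \<cdot> b)" unfolding assms(1) using assms(2-7,9-)
    by (smt (verit, ccfv_SIG) assms(1) vcomp_assoc vcomp_simps)
  also have "\<dots> = b' \<cdot> y" using assms by (metis vcomp_id(1) vcomp_simps)
  finally show ?thesis .
qed

lemma nat2:
  assumes "\<phi> \<in> Cell B" "\<psi> \<in> Cell B" "\<chi> \<in> Cell B" "src B (cdom B \<psi>) = trg B (cdom B \<phi>)" "src B (cdom B \<chi>) = trg B (cdom B \<psi>)"
    "f = cdom B \<phi>" "f' = ccod B \<phi>" "g = cdom B \<psi>" "g' = ccod B \<psi>" "h = cdom B \<chi>" "h' = ccod B \<chi>"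
  shows "((\<chi> \<star> \<psi>) \<star> \<phi>) \<cdot> assoc_inv B h g f = assoc_inv B h' g' f' \<cdot> (\<chi> \<star> (\<psi> \<star> \<phi>))"
  by (rule conj_eq[OF nat1, of \<phi> \<psi> \<chi>]) (use assms in auto)

lemma pent0:
  assumes "f \<in> Arr B" "g \<in> Arr B" "h \<in> Arr B" "k \<in> Arr B" "src B g = trg B f" "src B h = trg B g" "src B k = trg B h"
  shows "assoc B k h (g \<odot> f) \<cdot> assoc B (k \<odot> h) g f =
      (k \<rhd> assoc B h g f) \<cdot> assoc B k (h \<odot> g) f \<cdot> (assoc B k h g \<lhd> f)"
  using pentagon[of f "src B f" "trg B f" g "trg B g" h "trg B h" k "trg B k"] assms by (auto simp: arrs_def)

lemma tri [simp]: "f \<in> Arr B \<Longrightarrow> g \<in> Arr B \<Longrightarrow> src B g = trg B f \<Longrightarrow> Y = trg B f \<Longrightarrow> assoc B g (id1 B Y) f = id2 B (g \<odot> f)"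
  using triangle by (auto simp: arrs_def)

lemma invI:
  assumes "f \<in> Arr B" "g \<in> Arr B" "h \<in> Arr B" "src B g = trg B f" "src B h = trg B g" "(h \<odot> g) \<odot> f = h \<odot> g \<odot> f" "assoc B h g f = id2 B (h \<odot> g \<odot> f)"
  shows "assoc_inv B h g f = id2 B (h \<odot> g \<odot> f)"
  by (metis (no_types) assms assoc_simps(4) assoc_simps(5) assoc_simps(7) vcomp_id(1))

lemma idem:
  assumes "f \<in> Arr B" "g \<in> Arr B" "h \<in> Arr B" "src B g = trg B f" "src B h = trg B g" "(h \<odot> g) \<odot> f = h \<odot> g \<odot> f"
   "assoc B h g f \<cdot> assoc B h g f = assoc B h g f"
  shows "assoc B h g f = id2 B (h \<odot> g \<odot> f)"
  by (metis (no_types) assms assoc_simps(1-3,7) assoc_cancel(1))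

lemma kelly [simp]:
  assumes "f \<in> Arr B" "g \<in> Arr B" "src B g = trg B f"
  shows "Y = trg B g \<Longrightarrow> assoc B (id1 B Y) g f = id2 B (g \<odot> f)" "X = src B f \<Longrightarrow> assoc B g f (id1 B X) = id2 B (g \<odot> f)"
proof -
  have "assoc B (id1 B (trg B g)) g f = id2 B (id1 B (trg B g) \<odot> g \<odot> f)"
    apply (rule idem) using assms pent0[of f g "id1 B (trg B g)" "id1 B (trg B g)"] by auto
  then show "Y = trg B g \<Longrightarrow> assoc B (id1 B Y) g f = id2 B (g \<odot> f)" using assms by simp
  have "assoc B g f (id1 B (src B f)) = id2 B (g \<odot> f \<odot> id1 B (src B f))"
    apply (rule idem) using assms pent0[of "id1 B (src B f)" "id1 B (src B f)" f g] by auto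
  then show "X = src B f \<Longrightarrow> assoc B g f (id1 B X) = id2 B (g \<odot> f)" using assms by simp
qed

lemma kelly_inv [simp]:
  assumes "f \<in> Arr B" "g \<in> Arr B" "src B g = trg B f"
  shows "Y = trg B g \<Longrightarrow> assoc_inv B (id1 B Y) g f = id2 B (g \<odot> f)" "X = src B f \<Longrightarrow> assoc_inv B g f (id1 B X) = id2 B (g \<odot> f)"
   "Y = trg B f \<Longrightarrow> assoc_inv B g (id1 B Y) f = id2 B (g \<odot> f)"
  using assms by (subst invI; simp)+

lemma whisker_cancel:
  assumes "f \<in> Arr B" "g \<in> Arr B" "h \<in> Arr B" "src B g = trg B f" "src B h = trg B g" "k \<in> Arr B"
  shows "src B k = trg B h \<Longrightarrow> (k \<rhd> assoc B h g f) \<cdot> (k \<rhd> assoc_inv B h g f) = id2 B (k \<odot> h \<odot> g \<odot> f)"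
   "src B k = trg B h \<Longrightarrow> (k \<rhd> assoc_inv B h g f) \<cdot> (k \<rhd> assoc B h g f) = id2 B (k \<odot> (h \<odot> g) \<odot> f)"
   "trg B k = src B f \<Longrightarrow> (assoc B h g f \<lhd> k) \<cdot> (assoc_inv B h g f \<lhd> k) = id2 B ((h \<odot> g \<odot> f) \<odot> k)"
   "trg B k = src B f \<Longrightarrow> (assoc_inv B h g f \<lhd> k) \<cdot> (assoc B h g f \<lhd> k) = id2 B (((h \<odot> g) \<odot> f) \<odot> k)"
  using assms by (auto simp: whisker_vcomp[symmetric])

lemma cancel_l: "a \<cdot> x = a \<cdot> y \<Longrightarrow> b \<cdot> a = id2 B (cdom B a) \<Longrightarrow> x \<in> Cell B \<Longrightarrow> y \<in> Cell B \<Longrightarrow> a \<in> Cell B \<Longrightarrow> b \<in> Cell B \<Longrightarrow>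
   cdom B a = ccod B x \<Longrightarrow> cdom B a = ccod B y \<Longrightarrow> cdom B b = ccod B a \<Longrightarrow> x = y"
  by (metis vcomp_assoc vcomp_id(2))
lemma cancel_r: "x \<cdot> a = y \<cdot> a \<Longrightarrow> a \<cdot> b = id2 B (ccod B a) \<Longrightarrow> x \<in> Cell B \<Longrightarrow> y \<in> Cell B \<Longrightarrow> a \<in> Cell B \<Longrightarrow> b \<in> Cell B \<Longrightarrow>
   cdom B x = ccod B a \<Longrightarrow> cdom B y = ccod B a \<Longrightarrow> cdom B a = ccod B b \<Longrightarrow> x = y"
  by (metis vcomp_assoc vcomp_id(1))

lemma pent1:
  assumes "f \<in> Arr B" "g \<in> Arr B" "h \<in> Arr B" "k \<in> Arr B" "src B g = trg B f" "src B h = trg B g" "src B k = trg B h"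
  shows "assoc_inv B k h (g \<odot> f) \<cdot> (k \<rhd> assoc B h g f) = assoc B (k \<odot> h) g f \<cdot> (assoc_inv B k h g \<lhd> f) \<cdot> assoc_inv B k (h \<odot> g) f"
proof (rule cancel_r[where a = "assoc B k (h \<odot> g) f" and b = "assoc_inv B k (h \<odot> g) f"],
      rule cancel_r[where a = "assoc B k h g \<lhd> f" and b = "assoc_inv B k h g \<lhd> f"])
  show "((assoc_inv B k h (g \<odot> f) \<cdot> (k \<rhd> assoc B h g f)) \<cdot> assoc B k (h \<odot> g) f) \<cdot> (assoc B k h g \<lhd> f) =
    ((assoc B (k \<odot> h) g f \<cdot> (assoc_inv B k h g \<lhd> f) \<cdot> assoc_inv B k (h \<odot> g) f) \<cdot> assoc B k (h \<odot> g) f) \<cdot> (assoc B k h g \<lhd> f)"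
    using assms by (simp add: pent0[symmetric] whisker_cancel)
qed (use assms in \<open>auto simp: whisker_cancel\<close>)

lemma pent2:
  assumes "f \<in> Arr B" "g \<in> Arr B" "h \<in> Arr B" "k \<in> Arr B" "src B g = trg B f" "src B h = trg B g" "src B k = trg B h"
  shows "(k \<rhd> assoc_inv B h g f) \<cdot> assoc B k h (g \<odot> f) = assoc B k (h \<odot> g) f \<cdot> (assoc B k h g \<lhd> f) \<cdot> assoc_inv B (k \<odot> h) g f"
proof (rule cancel_r[where a = "assoc B (k \<odot> h) g f" and b = "assoc_inv B (k \<odot> h) g f"])
  show "((k \<rhd> assoc_inv B h g f) \<cdot> assoc B k h (g \<odot> f)) \<cdot> assoc B (k \<odot> h) g f =
     (assoc B k (h \<odot> g) f \<cdot> (assoc B k h g \<lhd> f) \<cdot> assoc_inv B (k \<odot> h) g f) \<cdot> assoc B (k \<odot> h) g f"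
    using assms by (simp add: pent0 reassoc[OF whisker_cancel(2)])
qed (use assms in \<open>auto simp: whisker_cancel\<close>)

end

context normal_bicategory
begin

lemmas wv = whisker_vcomp

lemma nat_l:
  assumes "\<phi> \<in> Cell B" "g \<in> Arr B" "h \<in> Arr B" "src B g = trg B (cdom B \<phi>)" "src B h = trg B g"
    "f = cdom B \<phi>" "f' = ccod B \<phi>"
  shows "assoc B h g f' \<cdot> ((h \<odot> g) \<rhd> \<phi>) = (h \<rhd> (g \<rhd> \<phi>)) \<cdot> assoc B h g f"
  using nat1[of \<phi> "id2 B g" "id2 B h" f f' g g h h] assms by (simp add: lwhisker_def)
lemma nat_m:
  assumes "\<phi> \<in> Cell B" "f \<in> Arr B" "h \<in> Arr B" "src B (cdom B \<phi>) = trg B f" "src B h = trg B (cdom B \<phi>)"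
    "g = cdom B \<phi>" "g' = ccod B \<phi>"
  shows "assoc B h g' f \<cdot> ((h \<rhd> \<phi>) \<lhd> f) = (h \<rhd> (\<phi> \<lhd> f)) \<cdot> assoc B h g f"
  using nat1[of "id2 B f" \<phi> "id2 B h" f f g g' h h] assms by (simp add: lwhisker_def rwhisker_def)
lemma nat_r:
  assumes "\<phi> \<in> Cell B" "f \<in> Arr B" "g \<in> Arr B" "src B (cdom B \<phi>) = trg B g" "src B g = trg B f"
    "h = cdom B \<phi>" "h' = ccod B \<phi>"
  shows "assoc B h' g f \<cdot> ((\<phi> \<lhd> g) \<lhd> f) = (\<phi> \<lhd> (g \<odot> f)) \<cdot> assoc B h g f"
  using nat1[of "id2 B f" "id2 B g" \<phi> f f g g h h'] assms by (simp add: rwhisker_def)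
lemma nat_m':
  assumes "\<phi> \<in> Cell B" "f \<in> Arr B" "h \<in> Arr B" "src B (cdom B \<phi>) = trg B f" "src B h = trg B (cdom B \<phi>)"
    "g = cdom B \<phi>" "g' = ccod B \<phi>"
  shows "assoc_inv B h g' f \<cdot> (h \<rhd> (\<phi> \<lhd> f)) = ((h \<rhd> \<phi>) \<lhd> f) \<cdot> assoc_inv B h g f"
  using nat2[of "id2 B f" \<phi> "id2 B h" f f g g' h h] assms by (simp add: lwhisker_def rwhisker_def)
lemma nat_r':
  assumes "\<phi> \<in> Cell B" "f \<in> Arr B" "g \<in> Arr B" "src B (cdom B \<phi>) = trg B g" "src B g = trg B f"
    "h = cdom B \<phi>" "h' = ccod B \<phi>"
  shows "assoc_inv B h' g f \<cdot> (\<phi> \<lhd> (g \<odot> f)) = ((\<phi> \<lhd> g) \<lhd> f) \<cdot> assoc_inv B h g f"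
  using nat2[of "id2 B f" "id2 B g" \<phi> f f g g h h'] assms by (simp add: rwhisker_def)
lemma slide:
  assumes "\<phi> \<in> Cell B" "\<psi> \<in> Cell B" "src B (cdom B \<psi>) = trg B (cdom B \<phi>)"
   "f = cdom B \<phi>" "f' = ccod B \<phi>" "g = cdom B \<psi>" "g' = ccod B \<psi>"
  shows "(\<psi> \<lhd> f') \<cdot> (g \<rhd> \<phi>) = (g' \<rhd> \<phi>) \<cdot> (\<psi> \<lhd> f)"
  using assms by (simp add: lwhisker_def rwhisker_def inter)

end

text \<open>The unit and counit of the adjunction between composition with \<open>f\<close> and with \<open>F\<close>, at \<open>k\<close>, are
  \<open>un k : k \<rightarrow> F (f k)\<close> and \<open>co k : f (F k) \<rightarrow> k\<close>.\<close>

locale adj = normal_bicategory +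
  fixes f F \<eta> \<epsilon> assumes A: "adjunction B f F \<eta> \<epsilon>"
begin

abbreviation "X \<equiv> src B f"
abbreviation "Y \<equiv> trg B f"
lemma adj_simps [simp]:
  "f \<in> Arr B" "F \<in> Arr B" "src B F = Y" "trg B F = X" "\<eta> \<in> Cell B" "\<epsilon> \<in> Cell B"
  "cdom B \<eta> = id1 B X" "ccod B \<eta> = F \<odot> f" "cdom B \<epsilon> = f \<odot> F" "ccod B \<epsilon> = id1 B Y"
  "(\<epsilon> \<lhd> f) \<cdot> assoc_inv B f F f \<cdot> (f \<rhd> \<eta>) = id2 B f"
  "(F \<rhd> \<epsilon>) \<cdot> assoc B F f F \<cdot> (\<eta> \<lhd> F) = id2 B F"
  using A by (auto simp: adjunction_def arrs_def cells_def)

definition "un k = assoc B F f k \<cdot> (\<eta> \<lhd> k)"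
definition "co k = (\<epsilon> \<lhd> k) \<cdot> assoc_inv B f F k"

lemma un_simps [simp]:
  assumes "k \<in> Arr B" "trg B k = X"
  shows "un k \<in> Cell B" "cdom B (un k) = k" "ccod B (un k) = F \<odot> f \<odot> k"
  using assms by (auto simp: un_def)
lemma co_simps [simp]:
  assumes "k \<in> Arr B" "trg B k = Y"
  shows "co k \<in> Cell B" "ccod B (co k) = k" "cdom B (co k) = f \<odot> F \<odot> k"
  using assms by (auto simp: co_def)

lemma co_nat:
  assumes "\<phi> \<in> Cell B" "trg B (cdom B \<phi>) = Y" "k = cdom B \<phi>" "k' = ccod B \<phi>"
  shows "co k' \<cdot> (f \<rhd> (F \<rhd> \<phi>)) = \<phi> \<cdot> co k"
proof -
  have "assoc_inv B f F k' \<cdot> (f \<rhd> (F \<rhd> \<phi>)) = ((f \<odot> F) \<rhd> \<phi>) \<cdot> assoc_inv B f F k"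
    using nat2[of \<phi> "id2 B F" "id2 B f" k k' F F f f] assms by (simp add: lwhisker_def)
  then have "co k' \<cdot> (f \<rhd> (F \<rhd> \<phi>)) = ((\<epsilon> \<lhd> k') \<cdot> ((f \<odot> F) \<rhd> \<phi>)) \<cdot> assoc_inv B f F k"
    unfolding co_def using assms by simp
  moreover have "(\<epsilon> \<lhd> k') \<cdot> ((f \<odot> F) \<rhd> \<phi>) = \<phi> \<cdot> (\<epsilon> \<lhd> k)"
    using assms slide[of \<phi> \<epsilon> k k'] by simp
  ultimately have "co k' \<cdot> (f \<rhd> (F \<rhd> \<phi>)) = (\<phi> \<cdot> (\<epsilon> \<lhd> k)) \<cdot> assoc_inv B f F k" by (simp only:)
  then show ?thesis unfolding co_def using assms by simp
qed

lemma T1: assumes "k \<in> Arr B" "trg B k = X"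
  shows "co (f \<odot> k) \<cdot> (f \<rhd> un k) = id2 B (f \<odot> k)"
proof -
  have "co (f \<odot> k) \<cdot> (f \<rhd> un k) = (\<epsilon> \<lhd> (f \<odot> k)) \<cdot> (assoc_inv B f F (f \<odot> k) \<cdot> (f \<rhd> assoc B F f k)) \<cdot> (f \<rhd> (\<eta> \<lhd> k))"
    using assms by (simp add: un_def co_def wv)
  also have "\<dots> = ((\<epsilon> \<lhd> (f \<odot> k)) \<cdot> assoc B (f \<odot> F) f k) \<cdot> (assoc_inv B f F f \<lhd> k) \<cdot> (assoc_inv B f (F \<odot> f) k \<cdot> (f \<rhd> (\<eta> \<lhd> k)))"
    using assms by (simp add: pent1)
  also have "\<dots> = ((\<epsilon> \<lhd> f) \<lhd> k) \<cdot> (assoc_inv B f F f \<lhd> k) \<cdot> ((f \<rhd> \<eta>) \<lhd> k)"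
    using assms by (simp add: nat_r[symmetric] nat_m')
  also have "\<dots> = ((\<epsilon> \<lhd> f) \<cdot> assoc_inv B f F f \<cdot> (f \<rhd> \<eta>)) \<lhd> k"
    using assms by (simp add: wv del: adj_simps(11))
  finally show ?thesis using assms by simp
qed

lemma T2: assumes "k \<in> Arr B" "trg B k = Y"
  shows "(F \<rhd> co k) \<cdot> un (F \<odot> k) = id2 B (F \<odot> k)"
proof -
  have "(F \<rhd> co k) \<cdot> un (F \<odot> k) = (F \<rhd> (\<epsilon> \<lhd> k)) \<cdot> ((F \<rhd> assoc_inv B f F k) \<cdot> assoc B F f (F \<odot> k)) \<cdot> (\<eta> \<lhd> (F \<odot> k))"
    using assms by (simp add: un_def co_def wv)
  also have "\<dots> = ((F \<rhd> (\<epsilon> \<lhd> k)) \<cdot> assoc B F (f \<odot> F) k) \<cdot> (assoc B F f F \<lhd> k) \<cdot> (assoc_inv B (F \<odot> f) F k \<cdot> (\<eta> \<lhd> (F \<odot> k)))"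
    using assms by (simp add: pent2)
  also have "\<dots> = ((F \<rhd> \<epsilon>) \<lhd> k) \<cdot> (assoc B F f F \<lhd> k) \<cdot> ((\<eta> \<lhd> F) \<lhd> k)"
    using assms by (simp add: nat_m[symmetric] nat_r')
  also have "\<dots> = ((F \<rhd> \<epsilon>) \<cdot> assoc B F f F \<cdot> (\<eta> \<lhd> F)) \<lhd> k"
    using assms by (simp add: wv del: adj_simps(12))
  finally show ?thesis using assms by simp
qed

end

locale adj2 = f: adj B f F \<eta> \<epsilon> + g: adj B g G \<eta>' \<epsilon>'
  for B (structure) and f F \<eta> \<epsilon> g G \<eta>' \<epsilon>' + assumes comp[simp]: "src B g = trg B f"
begin

definition "H = assoc_inv B F G (g \<odot> f) \<cdot> (F \<rhd> g.un f) \<cdot> \<eta>"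
definition "E = \<epsilon>' \<cdot> (g \<rhd> f.co G) \<cdot> assoc B g f (F \<odot> G)"

lemma HE_simps [simp]:
  "H \<in> Cell B" "cdom B H = id1 B (src B f)" "ccod B H = (F \<odot> G) \<odot> g \<odot> f"
  "E \<in> Cell B" "cdom B E = (g \<odot> f) \<odot> F \<odot> G" "ccod B E = id1 B (trg B g)"
  by (auto simp: H_def E_def)

lemma E_form:
  assumes "k \<in> Arr B" "trg B k = trg B g"
  shows "(E \<lhd> k) \<cdot> assoc_inv B (g \<odot> f) (F \<odot> G) k =
    g.co k \<cdot> (g \<rhd> f.co (G \<odot> k)) \<cdot> (g \<rhd> (f \<rhd> assoc B F G k)) \<cdot> assoc B g f ((F \<odot> G) \<odot> k)"
proof -
  have 1: "f.co (G \<odot> k) \<cdot> (f \<rhd> assoc B F G k) = (f.co G \<lhd> k) \<cdot> assoc_inv B f (F \<odot> G) k"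
  proof -
    have "f.co (G \<odot> k) \<cdot> (f \<rhd> assoc B F G k) = (\<epsilon> \<lhd> (G \<odot> k)) \<cdot> (assoc_inv B f F (G \<odot> k) \<cdot> (f \<rhd> assoc B F G k))"
      using assms by (simp add: f.co_def)
    also have "\<dots> = ((\<epsilon> \<lhd> (G \<odot> k)) \<cdot> assoc B (f \<odot> F) G k) \<cdot> (assoc_inv B f F G \<lhd> k) \<cdot> assoc_inv B f (F \<odot> G) k"
      using assms by (simp add: f.pent1)
    also have "\<dots> = (f.co G \<lhd> k) \<cdot> assoc_inv B f (F \<odot> G) k"
      using assms by (simp add: f.co_def f.wv f.nat_r[symmetric])
    finally show ?thesis .
  qed
  have "g.co k \<cdot> (g \<rhd> f.co (G \<odot> k)) \<cdot> (g \<rhd> (f \<rhd> assoc B F G k)) \<cdot> assoc B g f ((F \<odot> G) \<odot> k)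
    = g.co k \<cdot> (g \<rhd> (f.co (G \<odot> k) \<cdot> (f \<rhd> assoc B F G k))) \<cdot> assoc B g f ((F \<odot> G) \<odot> k)"
    using assms by (simp add: f.wv)
  also have "\<dots> = g.co k \<cdot> (g \<rhd> (f.co G \<lhd> k)) \<cdot> ((g \<rhd> assoc_inv B f (F \<odot> G) k) \<cdot> assoc B g f ((F \<odot> G) \<odot> k))"
    unfolding 1 using assms by (simp add: f.wv)
  also have "\<dots> = (\<epsilon>' \<lhd> k) \<cdot> assoc_inv B g G k \<cdot> ((g \<rhd> (f.co G \<lhd> k)) \<cdot> assoc B g (f \<odot> F \<odot> G) k) \<cdot> (assoc B g f (F \<odot> G) \<lhd> k) \<cdot> assoc_inv B (g \<odot> f) (F \<odot> G) k"
    using assms by (simp add: f.pent2 g.co_def)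
  also have "(g \<rhd> (f.co G \<lhd> k)) \<cdot> assoc B g (f \<odot> F \<odot> G) k = assoc B g G k \<cdot> ((g \<rhd> f.co G) \<lhd> k)"
    using assms by (simp add: f.nat_m)
  finally show ?thesis using assms by (simp add: E_def f.wv)
qed

lemma H_form:
  assumes "k \<in> Arr B" "trg B k = src B f"
  shows "(F \<rhd> (G \<rhd> assoc B g f k)) \<cdot> assoc B F G ((g \<odot> f) \<odot> k) \<cdot> assoc B (F \<odot> G) (g \<odot> f) k \<cdot> (H \<lhd> k) =
    (F \<rhd> g.un (f \<odot> k)) \<cdot> f.un k"
proof -
  have 1: "(G \<rhd> assoc B g f k) \<cdot> assoc B G (g \<odot> f) k \<cdot> (g.un f \<lhd> k) = g.un (f \<odot> k)"
  proof -
    have "(G \<rhd> assoc B g f k) \<cdot> assoc B G (g \<odot> f) k \<cdot> (g.un f \<lhd> k) =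
      ((G \<rhd> assoc B g f k) \<cdot> assoc B G (g \<odot> f) k \<cdot> (assoc B G g f \<lhd> k)) \<cdot> ((\<eta>' \<lhd> f) \<lhd> k)"
      using assms by (simp add: g.un_def f.wv)
    also have "\<dots> = assoc B G g (f \<odot> k) \<cdot> (assoc B (G \<odot> g) f k \<cdot> ((\<eta>' \<lhd> f) \<lhd> k))"
      using assms by (subst f.pent0[symmetric]) auto
    also have "\<dots> = g.un (f \<odot> k)" using assms by (simp add: g.un_def f.nat_r)
    finally show ?thesis .
  qed
  have "(F \<rhd> (G \<rhd> assoc B g f k)) \<cdot> assoc B F G ((g \<odot> f) \<odot> k) \<cdot> assoc B (F \<odot> G) (g \<odot> f) k \<cdot> (H \<lhd> k) =
     (F \<rhd> (G \<rhd> assoc B g f k)) \<cdot> (assoc B F G ((g \<odot> f) \<odot> k) \<cdot> assoc B (F \<odot> G) (g \<odot> f) k) \<cdot> (H \<lhd> k)"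
    using assms by simp
  also have "\<dots> = (F \<rhd> (G \<rhd> assoc B g f k)) \<cdot> (F \<rhd> assoc B G (g \<odot> f) k) \<cdot> assoc B F (G \<odot> g \<odot> f) k \<cdot> ((assoc B F G (g \<odot> f) \<cdot> H) \<lhd> k)"
    using assms by (subst f.pent0) (auto simp: f.wv)
  also have "\<dots> = (F \<rhd> (G \<rhd> assoc B g f k)) \<cdot> (F \<rhd> assoc B G (g \<odot> f) k) \<cdot> (assoc B F (G \<odot> g \<odot> f) k \<cdot> ((F \<rhd> g.un f) \<lhd> k)) \<cdot> (\<eta> \<lhd> k)"
    using assms by (simp add: H_def f.wv)
  also have "\<dots> = (F \<rhd> ((G \<rhd> assoc B g f k) \<cdot> assoc B G (g \<odot> f) k \<cdot> (g.un f \<lhd> k))) \<cdot> f.un k"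
    using assms by (simp add: f.wv f.nat_m f.un_def)
  finally show ?thesis unfolding 1 .
qed

lemma tri1: "(E \<lhd> (g \<odot> f)) \<cdot> assoc_inv B (g \<odot> f) (F \<odot> G) (g \<odot> f) \<cdot> ((g \<odot> f) \<rhd> H) = id2 B (g \<odot> f)"
proof -
  have "(E \<lhd> (g \<odot> f)) \<cdot> assoc_inv B (g \<odot> f) (F \<odot> G) (g \<odot> f) \<cdot> ((g \<odot> f) \<rhd> H) =
    g.co (g \<odot> f) \<cdot> (g \<rhd> f.co (G \<odot> g \<odot> f)) \<cdot> (g \<rhd> (f \<rhd> assoc B F G (g \<odot> f))) \<cdot> (assoc B g f ((F \<odot> G) \<odot> g \<odot> f) \<cdot> ((g \<odot> f) \<rhd> H))"
    using f.reassoc[OF E_form, of "g \<odot> f" "((g \<odot> f) \<rhd> H)"] by simp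
  also have "assoc B g f ((F \<odot> G) \<odot> g \<odot> f) \<cdot> ((g \<odot> f) \<rhd> H) = g \<rhd> (f \<rhd> H)"
    by (simp add: f.nat_l)
  also have "g.co (g \<odot> f) \<cdot> (g \<rhd> f.co (G \<odot> g \<odot> f)) \<cdot> (g \<rhd> (f \<rhd> assoc B F G (g \<odot> f))) \<cdot> (g \<rhd> (f \<rhd> H))
     = g.co (g \<odot> f) \<cdot> (g \<rhd> (f.co (G \<odot> g \<odot> f) \<cdot> (f \<rhd> (assoc B F G (g \<odot> f) \<cdot> H))))"
    by (simp add: f.wv)
  also have "assoc B F G (g \<odot> f) \<cdot> H = (F \<rhd> g.un f) \<cdot> \<eta>" by (simp add: H_def)
  also have "f.co (G \<odot> g \<odot> f) \<cdot> (f \<rhd> ((F \<rhd> g.un f) \<cdot> \<eta>)) = (f.co (G \<odot> g \<odot> f) \<cdot> (f \<rhd> (F \<rhd> g.un f))) \<cdot> (f \<rhd> \<eta>)"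
    by (simp add: f.wv)
  also have "\<dots> = g.un f \<cdot> (f.co f \<cdot> (f \<rhd> \<eta>))" by (simp add: f.co_nat)
  also have "\<dots> = g.un f" by (simp add: f.co_def)
  also have "g.co (g \<odot> f) \<cdot> (g \<rhd> g.un f) = id2 B (g \<odot> f)" by (rule g.T1) auto
  finally show ?thesis .
qed

lemma tri2: "((F \<odot> G) \<rhd> E) \<cdot> assoc B (F \<odot> G) (g \<odot> f) (F \<odot> G) \<cdot> (H \<lhd> (F \<odot> G)) = id2 B (F \<odot> G)"
proof -
  have nl: "((F \<odot> G) \<rhd> E) = (F \<rhd> (G \<rhd> E)) \<cdot> assoc B F G ((g \<odot> f) \<odot> F \<odot> G)"
    using f.nat_l[of E G F] by simp
  have "((F \<odot> G) \<rhd> E) \<cdot> assoc B (F \<odot> G) (g \<odot> f) (F \<odot> G) \<cdot> (H \<lhd> (F \<odot> G)) =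
     (F \<rhd> (G \<rhd> (\<epsilon>' \<cdot> (g \<rhd> f.co G)))) \<cdot> (F \<rhd> (G \<rhd> assoc B g f (F \<odot> G))) \<cdot> assoc B F G ((g \<odot> f) \<odot> F \<odot> G) \<cdot> assoc B (F \<odot> G) (g \<odot> f) (F \<odot> G) \<cdot> (H \<lhd> (F \<odot> G))"
    unfolding nl by (simp add: E_def f.wv)
  also have "\<dots> = (F \<rhd> (G \<rhd> (\<epsilon>' \<cdot> (g \<rhd> f.co G)))) \<cdot> (F \<rhd> g.un (f \<odot> F \<odot> G)) \<cdot> f.un (F \<odot> G)"
    by (subst H_form) auto
  also have "\<dots> = (F \<rhd> ((G \<rhd> \<epsilon>') \<cdot> ((G \<rhd> (g \<rhd> f.co G)) \<cdot> g.un (f \<odot> F \<odot> G)))) \<cdot> f.un (F \<odot> G)"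
    by (simp add: f.wv)
  also have "(G \<rhd> (g \<rhd> f.co G)) \<cdot> g.un (f \<odot> F \<odot> G) = g.un G \<cdot> f.co G"
  proof -
    have "(G \<rhd> (g \<rhd> f.co G)) \<cdot> g.un (f \<odot> F \<odot> G) = ((G \<rhd> (g \<rhd> f.co G)) \<cdot> assoc B G g (f \<odot> F \<odot> G)) \<cdot> (\<eta>' \<lhd> (f \<odot> F \<odot> G))"
      by (simp add: g.un_def)
    also have "\<dots> = assoc B G g G \<cdot> ((G \<odot> g) \<rhd> f.co G) \<cdot> (\<eta>' \<lhd> (f \<odot> F \<odot> G))"
      by (simp add: f.nat_l[symmetric])
    also have "((G \<odot> g) \<rhd> f.co G) \<cdot> (\<eta>' \<lhd> (f \<odot> F \<odot> G)) = (\<eta>' \<lhd> G) \<cdot> f.co G"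
      using f.slide[of "f.co G" \<eta>'] by simp
    finally show ?thesis by (simp add: g.un_def)
  qed
  also have "(G \<rhd> \<epsilon>') \<cdot> (g.un G \<cdot> f.co G) = ((G \<rhd> \<epsilon>') \<cdot> assoc B G g G \<cdot> (\<eta>' \<lhd> G)) \<cdot> f.co G"
    by (simp add: g.un_def del: g.adj_simps(12))
  also have "\<dots> = f.co G" by simp
  also have "(F \<rhd> f.co G) \<cdot> f.un (F \<odot> G) = id2 B (F \<odot> G)" by (rule f.T2) auto
  finally show ?thesis .
qed

lemma comp_adj: "adjunction B (g \<odot> f) (F \<odot> G) H E"
  using tri1 tri2 by (simp add: adjunction_def arrs_def cells_def)

end

context normal_bicategory
begin

lemma is_map_comp:
  assumes "is_map B f" "is_map B g" "src B g = trg B f" shows "is_map B (g \<odot> f)"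
proof -
  obtain F \<eta> \<epsilon> G \<eta>' \<epsilon>' where "adjunction B f F \<eta> \<epsilon>" "adjunction B g G \<eta>' \<epsilon>'"
    using assms by (auto simp: is_map_def)
  then interpret adj2 B f F \<eta> \<epsilon> g G \<eta>' \<epsilon>' by unfold_locales (use assms in auto)
  show ?thesis using comp_adj by (auto simp: is_map_def)
qed

lemma is_map_id: assumes "X \<in> Obj B" shows "is_map B (id1 B X)"
  unfolding is_map_def by (rule exI[of _ "id1 B X"], rule exI[of _ "id2 B (id1 B X)"], rule exI[of _ "id2 B (id1 B X)"])
    (use assms in \<open>simp add: adjunction_def arrs_def cells_def\<close>)

end

context normal_bicategory
begin

lemma Map_sel [simp]:
  "Obj (Map_bicat B) = Obj B" "src (Map_bicat B) = src B" "trg (Map_bicat B) = trg B"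
  "cdom (Map_bicat B) = cdom B" "ccod (Map_bicat B) = ccod B" "id1 (Map_bicat B) = id1 B" "id2 (Map_bicat B) = id2 B"
  "comp1 (Map_bicat B) = comp1 B" "vcomp (Map_bicat B) = vcomp B" "hcomp (Map_bicat B) = hcomp B"
  "assoc (Map_bicat B) = assoc B" "assoc_inv (Map_bicat B) = assoc_inv B"
  "f \<in> Arr (Map_bicat B) \<longleftrightarrow> f \<in> Arr B \<and> is_map B f"
  "\<phi> \<in> Cell (Map_bicat B) \<longleftrightarrow> \<phi> \<in> Cell B \<and> is_map B (cdom B \<phi>) \<and> is_map B (ccod B \<phi>)"
  by (auto simp: Map_bicat_def)

lemma Map_whisker [simp]: "lwhisker (Map_bicat B) = lwhisker B" "rwhisker (Map_bicat B) = rwhisker B"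
  by (auto simp: fun_eq_iff lwhisker_def rwhisker_def)

lemma normal_bicategory_Map: "normal_bicategory (Map_bicat B)"
proof
  fix X Y assume "X \<in> Obj (Map_bicat B)" "Y \<in> Obj (Map_bicat B)"
  show "category (hom_cat (Map_bicat B) X Y)"
    by (auto simp: category_def homset_def hom_cat_def arrs_iff)
qed (auto simp: arrs_iff cells_iff is_map_id is_map_comp inter nat1 pent0)

text \<open>\<open>hat S u R f \<alpha> k : u (R k) \<rightarrow> S (f k)\<close> is \<open>\<alpha> k\<close> rebracketed.  Pasting is compatible with it
  (\<open>hat_pasting\<close>), which reduces its associativity to the pentagon.\<close>

definition "hat S u R f \<alpha> k = assoc B S f k \<cdot> (\<alpha> \<lhd> k) \<cdot> assoc_inv B u R k"

lemma hat_simps [simp]: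
  assumes "S \<in> Arr B" "u \<in> Arr B" "R \<in> Arr B" "f \<in> Arr B" "\<alpha> \<in> Cell B" "cdom B \<alpha> = u \<odot> R" "ccod B \<alpha> = S \<odot> f"
    "src B u = trg B R" "src B S = trg B f" "src B R = src B f" "k \<in> Arr B" "trg B k = src B f"
  shows "hat S u R f \<alpha> k \<in> Cell B" "cdom B (hat S u R f \<alpha> k) = u \<odot> R \<odot> k" "ccod B (hat S u R f \<alpha> k) = S \<odot> f \<odot> k"
  using assms by (auto simp: hat_def)

definition sq where
  "sq R S f \<alpha> u \<longleftrightarrow> R \<in> Arr B \<and> S \<in> Arr B \<and> f \<in> Arr B \<and> u \<in> Arr B \<and> src B f = src B R \<and> src B u = trg B R \<and>
     trg B f = src B S \<and> trg B u = trg B S \<and> \<alpha> \<in> Cell B \<and> cdom B \<alpha> = u \<odot> R \<and> ccod B \<alpha> = S \<odot> f"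

lemma pasting_hat:
  assumes "sq R S f \<alpha> u" "sq S T g \<beta> v"
  shows "pasting B R S T g \<beta> v f \<alpha> u = hat T v S g \<beta> f \<cdot> (v \<rhd> \<alpha>) \<cdot> assoc B v u R"
  using assms by (auto simp: sq_def pasting_def hat_def)

lemma sq_pasting:
  assumes "sq R S f \<alpha> u" "sq S T g \<beta> v"
  shows "sq R T (g \<odot> f) (pasting B R S T g \<beta> v f \<alpha> u) (v \<odot> u)"
  using assms by (auto simp: sq_def pasting_def)

lemma hat_pasting:
  assumes "sq R S f \<alpha> u" "sq S T g \<beta> v" and k: "k \<in> Arr B" "trg B k = src B f"
  shows "(T \<rhd> assoc B g f k) \<cdot> hat T (v \<odot> u) R (g \<odot> f) (pasting B R S T g \<beta> v f \<alpha> u) k =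
    hat T v S g \<beta> (f \<odot> k) \<cdot> (v \<rhd> hat S u R f \<alpha> k) \<cdot> assoc B v u (R \<odot> k)"
proof -
  have [simp]: "R \<in> Arr B" "S \<in> Arr B" "f \<in> Arr B" "u \<in> Arr B" "src B f = src B R" "src B u = trg B R"
     "trg B f = src B S" "trg B u = trg B S" "\<alpha> \<in> Cell B" "cdom B \<alpha> = u \<odot> R" "ccod B \<alpha> = S \<odot> f"
     "T \<in> Arr B" "g \<in> Arr B" "v \<in> Arr B" "src B g = src B S" "src B v = trg B S"
     "trg B g = src B T" "trg B v = trg B T" "\<beta> \<in> Cell B" "cdom B \<beta> = v \<odot> S" "ccod B \<beta> = T \<odot> g" "k \<in> Arr B" "trg B k = src B R"
    using assms by (auto simp: sq_def)
  have "hat T v S g \<beta> (f \<odot> k) \<cdot> (v \<rhd> hat S u R f \<alpha> k) \<cdot> assoc B v u (R \<odot> k) =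
    hat T v S g \<beta> (f \<odot> k) \<cdot> (v \<rhd> assoc B S f k) \<cdot> (v \<rhd> (\<alpha> \<lhd> k)) \<cdot> ((v \<rhd> assoc_inv B u R k) \<cdot> assoc B v u (R \<odot> k))"
    by (simp add: hat_def[of S] wv)
  also have "\<dots> = hat T v S g \<beta> (f \<odot> k) \<cdot> (v \<rhd> assoc B S f k) \<cdot> ((v \<rhd> (\<alpha> \<lhd> k)) \<cdot> assoc B v (u \<odot> R) k) \<cdot> (assoc B v u R \<lhd> k) \<cdot> assoc_inv B (v \<odot> u) R k"
    by (simp add: pent2)
  also have "(v \<rhd> (\<alpha> \<lhd> k)) \<cdot> assoc B v (u \<odot> R) k = assoc B v (S \<odot> f) k \<cdot> ((v \<rhd> \<alpha>) \<lhd> k)"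
    by (simp add: nat_m)
  also have "hat T v S g \<beta> (f \<odot> k) \<cdot> (v \<rhd> assoc B S f k) \<cdot> (assoc B v (S \<odot> f) k \<cdot> ((v \<rhd> \<alpha>) \<lhd> k)) \<cdot> (assoc B v u R \<lhd> k) \<cdot> assoc_inv B (v \<odot> u) R k
    = assoc B T g (f \<odot> k) \<cdot> (\<beta> \<lhd> (f \<odot> k)) \<cdot> (assoc_inv B v S (f \<odot> k) \<cdot> (v \<rhd> assoc B S f k)) \<cdot> assoc B v (S \<odot> f) k \<cdot> ((v \<rhd> \<alpha>) \<lhd> k) \<cdot> (assoc B v u R \<lhd> k) \<cdot> assoc_inv B (v \<odot> u) R k"
    by (simp add: hat_def)
  also have "\<dots> = assoc B T g (f \<odot> k) \<cdot> ((\<beta> \<lhd> (f \<odot> k)) \<cdot> assoc B (v \<odot> S) f k) \<cdot> (assoc_inv B v S f \<lhd> k) \<cdot> ((v \<rhd> \<alpha>) \<lhd> k) \<cdot> (assoc B v u R \<lhd> k) \<cdot> assoc_inv B (v \<odot> u) R k"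
    by (simp add: pent1)
  also have "(\<beta> \<lhd> (f \<odot> k)) \<cdot> assoc B (v \<odot> S) f k = assoc B (T \<odot> g) f k \<cdot> ((\<beta> \<lhd> f) \<lhd> k)"
    by (simp add: nat_r)
  also have "assoc B T g (f \<odot> k) \<cdot> (assoc B (T \<odot> g) f k \<cdot> ((\<beta> \<lhd> f) \<lhd> k)) \<cdot> (assoc_inv B v S f \<lhd> k) \<cdot> ((v \<rhd> \<alpha>) \<lhd> k) \<cdot> (assoc B v u R \<lhd> k) \<cdot> assoc_inv B (v \<odot> u) R k
     = (assoc B T g (f \<odot> k) \<cdot> assoc B (T \<odot> g) f k) \<cdot> ((\<beta> \<lhd> f) \<lhd> k) \<cdot> (assoc_inv B v S f \<lhd> k) \<cdot> ((v \<rhd> \<alpha>) \<lhd> k) \<cdot> (assoc B v u R \<lhd> k) \<cdot> assoc_inv B (v \<odot> u) R k"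
    by simp
  also have "\<dots> = (T \<rhd> assoc B g f k) \<cdot> hat T (v \<odot> u) R (g \<odot> f) (pasting B R S T g \<beta> v f \<alpha> u) k"
    by (subst pent0) (auto simp: wv hat_def pasting_def)
  finally show ?thesis by simp
qed

lemma pasting_assoc:
  assumes "sq R S f \<alpha> u" "sq S T g \<beta> v" "sq T U h \<gamma> w"
  shows "(U \<rhd> assoc B h g f) \<cdot> pasting B R S U (h \<odot> g) (pasting B S T U h \<gamma> w g \<beta> v) (w \<odot> v) f \<alpha> u =
    pasting B R T U h \<gamma> w (g \<odot> f) (pasting B R S T g \<beta> v f \<alpha> u) (v \<odot> u) \<cdot> (assoc B w v u \<lhd> R)"
proof -
  have [simp]: "R \<in> Arr B" "S \<in> Arr B" "f \<in> Arr B" "u \<in> Arr B" "src B f = src B R" "src B u = trg B R"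
     "trg B f = src B S" "trg B u = trg B S" "\<alpha> \<in> Cell B" "cdom B \<alpha> = u \<odot> R" "ccod B \<alpha> = S \<odot> f"
     "T \<in> Arr B" "g \<in> Arr B" "v \<in> Arr B" "src B g = src B S" "src B v = trg B S"
     "trg B g = src B T" "trg B v = trg B T" "\<beta> \<in> Cell B" "cdom B \<beta> = v \<odot> S" "ccod B \<beta> = T \<odot> g"
     "U \<in> Arr B" "h \<in> Arr B" "w \<in> Arr B" "src B h = src B T" "src B w = trg B T"
     "trg B h = src B U" "trg B w = trg B U" "\<gamma> \<in> Cell B" "cdom B \<gamma> = w \<odot> T" "ccod B \<gamma> = U \<odot> h"
    using assms by (auto simp: sq_def)
  have [simp]: "pasting B S T U h \<gamma> w g \<beta> v \<in> Cell B" "cdom B (pasting B S T U h \<gamma> w g \<beta> v) = (w \<odot> v) \<odot> S" "ccod B (pasting B S T U h \<gamma> w g \<beta> v) = U \<odot> h \<odot> g"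
    using sq_pasting[OF assms(2,3)] by (auto simp: sq_def)
  let ?G = "hat U w T h \<gamma> (g \<odot> f)"
  have "(U \<rhd> assoc B h g f) \<cdot> pasting B R S U (h \<odot> g) (pasting B S T U h \<gamma> w g \<beta> v) (w \<odot> v) f \<alpha> u =
     ((U \<rhd> assoc B h g f) \<cdot> hat U (w \<odot> v) S (h \<odot> g) (pasting B S T U h \<gamma> w g \<beta> v) f) \<cdot> ((w \<odot> v) \<rhd> \<alpha>) \<cdot> assoc B (w \<odot> v) u R"
    by (subst pasting_hat[OF assms(1) sq_pasting[OF assms(2,3)]]) simp
  also have "\<dots> = ?G \<cdot> (w \<rhd> hat T v S g \<beta> f) \<cdot> (assoc B w v (S \<odot> f) \<cdot> ((w \<odot> v) \<rhd> \<alpha>)) \<cdot> assoc B (w \<odot> v) u R"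
    by (subst hat_pasting[OF assms(2,3)]) auto
  also have "assoc B w v (S \<odot> f) \<cdot> ((w \<odot> v) \<rhd> \<alpha>) = (w \<rhd> (v \<rhd> \<alpha>)) \<cdot> assoc B w v (u \<odot> R)"
    by (simp add: nat_l)
  also have "?G \<cdot> (w \<rhd> hat T v S g \<beta> f) \<cdot> ((w \<rhd> (v \<rhd> \<alpha>)) \<cdot> assoc B w v (u \<odot> R)) \<cdot> assoc B (w \<odot> v) u R =
    ?G \<cdot> (w \<rhd> hat T v S g \<beta> f) \<cdot> (w \<rhd> (v \<rhd> \<alpha>)) \<cdot> (w \<rhd> assoc B v u R) \<cdot> assoc B w (v \<odot> u) R \<cdot> (assoc B w v u \<lhd> R)"
    by (simp add: pent0)
  also have "\<dots> = pasting B R T U h \<gamma> w (g \<odot> f) (pasting B R S T g \<beta> v f \<alpha> u) (v \<odot> u) \<cdot> (assoc B w v u \<lhd> R)"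
    by (subst pasting_hat[OF sq_pasting[OF assms(1,2)] assms(3)], subst pasting_hat[OF assms(1,2)]) (simp add: wv)
  finally show ?thesis .
qed

lemma pasting_assoc_inv:
  assumes "sq R S f \<alpha> u" "sq S T g \<beta> v" "sq T U h \<gamma> w"
  shows "(U \<rhd> assoc_inv B h g f) \<cdot> pasting B R T U h \<gamma> w (g \<odot> f) (pasting B R S T g \<beta> v f \<alpha> u) (v \<odot> u) =
    pasting B R S U (h \<odot> g) (pasting B S T U h \<gamma> w g \<beta> v) (w \<odot> v) f \<alpha> u \<cdot> (assoc_inv B w v u \<lhd> R)"
proof -
  have *: "sq R U ((h \<odot> g) \<odot> f) (pasting B R S U (h \<odot> g) (pasting B S T U h \<gamma> w g \<beta> v) (w \<odot> v) f \<alpha> u) ((w \<odot> v) \<odot> u)"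
     "sq R U (h \<odot> g \<odot> f) (pasting B R T U h \<gamma> w (g \<odot> f) (pasting B R S T g \<beta> v f \<alpha> u) (v \<odot> u)) (w \<odot> v \<odot> u)"
    using assms by (blast intro: sq_pasting)+
  show ?thesis
    by (rule conj_eq[OF pasting_assoc[OF assms], symmetric])
      (use * assms in \<open>auto simp: sq_def whisker_cancel\<close>)
qed

lemma pasting_cell:
  assumes "sq R S f \<alpha> u" "sq S T g \<beta> v" "sq R S f' \<alpha>' u'" "sq S T g' \<beta>' v'"
    "\<phi> \<in> cells B f f'" "\<psi> \<in> cells B u u'" "\<phi>' \<in> cells B g g'" "\<psi>' \<in> cells B v v'"
    "(S \<rhd> \<phi>) \<cdot> \<alpha> = \<alpha>' \<cdot> (\<psi> \<lhd> R)" "(T \<rhd> \<phi>') \<cdot> \<beta> = \<beta>' \<cdot> (\<psi>' \<lhd> S)"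
  shows "(T \<rhd> (\<phi>' \<star> \<phi>)) \<cdot> pasting B R S T g \<beta> v f \<alpha> u = pasting B R S T g' \<beta>' v' f' \<alpha>' u' \<cdot> ((\<psi>' \<star> \<psi>) \<lhd> R)"
proof -
  have [simp]: "R \<in> Arr B" "S \<in> Arr B" "f \<in> Arr B" "u \<in> Arr B" "src B f = src B R" "src B u = trg B R"
     "trg B f = src B S" "trg B u = trg B S" "\<alpha> \<in> Cell B" "cdom B \<alpha> = u \<odot> R" "ccod B \<alpha> = S \<odot> f"
     "T \<in> Arr B" "g \<in> Arr B" "v \<in> Arr B" "src B g = src B S" "src B v = trg B S"
     "trg B g = src B T" "trg B v = trg B T" "\<beta> \<in> Cell B" "cdom B \<beta> = v \<odot> S" "ccod B \<beta> = T \<odot> g"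
     "f' \<in> Arr B" "u' \<in> Arr B" "src B f' = src B R" "src B u' = trg B R"
     "trg B f' = src B S" "trg B u' = trg B S" "\<alpha>' \<in> Cell B" "cdom B \<alpha>' = u' \<odot> R" "ccod B \<alpha>' = S \<odot> f'"
     "g' \<in> Arr B" "v' \<in> Arr B" "src B g' = src B S" "src B v' = trg B S"
     "trg B g' = src B T" "trg B v' = trg B T" "\<beta>' \<in> Cell B" "cdom B \<beta>' = v' \<odot> S" "ccod B \<beta>' = T \<odot> g'"
     "\<phi> \<in> Cell B" "cdom B \<phi> = f" "ccod B \<phi> = f'" "\<psi> \<in> Cell B" "cdom B \<psi> = u" "ccod B \<psi> = u'"
     "\<phi>' \<in> Cell B" "cdom B \<phi>' = g" "ccod B \<phi>' = g'" "\<psi>' \<in> Cell B" "cdom B \<psi>' = v" "ccod B \<psi>' = v'"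
    using assms by (auto simp: sq_def cells_iff)
  have "(T \<rhd> (\<phi>' \<star> \<phi>)) \<cdot> pasting B R S T g \<beta> v f \<alpha> u =
     ((T \<rhd> (\<phi>' \<star> \<phi>)) \<cdot> assoc B T g f) \<cdot> (\<beta> \<lhd> f) \<cdot> assoc_inv B v S f \<cdot> (v \<rhd> \<alpha>) \<cdot> assoc B v u R"
    by (simp add: pasting_def)
  also have "(T \<rhd> (\<phi>' \<star> \<phi>)) \<cdot> assoc B T g f = assoc B T g' f' \<cdot> ((T \<rhd> \<phi>') \<star> \<phi>)"
    unfolding lwhisker_def by (rule nat1[symmetric]) simp_all
  also have "(assoc B T g' f' \<cdot> ((T \<rhd> \<phi>') \<star> \<phi>)) \<cdot> (\<beta> \<lhd> f) \<cdot> assoc_inv B v S f \<cdot> (v \<rhd> \<alpha>) \<cdot> assoc B v u R =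
     assoc B T g' f' \<cdot> (((T \<rhd> \<phi>') \<star> \<phi>) \<cdot> (\<beta> \<lhd> f)) \<cdot> assoc_inv B v S f \<cdot> (v \<rhd> \<alpha>) \<cdot> assoc B v u R" by simp
  also have "((T \<rhd> \<phi>') \<star> \<phi>) \<cdot> (\<beta> \<lhd> f) = (\<beta>' \<lhd> f') \<cdot> ((\<psi>' \<lhd> S) \<star> \<phi>)"
    using assms(10) by (simp add: rwhisker_def[of B \<beta>] rwhisker_def[of B \<beta>'] inter)
  also have "assoc B T g' f' \<cdot> ((\<beta>' \<lhd> f') \<cdot> ((\<psi>' \<lhd> S) \<star> \<phi>)) \<cdot> assoc_inv B v S f \<cdot> (v \<rhd> \<alpha>) \<cdot> assoc B v u R =
     assoc B T g' f' \<cdot> (\<beta>' \<lhd> f') \<cdot> (((\<psi>' \<lhd> S) \<star> \<phi>) \<cdot> assoc_inv B v S f) \<cdot> (v \<rhd> \<alpha>) \<cdot> assoc B v u R" by simp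
  also have "((\<psi>' \<lhd> S) \<star> \<phi>) \<cdot> assoc_inv B v S f = assoc_inv B v' S f' \<cdot> (\<psi>' \<star> (S \<rhd> \<phi>))"
    unfolding lwhisker_def rwhisker_def by (rule nat2) simp_all
  also have "assoc B T g' f' \<cdot> (\<beta>' \<lhd> f') \<cdot> (assoc_inv B v' S f' \<cdot> (\<psi>' \<star> (S \<rhd> \<phi>))) \<cdot> (v \<rhd> \<alpha>) \<cdot> assoc B v u R =
    assoc B T g' f' \<cdot> (\<beta>' \<lhd> f') \<cdot> assoc_inv B v' S f' \<cdot> ((\<psi>' \<star> (S \<rhd> \<phi>)) \<cdot> (v \<rhd> \<alpha>)) \<cdot> assoc B v u R" by simp
  also have "(\<psi>' \<star> (S \<rhd> \<phi>)) \<cdot> (v \<rhd> \<alpha>) = (v' \<rhd> \<alpha>') \<cdot> (\<psi>' \<star> (\<psi> \<lhd> R))"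
    using assms(9) by (simp add: lwhisker_def[of B v] lwhisker_def[of B v'] inter)
  also have "assoc B T g' f' \<cdot> (\<beta>' \<lhd> f') \<cdot> assoc_inv B v' S f' \<cdot> ((v' \<rhd> \<alpha>') \<cdot> (\<psi>' \<star> (\<psi> \<lhd> R))) \<cdot> assoc B v u R =
     assoc B T g' f' \<cdot> (\<beta>' \<lhd> f') \<cdot> assoc_inv B v' S f' \<cdot> (v' \<rhd> \<alpha>') \<cdot> ((\<psi>' \<star> (\<psi> \<lhd> R)) \<cdot> assoc B v u R)" by simp
  also have "(\<psi>' \<star> (\<psi> \<lhd> R)) \<cdot> assoc B v u R = assoc B v' u' R \<cdot> ((\<psi>' \<star> \<psi>) \<lhd> R)"
    unfolding rwhisker_def by (rule nat1[symmetric]) simp_all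
  finally show ?thesis by (simp add: pasting_def)
qed

lemma G_sel [simp]:
  "Obj (G_bicat B) = G_obj B" "Arr (G_bicat B) = G_arr B" "Cell (G_bicat B) = G_cell B"
  "src (G_bicat B) (x, t, y) = x" "trg (G_bicat B) (x, t, y) = y"
  "cdom (G_bicat B) (a, s, b) = a" "ccod (G_bicat B) (a, s, b) = b"
  "id1 (G_bicat B) = G_id1 B" "id2 (G_bicat B) = G_id2 B"
  "comp1 (G_bicat B) = G_comp1 B" "vcomp (G_bicat B) = G_vcomp B" "hcomp (G_bicat B) = G_hcomp B"
  "assoc (G_bicat B) = G_assoc B" "assoc_inv (G_bicat B) = G_assoc_inv B"
  by (auto simp: G_bicat_def)

lemma G_obj_iff: "(X, R, A) \<in> G_obj B \<longleftrightarrow> R \<in> Arr B \<and> src B R = X \<and> trg B R = A"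
  by (auto simp: G_obj_def arrs_iff)

lemma G_arr_iff: "((X, R, A), (f, \<alpha>, u), (Y, S, C)) \<in> G_arr B \<longleftrightarrow>
   X = src B R \<and> A = trg B R \<and> Y = src B S \<and> C = trg B S \<and> is_map B f \<and> is_map B u \<and> sq R S f \<alpha> u"
  by (auto simp: G_arr_def G_obj_iff arrs_iff cells_iff sq_def)

lemma G_cell_iff: "(((X, R, A), (f, \<alpha>, u), (Y, S, C)), (\<phi>, \<psi>), ((X', R', A'), (f', \<alpha>', u'), (Y', S', C'))) \<in> G_cell B \<longleftrightarrow>
   (X', R', A') = (X, R, A) \<and> (Y', S', C') = (Y, S, C) \<and>
     X = src B R \<and> A = trg B R \<and> Y = src B S \<and> C = trg B S \<and> is_map B f \<and> is_map B u \<and> sq R S f \<alpha> u \<and>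
     is_map B f' \<and> is_map B u' \<and> sq R S f' \<alpha>' u' \<and>
     \<phi> \<in> cells B f f' \<and> \<psi> \<in> cells B u u' \<and>
     (S \<rhd>\<^bsub>B\<^esub> \<phi>) \<cdot>\<^bsub>B\<^esub> \<alpha> = \<alpha>' \<cdot>\<^bsub>B\<^esub> (\<psi> \<lhd>\<^bsub>B\<^esub> R)"
  by (auto simp: G_cell_def G_arr_iff)

lemma sq_id: "R \<in> Arr B \<Longrightarrow> X = src B R \<Longrightarrow> A = trg B R \<Longrightarrow> sq R R (id1 B X) (id2 B R) (id1 B A)"
  by (auto simp: sq_def)

lemma vcell:
  assumes "sq R S f \<alpha> u" "sq R S f' \<alpha>' u'" "sq R S f'' \<alpha>'' u''"
    "\<phi> \<in> cells B f f'" "\<psi> \<in> cells B u u'" "\<phi>' \<in> cells B f' f''" "\<psi>' \<in> cells B u' u''"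
    "(S \<rhd> \<phi>) \<cdot> \<alpha> = \<alpha>' \<cdot> (\<psi> \<lhd> R)" "(S \<rhd> \<phi>') \<cdot> \<alpha>' = \<alpha>'' \<cdot> (\<psi>' \<lhd> R)"
  shows "(S \<rhd> (\<phi>' \<cdot> \<phi>)) \<cdot> \<alpha> = \<alpha>'' \<cdot> ((\<psi>' \<cdot> \<psi>) \<lhd> R)"
proof -
  have "(S \<rhd> (\<phi>' \<cdot> \<phi>)) \<cdot> \<alpha> = (S \<rhd> \<phi>') \<cdot> ((S \<rhd> \<phi>) \<cdot> \<alpha>)"
    using assms(1-7) by (simp add: sq_def cells_iff wv)
  also have "\<dots> = ((S \<rhd> \<phi>') \<cdot> \<alpha>') \<cdot> (\<psi> \<lhd> R)"
    unfolding assms(8) using assms(1-7) by (simp add: sq_def cells_iff wv)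
  also have "\<dots> = \<alpha>'' \<cdot> ((\<psi>' \<cdot> \<psi>) \<lhd> R)"
    unfolding assms(9) using assms(1-7) by (simp add: sq_def cells_iff wv)
  finally show ?thesis .
qed

lemma pasting_unit:
  assumes "sq R S f \<alpha> u"
  shows "pasting B R S S (id1 B (src B S)) (id2 B S) (id1 B (trg B S)) f \<alpha> u = \<alpha>"
    "pasting B R R S f \<alpha> u (id1 B (src B R)) (id2 B R) (id1 B (trg B R)) = \<alpha>"
  using assms by (auto simp: sq_def pasting_def)

lemma G_arrE:
  assumes "a \<in> arrs (G_bicat B) x y"
  obtains R S f \<alpha> u where "x = (src B R, R, trg B R)" "y = (src B S, S, trg B S)" "a = (x, (f, \<alpha>, u), y)"
    "is_map B f" "is_map B u" "sq R S f \<alpha> u"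
proof -
  obtain x' f \<alpha> u y' where a: "a = (x', (f, \<alpha>, u), y')" by (metis prod_cases3)
  obtain X R A where x': "x' = (X, R, A)" by (metis prod_cases3)
  obtain Y S C where y': "y' = (Y, S, C)" by (metis prod_cases3)
  show ?thesis using assms that unfolding a x' y' by (auto simp: arrs_iff G_arr_iff)
qed

lemma G_cellE:
  assumes "s \<in> cells (G_bicat B) a b" "a \<in> arrs (G_bicat B) (X, R, A) (Y, S, C)"
  obtains f \<alpha> u f' \<alpha>' u' \<phi> \<psi> where
    "a = ((X, R, A), (f, \<alpha>, u), (Y, S, C))" "b = ((X, R, A), (f', \<alpha>', u'), (Y, S, C))" "s = (a, (\<phi>, \<psi>), b)"
    "X = src B R" "A = trg B R" "Y = src B S" "C = trg B S"
    "is_map B f" "is_map B u" "sq R S f \<alpha> u" "is_map B f'" "is_map B u'" "sq R S f' \<alpha>' u'"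
    "\<phi> \<in> cells B f f'" "\<psi> \<in> cells B u u'" "(S \<rhd> \<phi>) \<cdot> \<alpha> = \<alpha>' \<cdot> (\<psi> \<lhd> R)"
proof -
  obtain a' \<phi> \<psi> b' where s: "s = (a', (\<phi>, \<psi>), b')" by (metis prod_cases4 prod.collapse)
  obtain x' f \<alpha> u y' where a: "a' = (x', (f, \<alpha>, u), y')" by (metis prod_cases3)
  obtain X1 R1 A1 where x': "x' = (X1, R1, A1)" by (metis prod_cases3)
  obtain Y1 S1 C1 where y': "y' = (Y1, S1, C1)" by (metis prod_cases3)
  obtain x'' f' \<alpha>' u' y'' where b: "b' = (x'', (f', \<alpha>', u'), y'')" by (metis prod_cases3)
  obtain X2 R2 A2 where x'': "x'' = (X2, R2, A2)" by (metis prod_cases3)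
  obtain Y2 S2 C2 where y'': "y'' = (Y2, S2, C2)" by (metis prod_cases3)
  show ?thesis using assms that unfolding s a b x' y' x'' y'' by (auto simp: arrs_iff cells_iff[of _ "G_bicat B"] G_cell_iff)
qed

lemma G_cells_iff: "(a, (\<phi>, \<psi>), b) \<in> cells (G_bicat B) c d \<longleftrightarrow> a = c \<and> b = d \<and> (a, (\<phi>, \<psi>), b) \<in> G_cell B"
  by (auto simp: cells_iff)
lemma G_arrs_iff: "(x, t, y) \<in> arrs (G_bicat B) x' y' \<longleftrightarrow> x = x' \<and> y = y' \<and> (x, t, y) \<in> G_arr B"
  by (auto simp: arrs_iff)

lemma G_homset: "homset (hom_cat (G_bicat B) x y) a b = {s \<in> cells (G_bicat B) a b. a \<in> arrs (G_bicat B) x y \<and> b \<in> arrs (G_bicat B) x y}"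
  by (auto simp: homset_def hom_cat_def cells_iff)

lemma sqD: assumes "sq R S f \<alpha> u" shows "R \<in> Arr B" "S \<in> Arr B" "f \<in> Arr B" "u \<in> Arr B" "src B f = src B R" "src B u = trg B R"
     "trg B f = src B S" "trg B u = trg B S" "\<alpha> \<in> Cell B" "cdom B \<alpha> = u \<odot> R" "ccod B \<alpha> = S \<odot> f"
  using assms by (auto simp: sq_def)
lemma cellsD: assumes "\<phi> \<in> cells B f f'" shows "\<phi> \<in> Cell B" "cdom B \<phi> = f" "ccod B \<phi> = f'"
  using assms by (auto simp: cells_iff)

lemma G_whisker:
  "g \<rhd>\<^bsub>G_bicat B\<^esub> s = G_hcomp B (G_id2 B g) s" "s \<lhd>\<^bsub>G_bicat B\<^esub> g = G_hcomp B s (G_id2 B g)"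
  by (auto simp: lwhisker_def rwhisker_def)

lemma G_hom_category: "category (hom_cat (G_bicat B) x y)"
  unfolding category_def G_homset
proof (intro conjI allI ballI impI; (elim conjE CollectE)?)
  fix m assume "m \<in> mors (hom_cat (G_bicat B) x y)"
  then show "mdom (hom_cat (G_bicat B) x y) m \<in> objs (hom_cat (G_bicat B) x y)" "mcod (hom_cat (G_bicat B) x y) m \<in> objs (hom_cat (G_bicat B) x y)"
    by (auto simp: hom_cat_def)
next
  fix a assume "a \<in> objs (hom_cat (G_bicat B) x y)"
  then have a: "a \<in> arrs (G_bicat B) x y" by (simp add: hom_cat_def)
  then have "G_id2 B a \<in> cells (G_bicat B) a a"
    by (elim G_arrE) (auto simp: G_cells_iff G_cell_iff cells_iff sq_def)
  with a show "ident (hom_cat (G_bicat B) x y) a \<in> {s \<in> cells (G_bicat B) a a. a \<in> arrs (G_bicat B) x y \<and> a \<in> arrs (G_bicat B) x y}"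
    by (simp add: hom_cat_def)
next
  fix a b c m n
  assume *: "m \<in> cells (G_bicat B) a b" "n \<in> cells (G_bicat B) b c" "a \<in> arrs (G_bicat B) x y" "b \<in> arrs (G_bicat B) x y" "c \<in> arrs (G_bicat B) x y"
  obtain X R A Y S C where xy: "x = (X, R, A)" "y = (Y, S, C)" by (metis prod_cases3)
  from * have "G_vcomp B n m \<in> cells (G_bicat B) a c" unfolding xy
    apply -
    apply (rule G_cellE[OF *(1)[unfolded xy] *(3)[unfolded xy]])
    apply (rule G_cellE[OF *(2)[unfolded xy] *(4)[unfolded xy]])
    by (auto simp: G_cells_iff G_cell_iff cellsD intro: vcell, auto simp: cells_iff)
  with * show "mcomp (hom_cat (G_bicat B) x y) n m \<in> {s \<in> cells (G_bicat B) a c. a \<in> arrs (G_bicat B) x y \<and> c \<in> arrs (G_bicat B) x y}"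
    by (simp add: hom_cat_def)
next
  fix a b m
  assume *: "m \<in> cells (G_bicat B) a b" "a \<in> arrs (G_bicat B) x y" "b \<in> arrs (G_bicat B) x y"
  obtain X R A Y S C where xy: "x = (X, R, A)" "y = (Y, S, C)" by (metis prod_cases3)
  show "mcomp (hom_cat (G_bicat B) x y) m (ident (hom_cat (G_bicat B) x y) a) = m" "mcomp (hom_cat (G_bicat B) x y) (ident (hom_cat (G_bicat B) x y) b) m = m"
    by (rule G_cellE[OF *(1) *(2)[unfolded xy]], simp add: hom_cat_def cells_iff)+
next
  fix a b c d m n k
  assume *: "m \<in> cells (G_bicat B) a b" "n \<in> cells (G_bicat B) b c" "k \<in> cells (G_bicat B) c d"
    "a \<in> arrs (G_bicat B) x y" "b \<in> arrs (G_bicat B) x y" "c \<in> arrs (G_bicat B) x y" "d \<in> arrs (G_bicat B) x y"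
  obtain X R A Y S C where xy: "x = (X, R, A)" "y = (Y, S, C)" by (metis prod_cases3)
  show "mcomp (hom_cat (G_bicat B) x y) (mcomp (hom_cat (G_bicat B) x y) k n) m = mcomp (hom_cat (G_bicat B) x y) k (mcomp (hom_cat (G_bicat B) x y) n m)"
    apply (rule G_cellE[OF *(1)[unfolded xy] *(4)[unfolded xy]])
    apply (rule G_cellE[OF *(2)[unfolded xy] *(5)[unfolded xy]])
    apply (rule G_cellE[OF *(3)[unfolded xy] *(6)[unfolded xy]])
    by (auto simp add: hom_cat_def cells_iff)
qed


lemma normal_bicategory_G: "normal_bicategory (G_bicat B)"
proof
  fix a assume "a \<in> Arr (G_bicat B)"
  then have "a \<in> arrs (G_bicat B) (src (G_bicat B) a) (trg (G_bicat B) a)" by (simp add: arrs_iff del: G_sel)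
  then show "src (G_bicat B) a \<in> Obj (G_bicat B) \<and> trg (G_bicat B) a \<in> Obj (G_bicat B)"
    by (elim G_arrE) (auto simp: G_obj_iff sq_def)
next
  fix s assume "s \<in> Cell (G_bicat B)"
  then show "cdom (G_bicat B) s \<in> Arr (G_bicat B) \<and> ccod (G_bicat B) s \<in> Arr (G_bicat B) \<and>
         src (G_bicat B) (ccod (G_bicat B) s) = src (G_bicat B) (cdom (G_bicat B) s) \<and>
         trg (G_bicat B) (ccod (G_bicat B) s) = trg (G_bicat B) (cdom (G_bicat B) s)"
    by (auto simp: G_cell_def)
next
  fix x y show "category (hom_cat (G_bicat B) x y)" by (rule G_hom_category)
next
  fix x assume "x \<in> Obj (G_bicat B)"
  then show "id1 (G_bicat B) x \<in> arrs (G_bicat B) x x"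
    by (cases x) (auto simp: G_obj_iff G_arrs_iff G_arr_iff is_map_id sq_id)
next
  fix f x y g z assume "f \<in> arrs (G_bicat B) x y" "g \<in> arrs (G_bicat B) y z"
  then show "comp1 (G_bicat B) g f \<in> arrs (G_bicat B) x z"
    by (elim G_arrE) (auto simp: G_arrs_iff G_arr_iff is_map_comp sq_pasting sqD)
next
  fix f x y assume "f \<in> arrs (G_bicat B) x y"
  then show "comp1 (G_bicat B) (id1 (G_bicat B) y) f = f" "comp1 (G_bicat B) f (id1 (G_bicat B) x) = f"
    by (elim G_arrE; auto simp: sqD pasting_unit)+
next
  fix f x y f' s assume *: "f \<in> arrs (G_bicat B) x y" "s \<in> cells (G_bicat B) f f'"
  obtain X R A Y S C where xy: "x = (X, R, A)" "y = (Y, S, C)" by (metis prod_cases3)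
  show "id1 (G_bicat B) y \<rhd>\<^bsub>G_bicat B\<^esub> s = s" "s \<lhd>\<^bsub>G_bicat B\<^esub> id1 (G_bicat B) x = s"
    unfolding xy G_whisker
    by (rule G_cellE[OF *(2) *(1)[unfolded xy]], auto simp: pasting_unit sqD cellsD rwhisker_def[symmetric] lwhisker_def[symmetric])+
next
  fix f x y g z assume "f \<in> arrs (G_bicat B) x y" "g \<in> arrs (G_bicat B) y z"
  then show "hcomp (G_bicat B) (id2 (G_bicat B) g) (id2 (G_bicat B) f) = id2 (G_bicat B) (comp1 (G_bicat B) g f)"
    by (elim G_arrE) (auto simp: sqD)
  show "assoc (G_bicat B) g (id1 (G_bicat B) y) f = id2 (G_bicat B) (comp1 (G_bicat B) g f)"
    using \<open>f \<in> arrs (G_bicat B) x y\<close> \<open>g \<in> arrs (G_bicat B) y z\<close> by (elim G_arrE) (auto simp: sqD pasting_unit)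
next
  fix f x y g z h w assume *: "f \<in> arrs (G_bicat B) x y" "g \<in> arrs (G_bicat B) y z" "h \<in> arrs (G_bicat B) z w"
  show "assoc (G_bicat B) h g f \<in> cells (G_bicat B) (comp1 (G_bicat B) (comp1 (G_bicat B) h g) f) (comp1 (G_bicat B) h (comp1 (G_bicat B) g f))"
    using * apply (elim G_arrE)
    by (auto simp: G_cells_iff G_cell_iff sqD is_map_comp sq_pasting pasting_assoc cells_iff)
  show "assoc_inv (G_bicat B) h g f \<in> cells (G_bicat B) (comp1 (G_bicat B) h (comp1 (G_bicat B) g f)) (comp1 (G_bicat B) (comp1 (G_bicat B) h g) f)"
    using * apply (elim G_arrE)
    by (auto simp: G_cells_iff G_cell_iff sqD is_map_comp sq_pasting pasting_assoc_inv cells_iff)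
  show "vcomp (G_bicat B) (assoc_inv (G_bicat B) h g f) (assoc (G_bicat B) h g f) = id2 (G_bicat B) (comp1 (G_bicat B) (comp1 (G_bicat B) h g) f) \<and>
    vcomp (G_bicat B) (assoc (G_bicat B) h g f) (assoc_inv (G_bicat B) h g f) = id2 (G_bicat B) (comp1 (G_bicat B) h (comp1 (G_bicat B) g f))"
    using * by (elim G_arrE) (auto simp: sqD)
next
  fix f x y g z a f' b g' assume *: "f \<in> arrs (G_bicat B) x y" "g \<in> arrs (G_bicat B) y z" "a \<in> cells (G_bicat B) f f'" "b \<in> cells (G_bicat B) g g'"
  obtain X R A Y S C Z T D where xy: "x = (X, R, A)" "y = (Y, S, C)" "z = (Z, T, D)" by (metis prod_cases3)
  show "hcomp (G_bicat B) b a \<in> cells (G_bicat B) (comp1 (G_bicat B) g f) (comp1 (G_bicat B) g' f')"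
    apply (rule G_cellE[OF *(3) *(1)[unfolded xy]])
    apply (rule G_cellE[OF *(4) *(2)[unfolded xy]])
    apply (auto simp: G_cells_iff G_cell_iff sqD is_map_comp sq_pasting intro: pasting_cell)
    by (auto simp: cells_iff sqD)
next
  fix f x y g z a f' a' f'' b g' b' g'' assume *: "f \<in> arrs (G_bicat B) x y" "g \<in> arrs (G_bicat B) y z" "a \<in> cells (G_bicat B) f f'"
    "a' \<in> cells (G_bicat B) f' f''" "b \<in> cells (G_bicat B) g g'" "b' \<in> cells (G_bicat B) g' g''"
  obtain X R A Y S C Z T D where xy: "x = (X, R, A)" "y = (Y, S, C)" "z = (Z, T, D)" by (metis prod_cases3)
  show "hcomp (G_bicat B) (vcomp (G_bicat B) b' b) (vcomp (G_bicat B) a' a) =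
    vcomp (G_bicat B) (hcomp (G_bicat B) b' a') (hcomp (G_bicat B) b a)"
  proof -
    have 1: "f' \<in> arrs (G_bicat B) (X, R, A) (Y, S, C)" "g' \<in> arrs (G_bicat B) (Y, S, C) (Z, T, D)"
     subgoal by (rule G_cellE[OF *(3) *(1)[unfolded xy]]) (auto simp: G_arrs_iff G_arr_iff)
     subgoal by (rule G_cellE[OF *(5) *(2)[unfolded xy]]) (auto simp: G_arrs_iff G_arr_iff)
     done
  show ?thesis
    apply (rule G_cellE[OF *(3) *(1)[unfolded xy]])
    apply (rule G_cellE[OF *(4) 1(1)])
    apply (rule G_cellE[OF *(5) *(2)[unfolded xy]])
    apply (rule G_cellE[OF *(6) 1(2)])
    by (auto simp: inter cellsD sqD)
  qed
next
  fix f x y g z h w f' a g' b h' c assume *: "f \<in> arrs (G_bicat B) x y" "g \<in> arrs (G_bicat B) y z" "h \<in> arrs (G_bicat B) z w"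
    "a \<in> cells (G_bicat B) f f'" "b \<in> cells (G_bicat B) g g'" "c \<in> cells (G_bicat B) h h'"
  obtain X R A Y S C Z T D W U E where xy: "x = (X, R, A)" "y = (Y, S, C)" "z = (Z, T, D)" "w = (W, U, E)" by (metis prod_cases3)
  show "vcomp (G_bicat B) (assoc (G_bicat B) h' g' f') (hcomp (G_bicat B) (hcomp (G_bicat B) c b) a) =
    vcomp (G_bicat B) (hcomp (G_bicat B) c (hcomp (G_bicat B) b a)) (assoc (G_bicat B) h g f)"
    apply (rule G_cellE[OF *(4) *(1)[unfolded xy]])
    apply (rule G_cellE[OF *(5) *(2)[unfolded xy]])
    apply (rule G_cellE[OF *(6) *(3)[unfolded xy]])
    apply (simp only: G_sel G_hcomp.simps G_comp1.simps G_assoc.simps G_vcomp.simps prod.inject simp_thms)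
    apply (intro conjI nat1)
    by (simp_all (no_asm_simp) add: cellsD sqD)
next
  fix f v w g x h y k z assume *: "f \<in> arrs (G_bicat B) v w" "g \<in> arrs (G_bicat B) w x" "h \<in> arrs (G_bicat B) x y" "k \<in> arrs (G_bicat B) y z"
  show "vcomp (G_bicat B) (assoc (G_bicat B) k h (comp1 (G_bicat B) g f)) (assoc (G_bicat B) (comp1 (G_bicat B) k h) g f) =
     vcomp (G_bicat B) (k \<rhd>\<^bsub>G_bicat B\<^esub> assoc (G_bicat B) h g f) (vcomp (G_bicat B) (assoc (G_bicat B) k (comp1 (G_bicat B) h g) f) (assoc (G_bicat B) k h g \<lhd>\<^bsub>G_bicat B\<^esub> f))"
    unfolding G_whisker using *
    by (elim G_arrE) (auto simp: sqD pent0 rwhisker_def[symmetric] lwhisker_def[symmetric])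
qed

lemma iso_id2: assumes "f \<in> Arr B" shows "iso_cell B (id2 B f)"
  using assms unfolding iso_cell_def by (auto simp: cells_iff intro!: bexI[of _ "id2 B f"])

lemma iso_Map_id2: "f \<in> Arr B \<Longrightarrow> is_map B f \<Longrightarrow> iso_cell (Map_bicat B) (id2 B f)"
  using normal_bicategory.iso_id2[OF normal_bicategory_Map, of f] by simp

lemma pseudofunctor_boundary0: "pseudofunctor (G_bicat B) (Map_bicat B) (\<partial>\<^sub>0 B)"
proof -
  interpret G: normal_bicategory "G_bicat B" by (rule normal_bicategory_G)
  interpret M: normal_bicategory "Map_bicat B" by (rule normal_bicategory_Map)
  have sel: "on_obj (\<partial>\<^sub>0 B) (X, R, A) = X" "on_arr (\<partial>\<^sub>0 B) (x, (f, \<alpha>, u), y) = f" "on_cell (\<partial>\<^sub>0 B) (a, (\<phi>, \<psi>), b) = \<phi>"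
    "pf_comp (\<partial>\<^sub>0 B) (x1, (g, \<beta>, v), y1) (x2, (f, \<alpha>, u), y2) = id2 B (g \<odot> f)" "pf_unit (\<partial>\<^sub>0 B) (X, R, A) = id2 B (id1 B X)"
    for X R A x f \<alpha> u y a \<phi> \<psi> b x1 g \<beta> v y1 x2 y2
    by (auto simp: boundary0_def)
  show ?thesis
  proof
    fix x assume "x \<in> Obj (G_bicat B)"
    then show "on_obj (\<partial>\<^sub>0 B) x \<in> Obj (Map_bicat B)"
      by (cases x) (auto simp: G_obj_iff sel)
  next
    fix x y :: "('o, 'a) gobj"
    obtain X R A Y S C where xy: "x = (X, R, A)" "y = (Y, S, C)" by (metis prod_cases3)
    have 1: "on_arr (\<partial>\<^sub>0 B) f \<in> arrs (Map_bicat B) X Y" if "f \<in> arrs (G_bicat B) x y" for f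
      using that xy by (elim G_arrE) (auto simp: sel arrs_iff sqD)
    have 2: "on_cell (\<partial>\<^sub>0 B) m \<in> cells (Map_bicat B) (on_arr (\<partial>\<^sub>0 B) f) (on_arr (\<partial>\<^sub>0 B) g)" if "f \<in> arrs (G_bicat B) x y" "m \<in> cells (G_bicat B) f g" for f g m
      by (rule G_cellE[OF that(2) that(1)[unfolded xy]]) (auto simp: sel cells_iff)
    have 3: "on_cell (\<partial>\<^sub>0 B) (G_vcomp B n m) = on_cell (\<partial>\<^sub>0 B) n \<cdot> on_cell (\<partial>\<^sub>0 B) m" for n m
      by (cases n; cases m) (auto simp: sel)
    have 4: "on_cell (\<partial>\<^sub>0 B) (G_id2 B f) = id2 B (on_arr (\<partial>\<^sub>0 B) f)" for f
      by (cases f) (auto simp: sel)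
    have H: "homset (hom_cat (Map_bicat B) u v) a b = {s \<in> cells (Map_bicat B) a b. a \<in> arrs (Map_bicat B) u v \<and> b \<in> arrs (Map_bicat B) u v}" for u v a b
      by (auto simp: homset_def hom_cat_def cells_iff)
    have HH: "objs (hom_cat (G_bicat B) u v) = arrs (G_bicat B) u v" "objs (hom_cat (Map_bicat B) p q) = arrs (Map_bicat B) p q"
      "mcomp (hom_cat (G_bicat B) u v) = G_vcomp B" "ident (hom_cat (G_bicat B) u v) = G_id2 B"
       "mcomp (hom_cat (Map_bicat B) p q) = vcomp B" "ident (hom_cat (Map_bicat B) p q) = id2 B" for u v p q
      by (simp_all add: hom_cat_def)
    show "is_functor (hom_cat (G_bicat B) x y) (hom_cat (Map_bicat B) (on_obj (\<partial>\<^sub>0 B) x) (on_obj (\<partial>\<^sub>0 B) y)) (on_arr (\<partial>\<^sub>0 B)) (on_cell (\<partial>\<^sub>0 B))"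
      using 1 2 3 4 unfolding is_functor_def H G_homset HH xy sel by blast
  next
    fix f x y g z assume *: "f \<in> arrs (G_bicat B) x y" "g \<in> arrs (G_bicat B) y z"
    then show "pf_comp (\<partial>\<^sub>0 B) g f \<in> cells (Map_bicat B) (comp1 (Map_bicat B) (on_arr (\<partial>\<^sub>0 B) g) (on_arr (\<partial>\<^sub>0 B) f))
        (on_arr (\<partial>\<^sub>0 B) (comp1 (G_bicat B) g f)) \<and> iso_cell (Map_bicat B) (pf_comp (\<partial>\<^sub>0 B) g f)"
      by (elim G_arrE) (auto simp: sel cells_iff sqD is_map_comp iso_Map_id2)
  next
    fix f x y g z a f' b g' assume *: "f \<in> arrs (G_bicat B) x y" "g \<in> arrs (G_bicat B) y z" "a \<in> cells (G_bicat B) f f'" "b \<in> cells (G_bicat B) g g'"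
    obtain X R A Y S C Z T D where xy: "x = (X, R, A)" "y = (Y, S, C)" "z = (Z, T, D)" by (metis prod_cases3)
    show "vcomp (Map_bicat B) (pf_comp (\<partial>\<^sub>0 B) g' f') (hcomp (Map_bicat B) (on_cell (\<partial>\<^sub>0 B) b) (on_cell (\<partial>\<^sub>0 B) a)) =
       vcomp (Map_bicat B) (on_cell (\<partial>\<^sub>0 B) (hcomp (G_bicat B) b a)) (pf_comp (\<partial>\<^sub>0 B) g f)"
      apply (rule G_cellE[OF *(3) *(1)[unfolded xy]])
      apply (rule G_cellE[OF *(4) *(2)[unfolded xy]])
      by (auto simp: sel sqD cellsD)
  next
    fix x assume "x \<in> Obj (G_bicat B)"
    then show "pf_unit (\<partial>\<^sub>0 B) x \<in> cells (Map_bicat B) (id1 (Map_bicat B) (on_obj (\<partial>\<^sub>0 B) x)) (on_arr (\<partial>\<^sub>0 B) (id1 (G_bicat B) x)) \<and>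
        iso_cell (Map_bicat B) (pf_unit (\<partial>\<^sub>0 B) x)"
      by (cases x) (auto simp: G_obj_iff sel cells_iff is_map_id iso_Map_id2)
  next
    fix f x y g z h w assume *: "f \<in> arrs (G_bicat B) x y" "g \<in> arrs (G_bicat B) y z" "h \<in> arrs (G_bicat B) z w"
    then show "vcomp (Map_bicat B) (on_cell (\<partial>\<^sub>0 B) (assoc (G_bicat B) h g f)) (vcomp (Map_bicat B) (pf_comp (\<partial>\<^sub>0 B) (comp1 (G_bicat B) h g) f)
        (pf_comp (\<partial>\<^sub>0 B) h g \<lhd>\<^bsub>Map_bicat B\<^esub> on_arr (\<partial>\<^sub>0 B) f)) =
       vcomp (Map_bicat B) (pf_comp (\<partial>\<^sub>0 B) h (comp1 (G_bicat B) g f)) (vcomp (Map_bicat B) (on_arr (\<partial>\<^sub>0 B) h \<rhd>\<^bsub>Map_bicat B\<^esub> pf_comp (\<partial>\<^sub>0 B) g f)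
        (assoc (Map_bicat B) (on_arr (\<partial>\<^sub>0 B) h) (on_arr (\<partial>\<^sub>0 B) g) (on_arr (\<partial>\<^sub>0 B) f)))"
      by (elim G_arrE) (auto simp: sel sqD)
  next
    fix f x y assume "f \<in> arrs (G_bicat B) x y"
    then show "vcomp (Map_bicat B) (pf_comp (\<partial>\<^sub>0 B) (id1 (G_bicat B) y) f) (pf_unit (\<partial>\<^sub>0 B) y \<lhd>\<^bsub>Map_bicat B\<^esub> on_arr (\<partial>\<^sub>0 B) f) = id2 (Map_bicat B) (on_arr (\<partial>\<^sub>0 B) f)"
     "vcomp (Map_bicat B) (pf_comp (\<partial>\<^sub>0 B) f (id1 (G_bicat B) x)) (on_arr (\<partial>\<^sub>0 B) f \<rhd>\<^bsub>Map_bicat B\<^esub> pf_unit (\<partial>\<^sub>0 B) x) = id2 (Map_bicat B) (on_arr (\<partial>\<^sub>0 B) f)"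
      by (elim G_arrE; auto simp: sel sqD)+
  qed
qed

lemma pseudofunctor_boundary1: "pseudofunctor (G_bicat B) (Map_bicat B) (\<partial>\<^sub>1 B)"
proof -
  interpret G: normal_bicategory "G_bicat B" by (rule normal_bicategory_G)
  interpret M: normal_bicategory "Map_bicat B" by (rule normal_bicategory_Map)
  have sel: "on_obj (\<partial>\<^sub>1 B) (X, R, A) = A" "on_arr (\<partial>\<^sub>1 B) (x, (f, \<alpha>, u), y) = u" "on_cell (\<partial>\<^sub>1 B) (a, (\<phi>, \<psi>), b) = \<psi>"
    "pf_comp (\<partial>\<^sub>1 B) (x1, (g, \<beta>, v), y1) (x2, (f, \<alpha>, u), y2) = id2 B (v \<odot> u)" "pf_unit (\<partial>\<^sub>1 B) (X, R, A) = id2 B (id1 B A)"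
    for X R A x f \<alpha> u y a \<phi> \<psi> b x1 g \<beta> v y1 x2 y2
    by (auto simp: boundary1_def)
  show ?thesis
  proof
    fix x assume "x \<in> Obj (G_bicat B)"
    then show "on_obj (\<partial>\<^sub>1 B) x \<in> Obj (Map_bicat B)"
      by (cases x) (auto simp: G_obj_iff sel)
  next
    fix x y :: "('o, 'a) gobj"
    obtain X R A Y S C where xy: "x = (X, R, A)" "y = (Y, S, C)" by (metis prod_cases3)
    have 1: "on_arr (\<partial>\<^sub>1 B) f \<in> arrs (Map_bicat B) A C" if "f \<in> arrs (G_bicat B) x y" for f
      using that xy by (elim G_arrE) (auto simp: sel arrs_iff sqD)
    have 2: "on_cell (\<partial>\<^sub>1 B) m \<in> cells (Map_bicat B) (on_arr (\<partial>\<^sub>1 B) f) (on_arr (\<partial>\<^sub>1 B) g)" if "f \<in> arrs (G_bicat B) x y" "m \<in> cells (G_bicat B) f g" for f g m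
      by (rule G_cellE[OF that(2) that(1)[unfolded xy]]) (auto simp: sel cells_iff)
    have 3: "on_cell (\<partial>\<^sub>1 B) (G_vcomp B n m) = on_cell (\<partial>\<^sub>1 B) n \<cdot> on_cell (\<partial>\<^sub>1 B) m" for n m
      by (cases n; cases m) (auto simp: sel)
    have 4: "on_cell (\<partial>\<^sub>1 B) (G_id2 B f) = id2 B (on_arr (\<partial>\<^sub>1 B) f)" for f
      by (cases f) (auto simp: sel)
    have H: "homset (hom_cat (Map_bicat B) u v) a b = {s \<in> cells (Map_bicat B) a b. a \<in> arrs (Map_bicat B) u v \<and> b \<in> arrs (Map_bicat B) u v}" for u v a b
      by (auto simp: homset_def hom_cat_def cells_iff)
    have HH: "objs (hom_cat (G_bicat B) u v) = arrs (G_bicat B) u v" "objs (hom_cat (Map_bicat B) p q) = arrs (Map_bicat B) p q"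
      "mcomp (hom_cat (G_bicat B) u v) = G_vcomp B" "ident (hom_cat (G_bicat B) u v) = G_id2 B"
       "mcomp (hom_cat (Map_bicat B) p q) = vcomp B" "ident (hom_cat (Map_bicat B) p q) = id2 B" for u v p q
      by (simp_all add: hom_cat_def)
    show "is_functor (hom_cat (G_bicat B) x y) (hom_cat (Map_bicat B) (on_obj (\<partial>\<^sub>1 B) x) (on_obj (\<partial>\<^sub>1 B) y)) (on_arr (\<partial>\<^sub>1 B)) (on_cell (\<partial>\<^sub>1 B))"
      using 1 2 3 4 unfolding is_functor_def H G_homset HH xy sel by blast
  next
    fix f x y g z assume *: "f \<in> arrs (G_bicat B) x y" "g \<in> arrs (G_bicat B) y z"
    then show "pf_comp (\<partial>\<^sub>1 B) g f \<in> cells (Map_bicat B) (comp1 (Map_bicat B) (on_arr (\<partial>\<^sub>1 B) g) (on_arr (\<partial>\<^sub>1 B) f))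
        (on_arr (\<partial>\<^sub>1 B) (comp1 (G_bicat B) g f)) \<and> iso_cell (Map_bicat B) (pf_comp (\<partial>\<^sub>1 B) g f)"
      by (elim G_arrE) (auto simp: sel cells_iff sqD is_map_comp iso_Map_id2)
  next
    fix f x y g z a f' b g' assume *: "f \<in> arrs (G_bicat B) x y" "g \<in> arrs (G_bicat B) y z" "a \<in> cells (G_bicat B) f f'" "b \<in> cells (G_bicat B) g g'"
    obtain X R A Y S C Z T D where xy: "x = (X, R, A)" "y = (Y, S, C)" "z = (Z, T, D)" by (metis prod_cases3)
    show "vcomp (Map_bicat B) (pf_comp (\<partial>\<^sub>1 B) g' f') (hcomp (Map_bicat B) (on_cell (\<partial>\<^sub>1 B) b) (on_cell (\<partial>\<^sub>1 B) a)) =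
       vcomp (Map_bicat B) (on_cell (\<partial>\<^sub>1 B) (hcomp (G_bicat B) b a)) (pf_comp (\<partial>\<^sub>1 B) g f)"
      apply (rule G_cellE[OF *(3) *(1)[unfolded xy]])
      apply (rule G_cellE[OF *(4) *(2)[unfolded xy]])
      by (auto simp: sel sqD cellsD)
  next
    fix x assume "x \<in> Obj (G_bicat B)"
    then show "pf_unit (\<partial>\<^sub>1 B) x \<in> cells (Map_bicat B) (id1 (Map_bicat B) (on_obj (\<partial>\<^sub>1 B) x)) (on_arr (\<partial>\<^sub>1 B) (id1 (G_bicat B) x)) \<and>
        iso_cell (Map_bicat B) (pf_unit (\<partial>\<^sub>1 B) x)"
      by (cases x) (auto simp: G_obj_iff sel cells_iff is_map_id iso_Map_id2)
  next
    fix f x y g z h w assume *: "f \<in> arrs (G_bicat B) x y" "g \<in> arrs (G_bicat B) y z" "h \<in> arrs (G_bicat B) z w"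
    then show "vcomp (Map_bicat B) (on_cell (\<partial>\<^sub>1 B) (assoc (G_bicat B) h g f)) (vcomp (Map_bicat B) (pf_comp (\<partial>\<^sub>1 B) (comp1 (G_bicat B) h g) f)
        (pf_comp (\<partial>\<^sub>1 B) h g \<lhd>\<^bsub>Map_bicat B\<^esub> on_arr (\<partial>\<^sub>1 B) f)) =
       vcomp (Map_bicat B) (pf_comp (\<partial>\<^sub>1 B) h (comp1 (G_bicat B) g f)) (vcomp (Map_bicat B) (on_arr (\<partial>\<^sub>1 B) h \<rhd>\<^bsub>Map_bicat B\<^esub> pf_comp (\<partial>\<^sub>1 B) g f)
        (assoc (Map_bicat B) (on_arr (\<partial>\<^sub>1 B) h) (on_arr (\<partial>\<^sub>1 B) g) (on_arr (\<partial>\<^sub>1 B) f)))"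
      by (elim G_arrE) (auto simp: sel sqD)
  next
    fix f x y assume "f \<in> arrs (G_bicat B) x y"
    then show "vcomp (Map_bicat B) (pf_comp (\<partial>\<^sub>1 B) (id1 (G_bicat B) y) f) (pf_unit (\<partial>\<^sub>1 B) y \<lhd>\<^bsub>Map_bicat B\<^esub> on_arr (\<partial>\<^sub>1 B) f) = id2 (Map_bicat B) (on_arr (\<partial>\<^sub>1 B) f)"
     "vcomp (Map_bicat B) (pf_comp (\<partial>\<^sub>1 B) f (id1 (G_bicat B) x)) (on_arr (\<partial>\<^sub>1 B) f \<rhd>\<^bsub>Map_bicat B\<^esub> pf_unit (\<partial>\<^sub>1 B) x) = id2 (Map_bicat B) (on_arr (\<partial>\<^sub>1 B) f)"
      by (elim G_arrE; auto simp: sel sqD)+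
  qed
qed


end

end

theory Submission
  imports Defs
begin

text \<open>Let \<open>P\<close> and \<open>Q\<close> be products in \<open>Map B\<close> of the sources and of the targets of the arrows \<open>S i\<close>, with
  projections \<open>p i\<close> and \<open>q i\<close>.  The product of the \<open>S i\<close> in \<open>G\<close> is the product \<open>R\<close> of the arrows
  \<open>q i* S i p i\<close> in \<open>B(P, Q)\<close>, projecting by the transposes \<open>q i R \<rightarrow> S i p i\<close>.  For a map \<open>g\<close> into \<open>P\<close>,
  precomposition with \<open>g\<close> has the left adjoint given by precomposition with \<open>g*\<close>, so it preserves
  this product: 2-cells \<open>u T \<rightarrow> R g\<close> correspond to families \<open>u T \<rightarrow> (q i* S i p i) g\<close>, that is, to
  families \<open>(q i u) T \<rightarrow> S i (p i g)\<close>, and the correspondence is pasting with the projections.  With the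
  universal properties of \<open>P\<close> and \<open>Q\<close> this gives the universal property in \<open>G\<close>.  Both boundaries send
  the cone constructed to a product cone by construction, and every product cone over the same family
  is equivalent to it.\<close>

section \<open>Equivalences of categories\<close>

text \<open>Two obstacles shape the argument. A product cone is defined through equivalences of
  hom-categories, which involve chosen quasi-inverses and extensional families. They are traded for
  two lifting properties, unique for families of 2-cells and up to invertible 2-cells for families
  of arrows, and these can be checked in \<open>G\<close> component by component. Secondly, the
  universal properties of \<open>P\<close> and \<open>Q\<close> control the outer arrows of an arrow
  of \<open>G\<close> but not its middle 2-cell. Right adjoints of the \<open>q i\<close> are what
  moves the data into the single hom-category \<open>B(P, Q)\<close>, where products are available,
  and a right adjoint of \<open>g\<close> is what keeps \<open>R g\<close> a product. The resulting
  bijection on 2-cells is used twice: its uniqueness half shows that 2-cells obtained separately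
  from \<open>P\<close> and \<open>Q\<close> satisfy the compatibility condition of
  \<open>G\<close>, and its existence half supplies the middle 2-cell of a mediating arrow. Since
  \<open>B\<close> is not strict, pasting and transposition agree only after associators are
  inserted, which is the source of the pentagon manipulations.\<close>

locale cat =
  fixes C :: "('o, 'm, 'z) cat_scheme"
  assumes category: "category C"
begin

lemma homset_objs: "m \<in> homset C x y \<Longrightarrow> x \<in> objs C \<and> y \<in> objs C"
  using category unfolding category_def homset_def by blast

lemma ident_homset [intro]: "x \<in> objs C \<Longrightarrow> ident C x \<in> homset C x x"
  using category unfolding category_def by blast

lemma mcomp_homset [intro]:
  "n \<in> homset C y z \<Longrightarrow> m \<in> homset C x y \<Longrightarrow> mcomp C n m \<in> homset C x z"
  using category unfolding category_def by blast

lemma mcomp_ident: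
  assumes "m \<in> homset C x y"
  shows "mcomp C m (ident C x) = m" "mcomp C (ident C y) m = m"
  using category assms unfolding category_def by blast+

lemma mcomp_assoc:
  "m \<in> homset C w x \<Longrightarrow> n \<in> homset C x y \<Longrightarrow> k \<in> homset C y z \<Longrightarrow>
    mcomp C (mcomp C k n) m = mcomp C k (mcomp C n m)"
  using category unfolding category_def by blast

lemma iso_morE:
  assumes "m \<in> homset C x y" "iso_mor C m"
  obtains n where "n \<in> homset C y x" "mcomp C n m = ident C x" "mcomp C m n = ident C y"
  using assms unfolding iso_mor_def homset_def by auto

lemma iso_morI:
  assumes "m \<in> homset C x y" "n \<in> homset C y x"
    "mcomp C n m = ident C x" "mcomp C m n = ident C y"
  shows "iso_mor C m"
  using assms unfolding iso_mor_def homset_def by auto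

lemma iso_mor_cancel_left:
  assumes "iso_mor C k" "k \<in> homset C y z" "m \<in> homset C x y" "n \<in> homset C x y"
    "mcomp C k m = mcomp C k n"
  shows "m = n"
proof -
  obtain k' where k': "k' \<in> homset C z y" "mcomp C k' k = ident C y"
    using iso_morE[OF assms(2,1)] by metis
  have "m = mcomp C k' (mcomp C k m)" "n = mcomp C k' (mcomp C k n)"
    using mcomp_assoc[OF assms(3,2) k'(1)] mcomp_assoc[OF assms(4,2) k'(1)]
      mcomp_ident(2)[OF assms(3)] mcomp_ident(2)[OF assms(4)] k'(2) by simp_all
  then show ?thesis using assms(5) by simp
qed

lemma iso_mor_cancel_right:
  assumes "iso_mor C k" "k \<in> homset C x y" "m \<in> homset C y z" "n \<in> homset C y z"
    "mcomp C m k = mcomp C n k"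
  shows "m = n"
proof -
  obtain k' where k': "k' \<in> homset C y x" "mcomp C k k' = ident C y"
    using iso_morE[OF assms(2,1)] by metis
  have "m = mcomp C (mcomp C m k) k'" "n = mcomp C (mcomp C n k) k'"
    using mcomp_assoc[OF k'(1) assms(2,3)] mcomp_assoc[OF k'(1) assms(2,4)]
      mcomp_ident(1)[OF assms(3)] mcomp_ident(1)[OF assms(4)] k'(2) by simp_all
  then show ?thesis using assms(5) by simp
qed

end

definition fully_faithful ::
  "('o, 'm, 'z) cat_scheme \<Rightarrow> ('p, 'n, 'y) cat_scheme \<Rightarrow> ('o \<Rightarrow> 'p) \<Rightarrow> ('m \<Rightarrow> 'n) \<Rightarrow> bool" where
  "fully_faithful C D Fo Fm \<longleftrightarrow>
     (\<forall>x \<in> objs C. \<forall>y \<in> objs C. bij_betw Fm (homset C x y) (homset D (Fo x) (Fo y)))"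

definition essentially_surjective ::
  "('o, 'm, 'z) cat_scheme \<Rightarrow> ('p, 'n, 'y) cat_scheme \<Rightarrow> ('o \<Rightarrow> 'p) \<Rightarrow> bool" where
  "essentially_surjective C D Fo \<longleftrightarrow>
     (\<forall>y \<in> objs D. \<exists>x \<in> objs C. \<exists>m \<in> homset D (Fo x) y. iso_mor D m)"

locale cat_functor = C: cat C + D: cat D
  for C :: "('o, 'm, 'z) cat_scheme" and D :: "('p, 'n, 'y) cat_scheme" +
  fixes Fo Fm
  assumes is_functor: "is_functor C D Fo Fm"
begin

lemma functor_obj: "x \<in> objs C \<Longrightarrow> Fo x \<in> objs D"
  using is_functor unfolding is_functor_def by blast

lemma functor_mor: "m \<in> homset C x y \<Longrightarrow> Fm m \<in> homset D (Fo x) (Fo y)"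
  using is_functor unfolding is_functor_def by blast

lemma functor_ident: "x \<in> objs C \<Longrightarrow> Fm (ident C x) = ident D (Fo x)"
  using is_functor unfolding is_functor_def by blast

lemma functor_mcomp:
  "m \<in> homset C x y \<Longrightarrow> n \<in> homset C y z \<Longrightarrow> Fm (mcomp C n m) = mcomp D (Fm n) (Fm m)"
  using is_functor unfolding is_functor_def by blast

text \<open>Naturality of \<open>\<eta>\<close> makes \<open>mcomp C (\<eta> y) m\<close> depend on
  \<open>m\<close> only through \<open>Fm m\<close>, and the invertible \<open>\<eta> y\<close> can
  be cancelled.\<close>

lemma faithful_if_left_inverse:
  assumes "is_functor D C Ko Km" and \<eta>: "nat_iso C C (\<lambda>x. x) (\<lambda>m. m) (Ko \<circ> Fo) (Km \<circ> Fm) \<eta>"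
    and "m \<in> homset C x y" "n \<in> homset C x y" "Fm m = Fm n"
  shows "m = n"
proof (rule C.iso_mor_cancel_left)
  have xy: "x \<in> objs C" "y \<in> objs C" using C.homset_objs assms(3) by auto
  show "iso_mor C (\<eta> y)" "\<eta> y \<in> homset C y (Ko (Fo y))"
    using \<eta> xy unfolding nat_iso_def by auto
  have "mcomp C (\<eta> y) m = mcomp C (Km (Fm m)) (\<eta> x)" "mcomp C (\<eta> y) n = mcomp C (Km (Fm n)) (\<eta> x)"
    using \<eta> assms(3,4) unfolding nat_iso_def by auto
  then show "mcomp C (\<eta> y) m = mcomp C (\<eta> y) n" using assms(5) by simp
qed (use assms in auto)

lemma equivalence_imp_fully_faithful:
  assumes "is_equivalence C D Fo Fm"
  shows "fully_faithful C D Fo Fm"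
  unfolding fully_faithful_def bij_betw_def
proof (intro ballI conjI)
  obtain Ko Km \<eta> \<epsilon> where K: "is_functor D C Ko Km"
    and \<eta>: "nat_iso C C (\<lambda>x. x) (\<lambda>m. m) (Ko \<circ> Fo) (Km \<circ> Fm) \<eta>"
    and \<epsilon>: "nat_iso D D (Fo \<circ> Ko) (Fm \<circ> Km) (\<lambda>x. x) (\<lambda>m. m) \<epsilon>"
    using assms unfolding is_equivalence_def by blast
  interpret K: cat_functor D C Ko Km by unfold_locales (rule K)
  fix x y assume xy: "x \<in> objs C" "y \<in> objs C"
  show "inj_on Fm (homset C x y)"
    by (rule inj_onI) (rule faithful_if_left_inverse[OF K \<eta>])
  show "Fm ` homset C x y = homset D (Fo x) (Fo y)"
  proof
    show "Fm ` homset C x y \<subseteq> homset D (Fo x) (Fo y)" using functor_mor by auto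
    show "homset D (Fo x) (Fo y) \<subseteq> Fm ` homset C x y"
    proof
      fix g assume g: "g \<in> homset D (Fo x) (Fo y)"
      have \<eta>x: "\<eta> x \<in> homset C x (Ko (Fo x))" "iso_mor C (\<eta> x)" and
        \<eta>y: "\<eta> y \<in> homset C y (Ko (Fo y))" "iso_mor C (\<eta> y)"
        using \<eta> xy unfolding nat_iso_def by auto
      obtain k where k: "k \<in> homset C (Ko (Fo y)) y" "mcomp C (\<eta> y) k = ident C (Ko (Fo y))"
        using C.iso_morE[OF \<eta>y] by metis
      have Kg: "Km g \<in> homset C (Ko (Fo x)) (Ko (Fo y))" using K.functor_mor g .
      \<comment> \<open>The candidate preimage is \<open>Km g\<close> conjugated by
        \<open>\<eta>\<close>. Naturality of \<open>\<eta>\<close> then gives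
        \<open>Km (Fm m) = Km g\<close>, and naturality of \<open>\<epsilon>\<close> shows that
        \<open>Km\<close> is injective on this homset.\<close>
      define m where "m = mcomp C k (mcomp C (Km g) (\<eta> x))"
      have gx: "mcomp C (Km g) (\<eta> x) \<in> homset C x (Ko (Fo y))" using Kg \<eta>x by blast
      have m: "m \<in> homset C x y" unfolding m_def using k gx by blast
      have "mcomp C (\<eta> y) m = mcomp C (Km (Fm m)) (\<eta> x)"
        using \<eta> m unfolding nat_iso_def by auto
      moreover have "mcomp C (\<eta> y) m = mcomp C (Km g) (\<eta> x)"
        unfolding m_def
        using C.mcomp_assoc[OF gx k(1) \<eta>y(1)] k(2) C.mcomp_ident(2)[OF gx] by simp
      ultimately have "Km (Fm m) = Km g"
        using C.iso_mor_cancel_right[OF \<eta>x(2,1) _ Kg] K.functor_mor[OF functor_mor[OF m]]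
        by simp
      then have "Fm m = g"
        using functor_mor[OF m] g
      proof -
        assume eq: "Km (Fm m) = Km g" and h: "Fm m \<in> homset D (Fo x) (Fo y)"
        have "Fo x \<in> objs D" using xy functor_obj by blast
        then have e: "\<epsilon> (Fo x) \<in> homset D (Fo (Ko (Fo x))) (Fo x)" "iso_mor D (\<epsilon> (Fo x))"
          using \<epsilon> unfolding nat_iso_def by auto
        have "mcomp D (Fm m) (\<epsilon> (Fo x)) = mcomp D (\<epsilon> (Fo y)) (Fm (Km (Fm m)))"
          "mcomp D g (\<epsilon> (Fo x)) = mcomp D (\<epsilon> (Fo y)) (Fm (Km g))"
          using \<epsilon> h g unfolding nat_iso_def by auto
        then show ?thesis using D.iso_mor_cancel_right[OF e(2,1) h g] eq by simp
      qed
      then show "g \<in> Fm ` homset C x y" using m by blast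
    qed
  qed
qed

lemma equivalence_imp_essentially_surjective:
  assumes "is_equivalence C D Fo Fm"
  shows "essentially_surjective C D Fo"
  unfolding essentially_surjective_def
proof
  obtain Ko Km \<eta> \<epsilon> where K: "is_functor D C Ko Km"
    and \<epsilon>: "nat_iso D D (Fo \<circ> Ko) (Fm \<circ> Km) (\<lambda>x. x) (\<lambda>m. m) \<epsilon>"
    using assms unfolding is_equivalence_def by blast
  fix y assume y: "y \<in> objs D"
  then have "Ko y \<in> objs C" using K unfolding is_functor_def by blast
  moreover have "\<epsilon> y \<in> homset D (Fo (Ko y)) y" "iso_mor D (\<epsilon> y)"
    using \<epsilon> y unfolding nat_iso_def by auto
  ultimately show "\<exists>x\<in>objs C. \<exists>m\<in>homset D (Fo x) y. iso_mor D m" by blast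
qed

text \<open>Fullness lifts the inverse of \<open>Fm m\<close>, and faithfulness lifts the two
  equations that it satisfies.\<close>

lemma fully_faithful_reflects_iso:
  assumes ff: "fully_faithful C D Fo Fm" and m: "m \<in> homset C x y" and iso: "iso_mor D (Fm m)"
  shows "iso_mor C m"
proof -
  have xy: "x \<in> objs C" "y \<in> objs C" using C.homset_objs m by auto
  obtain g where g: "g \<in> homset D (Fo y) (Fo x)" "mcomp D g (Fm m) = ident D (Fo x)"
    "mcomp D (Fm m) g = ident D (Fo y)"
    using D.iso_morE[OF functor_mor[OF m] iso] .
  have inj: "inj_on Fm (homset C a b)" if "a \<in> objs C" "b \<in> objs C" for a b
    using ff that unfolding fully_faithful_def bij_betw_def by blast
  have "g \<in> Fm ` homset C y x" using ff g xy unfolding fully_faithful_def bij_betw_def by blast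
  then obtain n where n: "n \<in> homset C y x" "g = Fm n" by blast
  show ?thesis
  proof (rule C.iso_morI[OF m n(1)])
    show "mcomp C n m = ident C x"
      using inj_onD[OF inj[OF xy(1) xy(1)], of "mcomp C n m" "ident C x"] g(2) n(2) m n(1) xy
        functor_mcomp[OF m n(1)] functor_ident by auto
    show "mcomp C m n = ident C y"
      using inj_onD[OF inj[OF xy(2) xy(2)], of "mcomp C m n" "ident C y"] g(3) n(2) m n(1) xy
        functor_mcomp[OF n(1) m] functor_ident by auto
  qed
qed

text \<open>Essential surjectivity lets one choose an object \<open>Ko y\<close> and an invertible
  \<open>\<epsilon> y\<close> for each \<open>y\<close>. All the rest of the quasi-inverse is then
  forced, and each law that it must satisfy can be checked after applying the faithful
  \<open>Fm\<close>.\<close>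

lemma equivalence_if_fully_faithful:
  assumes ff: "fully_faithful C D Fo Fm" and es: "essentially_surjective C D Fo"
  shows "is_equivalence C D Fo Fm"
proof -
  have "\<forall>y \<in> objs D. \<exists>x e e'. x \<in> objs C \<and> e \<in> homset D (Fo x) y \<and> iso_mor D e \<and>
      e' \<in> homset D y (Fo x) \<and> mcomp D e' e = ident D (Fo x) \<and> mcomp D e e' = ident D y"
    using es D.iso_morE unfolding essentially_surjective_def by (metis (no_types, lifting))
  from bchoice[OF this] obtain Ko where "\<forall>y \<in> objs D. \<exists>e e'. Ko y \<in> objs C \<and>
      e \<in> homset D (Fo (Ko y)) y \<and> iso_mor D e \<and> e' \<in> homset D y (Fo (Ko y)) \<and>
      mcomp D e' e = ident D (Fo (Ko y)) \<and> mcomp D e e' = ident D y" by blast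
  from bchoice[OF this] obtain \<epsilon> where "\<forall>y \<in> objs D. \<exists>e'. Ko y \<in> objs C \<and>
      \<epsilon> y \<in> homset D (Fo (Ko y)) y \<and> iso_mor D (\<epsilon> y) \<and> e' \<in> homset D y (Fo (Ko y)) \<and>
      mcomp D e' (\<epsilon> y) = ident D (Fo (Ko y)) \<and> mcomp D (\<epsilon> y) e' = ident D y" by blast
  from bchoice[OF this] obtain \<epsilon>' where *: "\<forall>y \<in> objs D. Ko y \<in> objs C \<and>
      \<epsilon> y \<in> homset D (Fo (Ko y)) y \<and> iso_mor D (\<epsilon> y) \<and> \<epsilon>' y \<in> homset D y (Fo (Ko y)) \<and>
      mcomp D (\<epsilon>' y) (\<epsilon> y) = ident D (Fo (Ko y)) \<and> mcomp D (\<epsilon> y) (\<epsilon>' y) = ident D y" by blast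
  have K: "\<And>y. y \<in> objs D \<Longrightarrow> Ko y \<in> objs C"
    and \<epsilon>: "\<And>y. y \<in> objs D \<Longrightarrow> \<epsilon> y \<in> homset D (Fo (Ko y)) y" "\<And>y. y \<in> objs D \<Longrightarrow> iso_mor D (\<epsilon> y)"
    and \<epsilon>': "\<And>y. y \<in> objs D \<Longrightarrow> \<epsilon>' y \<in> homset D y (Fo (Ko y))"
    and \<epsilon>'\<epsilon>: "\<And>y. y \<in> objs D \<Longrightarrow> mcomp D (\<epsilon>' y) (\<epsilon> y) = ident D (Fo (Ko y))"
    and \<epsilon>\<epsilon>': "\<And>y. y \<in> objs D \<Longrightarrow> mcomp D (\<epsilon> y) (\<epsilon>' y) = ident D y"
    using * by blast+
  define lift where "lift x y g = (THE m. m \<in> homset C x y \<and> Fm m = g)" for x y g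
  have uniq: "\<exists>!m. m \<in> homset C x y \<and> Fm m = g"
    if xy: "x \<in> objs C" "y \<in> objs C" and g: "g \<in> homset D (Fo x) (Fo y)" for x y g
  proof -
    have b: "bij_betw Fm (homset C x y) (homset D (Fo x) (Fo y))"
      using ff xy unfolding fully_faithful_def by blast
    obtain m where "m \<in> homset C x y" "Fm m = g"
      using g unfolding bij_betw_imp_surj_on[OF b, symmetric] by blast
    then show ?thesis using inj_onD[OF bij_betw_imp_inj_on[OF b]] by (intro ex1I[of _ m]) auto
  qed
  have lift: "lift x y g \<in> homset C x y" "Fm (lift x y g) = g"
    if "x \<in> objs C" "y \<in> objs C" "g \<in> homset D (Fo x) (Fo y)" for x y g
    using theI'[OF uniq[OF that]] unfolding lift_def by auto
  have inj: "m = n" if "m \<in> homset C x y" "n \<in> homset C x y" "Fm m = Fm n" for m n x y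
  proof -
    have "x \<in> objs C" "y \<in> objs C" "Fm m \<in> homset D (Fo x) (Fo y)"
      using C.homset_objs[OF that(1)] functor_mor[OF that(1)] by auto
    from the1_equality[OF uniq[OF this], of m] the1_equality[OF uniq[OF this], of n] that
    show ?thesis by simp
  qed
  \<comment> \<open>The only morphism part that makes \<open>\<epsilon>\<close> natural. The
    endpoints are read off from \<open>g\<close>, because \<open>Km\<close> receives nothing but the
    morphism.\<close>
  define Km where "Km g = lift (Ko (mdom D g)) (Ko (mcod D g))
      (mcomp D (\<epsilon>' (mcod D g)) (mcomp D g (\<epsilon> (mdom D g))))" for g
  have Km: "Km g \<in> homset C (Ko y) (Ko z)" "Fm (Km g) = mcomp D (\<epsilon>' z) (mcomp D g (\<epsilon> y))"
    if g: "g \<in> homset D y z" for g y z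
  proof -
    have yz: "y \<in> objs D" "z \<in> objs D" using D.homset_objs g by auto
    have "mcomp D (\<epsilon>' z) (mcomp D g (\<epsilon> y)) \<in> homset D (Fo (Ko y)) (Fo (Ko z))"
      using yz g \<epsilon> \<epsilon>' by blast
    moreover have "mdom D g = y" "mcod D g = z" using g by (auto simp: homset_def)
    ultimately show "Km g \<in> homset C (Ko y) (Ko z)" "Fm (Km g) = mcomp D (\<epsilon>' z) (mcomp D g (\<epsilon> y))"
      unfolding Km_def using lift K yz by auto
  qed
  have \<epsilon>_nat: "mcomp D (\<epsilon> z) (Fm (Km g)) = mcomp D g (\<epsilon> y)" if g: "g \<in> homset D y z" for g y z
  proof -
    have yz: "y \<in> objs D" "z \<in> objs D" using D.homset_objs g by auto
    have ge: "mcomp D g (\<epsilon> y) \<in> homset D (Fo (Ko y)) z" using yz g \<epsilon> by blast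
    show ?thesis unfolding Km(2)[OF g]
      using D.mcomp_assoc[OF ge \<epsilon>'[OF yz(2)] \<epsilon>(1)[OF yz(2)]] \<epsilon>\<epsilon>'[OF yz(2)] D.mcomp_ident(2)[OF ge]
      by simp
  qed
  have K_functor: "is_functor D C Ko Km"
    unfolding is_functor_def
  proof (intro conjI ballI allI impI)
    fix y assume y: "y \<in> objs D" show "Ko y \<in> objs C" using K y .
    have i: "ident D y \<in> homset D y y" using y by blast
    show "Km (ident D y) = ident C (Ko y)"
    proof (rule inj[OF Km(1)[OF i]])
      show "ident C (Ko y) \<in> homset C (Ko y) (Ko y)" using K y by blast
      show "Fm (Km (ident D y)) = Fm (ident C (Ko y))"
        unfolding Km(2)[OF i] using D.mcomp_ident(2)[OF \<epsilon>(1)[OF y]] \<epsilon>'\<epsilon>[OF y] functor_ident K y by simp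
    qed
  next
    fix x y m assume "m \<in> homset D x y" then show "Km m \<in> homset C (Ko x) (Ko y)" by (rule Km)
  next
    fix x y z m n assume mn: "m \<in> homset D x y \<and> n \<in> homset D y z"
    then have m: "m \<in> homset D x y" and n: "n \<in> homset D y z" by auto
    have nm: "mcomp D n m \<in> homset D x z" using m n by blast
    have xyz: "x \<in> objs D" "y \<in> objs D" "z \<in> objs D" using D.homset_objs m n by auto
    note KK = functor_mor[OF Km(1)[OF m]] functor_mor[OF Km(1)[OF n]]
    show "Km (mcomp D n m) = mcomp C (Km n) (Km m)"
    proof (rule inj[OF Km(1)[OF nm]])
      show "mcomp C (Km n) (Km m) \<in> homset C (Ko x) (Ko z)" using Km(1) m n by blast
      \<comment> \<open>The comparison is made after composing with the invertible
        \<open>\<epsilon> z\<close>, where \<open>\<epsilon>_nat\<close> replaces each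
        \<open>Fm (Km _)\<close> by the original morphism.\<close>
      show "Fm (Km (mcomp D n m)) = Fm (mcomp C (Km n) (Km m))"
      proof (rule D.iso_mor_cancel_left[OF \<epsilon>(2)[OF xyz(3)] \<epsilon>(1)[OF xyz(3)]])
        show "Fm (Km (mcomp D n m)) \<in> homset D (Fo (Ko x)) (Fo (Ko z))"
          using functor_mor[OF Km(1)[OF nm]] .
        show "Fm (mcomp C (Km n) (Km m)) \<in> homset D (Fo (Ko x)) (Fo (Ko z))"
          using functor_mor Km(1) m n by blast
        have "mcomp D (\<epsilon> z) (Fm (mcomp C (Km n) (Km m))) =
            mcomp D (mcomp D (\<epsilon> z) (Fm (Km n))) (Fm (Km m))"
          unfolding functor_mcomp[OF Km(1)[OF m] Km(1)[OF n]]
          using D.mcomp_assoc[OF KK \<epsilon>(1)[OF xyz(3)]] by simp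
        also have "\<dots> = mcomp D n (mcomp D m (\<epsilon> x))"
          unfolding \<epsilon>_nat[OF n] D.mcomp_assoc[OF KK(1) \<epsilon>(1)[OF xyz(2)] n] \<epsilon>_nat[OF m] ..
        also have "\<dots> = mcomp D (\<epsilon> z) (Fm (Km (mcomp D n m)))"
          unfolding \<epsilon>_nat[OF nm] D.mcomp_assoc[OF \<epsilon>(1)[OF xyz(1)] m n] ..
        finally show "mcomp D (\<epsilon> z) (Fm (Km (mcomp D n m))) =
            mcomp D (\<epsilon> z) (Fm (mcomp C (Km n) (Km m)))" by simp
      qed
    qed
  qed
  \<comment> \<open>Lifting the inverse of the counit at \<open>Fo x\<close> makes the unit
    invertible, since \<open>Fm\<close> reflects isomorphisms.\<close>
  define \<eta> where "\<eta> x = lift x (Ko (Fo x)) (\<epsilon>' (Fo x))" for x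
  have \<eta>: "\<eta> x \<in> homset C x (Ko (Fo x))" "Fm (\<eta> x) = \<epsilon>' (Fo x)" if "x \<in> objs C" for x
    unfolding \<eta>_def using lift[OF that K[OF functor_obj[OF that]] \<epsilon>'[OF functor_obj[OF that]]] by auto
  have "nat_iso D D (Fo \<circ> Ko) (Fm \<circ> Km) (\<lambda>x. x) (\<lambda>m. m) \<epsilon>"
    unfolding nat_iso_def using \<epsilon> \<epsilon>_nat by auto
  moreover have "nat_iso C C (\<lambda>x. x) (\<lambda>m. m) (Ko \<circ> Fo) (Km \<circ> Fm) \<eta>"
    unfolding nat_iso_def
  proof (intro conjI ballI allI impI)
    fix x assume x: "x \<in> objs C"
    note Fx = functor_obj[OF x]
    show "\<eta> x \<in> homset C x ((Ko \<circ> Fo) x)" using \<eta> x by simp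
    have "iso_mor D (\<epsilon>' (Fo x))"
      by (rule D.iso_morI[OF \<epsilon>'[OF Fx] \<epsilon>(1)[OF Fx] \<epsilon>\<epsilon>'[OF Fx] \<epsilon>'\<epsilon>[OF Fx]])
    then show "iso_mor C (\<eta> x)"
      using fully_faithful_reflects_iso[OF ff \<eta>(1)[OF x]] \<eta>(2)[OF x] by simp
  next
    fix x y m assume m: "m \<in> homset C x y"
    have xy: "x \<in> objs C" "y \<in> objs C" using C.homset_objs m by auto
    note Fx = functor_obj[OF xy(1)] and Fy = functor_obj[OF xy(2)] and Fm = functor_mor[OF m]
    have KF: "Km (Fm m) \<in> homset C (Ko (Fo x)) (Ko (Fo y))" using Km(1)[OF Fm] .
    have me: "mcomp D (Fm m) (\<epsilon> (Fo x)) \<in> homset D (Fo (Ko (Fo x))) (Fo y)" using Fm \<epsilon> Fx by blast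
    have "mcomp C (\<eta> y) m = mcomp C (Km (Fm m)) (\<eta> x)"
    proof (rule inj)
      show "mcomp C (\<eta> y) m \<in> homset C x (Ko (Fo y))" using \<eta>(1) xy m by blast
      show "mcomp C (Km (Fm m)) (\<eta> x) \<in> homset C x (Ko (Fo y))" using \<eta>(1) xy KF by blast
      have "Fm (mcomp C (Km (Fm m)) (\<eta> x)) =
          mcomp D (mcomp D (\<epsilon>' (Fo y)) (mcomp D (Fm m) (\<epsilon> (Fo x)))) (\<epsilon>' (Fo x))"
        using functor_mcomp[OF \<eta>(1)[OF xy(1)] KF] \<eta>(2)[OF xy(1)] Km(2)[OF Fm] by simp
      also have "\<dots> = mcomp D (\<epsilon>' (Fo y)) (Fm m)"
        using D.mcomp_assoc[OF \<epsilon>'[OF Fx] me \<epsilon>'[OF Fy]] D.mcomp_assoc[OF \<epsilon>'[OF Fx] \<epsilon>(1)[OF Fx] Fm]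
          \<epsilon>\<epsilon>'[OF Fx] D.mcomp_ident(1)[OF Fm] by simp
      also have "\<dots> = Fm (mcomp C (\<eta> y) m)"
        using functor_mcomp[OF m \<eta>(1)[OF xy(2)]] \<eta>(2)[OF xy(2)] by simp
      finally show "Fm (mcomp C (\<eta> y) m) = Fm (mcomp C (Km (Fm m)) (\<eta> x))" by simp
    qed
    then show "mcomp C (\<eta> y) m = mcomp C ((Km \<circ> Fm) m) (\<eta> x)" by simp
  qed
  ultimately show ?thesis
    unfolding is_equivalence_def using is_functor K_functor by blast
qed

lemma equivalence_iff:
  "is_equivalence C D Fo Fm \<longleftrightarrow> fully_faithful C D Fo Fm \<and> essentially_surjective C D Fo"
  using equivalence_imp_fully_faithful equivalence_imp_essentially_surjective
    equivalence_if_fully_faithful by blast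

end

section \<open>Product categories, computed componentwise\<close>

lemma product_cat_simps [simp]:
  "objs (product_cat I C) = (\<Pi>\<^sub>E i\<in>I. objs (C i))"
  "mors (product_cat I C) = (\<Pi>\<^sub>E i\<in>I. mors (C i))"
  "mdom (product_cat I C) m = (\<lambda>i\<in>I. mdom (C i) (m i))"
  "mcod (product_cat I C) m = (\<lambda>i\<in>I. mcod (C i) (m i))"
  "ident (product_cat I C) x = (\<lambda>i\<in>I. ident (C i) (x i))"
  "mcomp (product_cat I C) n m = (\<lambda>i\<in>I. mcomp (C i) (n i) (m i))"
  by (simp_all add: product_cat_def)

lemma restrict_eq_iff: "restrict f I = x \<longleftrightarrow> x \<in> extensional I \<and> (\<forall>i\<in>I. f i = x i)"
  by (auto simp: extensional_def restrict_def fun_eq_iff)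

text \<open>Domains and codomains in the product are restrictions to \<open>I\<close>, so a homset
  is empty unless both of its families are extensional. This accounts for the two side conditions on
  \<open>x\<close> and \<open>y\<close>.\<close>

lemma homset_product_cat:
  "m \<in> homset (product_cat I C) x y \<longleftrightarrow> x \<in> extensional I \<and> y \<in> extensional I \<and>
     m \<in> (\<Pi>\<^sub>E i\<in>I. homset (C i) (x i) (y i))"
  by (auto simp: homset_def PiE_iff restrict_eq_iff)

lemma category_product_cat:
  assumes "\<And>i. i \<in> I \<Longrightarrow> category (C i)"
  shows "category (product_cat I C)"
proof -
  have c: "cat (C i)" if "i \<in> I" for i using assms[OF that] by (rule cat.intro)
  have ext: "m = n" if "m \<in> (\<Pi>\<^sub>E i\<in>I. X i)" "n \<in> extensional I" "\<And>i. i \<in> I \<Longrightarrow> n i = m i"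
    for m n :: "'a \<Rightarrow> 'c" and X
    using that by (auto intro!: extensionalityI[of m I n] simp: PiE_def)
  show ?thesis
    unfolding category_def homset_product_cat
  proof (intro conjI ballI allI impI)
    fix m assume m: "m \<in> mors (product_cat I C)"
    show "mdom (product_cat I C) m \<in> objs (product_cat I C)" "mcod (product_cat I C) m \<in> objs (product_cat I C)"
      using m assms unfolding category_def by (auto simp: PiE_iff)
  next
    fix x assume "x \<in> objs (product_cat I C)"
    then show "ident (product_cat I C) x \<in> (\<Pi>\<^sub>E i\<in>I. homset (C i) (x i) (x i))"
      "x \<in> extensional I" "x \<in> extensional I"
      using cat.ident_homset[OF c] by (auto simp: PiE_iff)
  next
    fix x y z m n
    assume "(x \<in> extensional I \<and> y \<in> extensional I \<and> m \<in> (\<Pi>\<^sub>E i\<in>I. homset (C i) (x i) (y i))) \<and>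
      y \<in> extensional I \<and> z \<in> extensional I \<and> n \<in> (\<Pi>\<^sub>E i\<in>I. homset (C i) (y i) (z i))"
    then show "x \<in> extensional I" "z \<in> extensional I"
      "mcomp (product_cat I C) n m \<in> (\<Pi>\<^sub>E i\<in>I. homset (C i) (x i) (z i))"
      using cat.mcomp_homset[OF c] by (auto simp: PiE_iff)
  next
    fix x y m
    assume "x \<in> extensional I \<and> y \<in> extensional I \<and> m \<in> (\<Pi>\<^sub>E i\<in>I. homset (C i) (x i) (y i))"
    then have m: "m \<in> (\<Pi>\<^sub>E i\<in>I. homset (C i) (x i) (y i))" by blast
    show "mcomp (product_cat I C) m (ident (product_cat I C) x) = m"
      "mcomp (product_cat I C) (ident (product_cat I C) y) m = m"
      by (rule sym, rule ext[OF m]; use cat.mcomp_ident[OF c PiE_mem[OF m]] in simp)+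
  next
    fix w x y z m n k
    assume "(w \<in> extensional I \<and> x \<in> extensional I \<and> m \<in> (\<Pi>\<^sub>E i\<in>I. homset (C i) (w i) (x i))) \<and>
      (x \<in> extensional I \<and> y \<in> extensional I \<and> n \<in> (\<Pi>\<^sub>E i\<in>I. homset (C i) (x i) (y i))) \<and>
      y \<in> extensional I \<and> z \<in> extensional I \<and> k \<in> (\<Pi>\<^sub>E i\<in>I. homset (C i) (y i) (z i))"
    then show "mcomp (product_cat I C) (mcomp (product_cat I C) k n) m =
        mcomp (product_cat I C) k (mcomp (product_cat I C) n m)"
      by (auto simp: PiE_iff intro!: restrict_ext cat.mcomp_assoc[OF c])
  qed
qed

lemma iso_mor_product_cat:
  assumes "\<And>i. i \<in> I \<Longrightarrow> category (C i)" and m: "m \<in> homset (product_cat I C) x y"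
  shows "iso_mor (product_cat I C) m \<longleftrightarrow> (\<forall>i\<in>I. iso_mor (C i) (m i))"
proof -
  have c: "cat (C i)" if "i \<in> I" for i using assms(1)[OF that] by (rule cat.intro)
  interpret P: cat "product_cat I C" using category_product_cat[OF assms(1)] by unfold_locales
  have mi: "m i \<in> homset (C i) (x i) (y i)" if "i \<in> I" for i
    using m that unfolding homset_product_cat by auto
  show ?thesis
  proof
    assume "iso_mor (product_cat I C) m"
    from P.iso_morE[OF m this] obtain n where n: "n \<in> homset (product_cat I C) y x"
      "mcomp (product_cat I C) n m = ident (product_cat I C) x"
      "mcomp (product_cat I C) m n = ident (product_cat I C) y" .
    show "\<forall>i\<in>I. iso_mor (C i) (m i)"
    proof
      fix i assume i: "i \<in> I"
      show "iso_mor (C i) (m i)"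
      proof (rule cat.iso_morI[OF c[OF i] mi[OF i]])
        show "n i \<in> homset (C i) (y i) (x i)" using n(1) i unfolding homset_product_cat by auto
        show "mcomp (C i) (n i) (m i) = ident (C i) (x i)" "mcomp (C i) (m i) (n i) = ident (C i) (y i)"
          using fun_cong[OF n(2), of i] fun_cong[OF n(3), of i] i by auto
      qed
    qed
  next
    assume iso: "\<forall>i\<in>I. iso_mor (C i) (m i)"
    have "\<forall>i\<in>I. \<exists>n. n \<in> homset (C i) (y i) (x i) \<and> mcomp (C i) n (m i) = ident (C i) (x i) \<and>
        mcomp (C i) (m i) n = ident (C i) (y i)"
      using iso mi cat.iso_morE[OF c] by (metis (no_types, lifting))
    from bchoice[OF this] obtain n where n: "\<forall>i\<in>I. n i \<in> homset (C i) (y i) (x i) \<and>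
        mcomp (C i) (n i) (m i) = ident (C i) (x i) \<and> mcomp (C i) (m i) (n i) = ident (C i) (y i)" by blast
    show "iso_mor (product_cat I C) m"
    proof (rule P.iso_morI[OF m])
      show "(\<lambda>i\<in>I. n i) \<in> homset (product_cat I C) y x"
        using n m unfolding homset_product_cat by auto
      show "mcomp (product_cat I C) (\<lambda>i\<in>I. n i) m = ident (product_cat I C) x"
        "mcomp (product_cat I C) m (\<lambda>i\<in>I. n i) = ident (product_cat I C) y"
        using n by (auto intro!: restrict_ext)
    qed
  qed
qed


section \<open>Product cones in a bicategory\<close>

text \<open>Full faithfulness of the functors induced by \<open>p\<close>, written out so that only
  the values of \<open>\<sigma>\<close> on \<open>I\<close> matter. Extensional families and product
  categories thereby disappear from the later arguments.\<close>

definition jointly_fully_faithful ::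
  "('o, 'a, 'c, 'z) bicat_scheme \<Rightarrow> 'i set \<Rightarrow> 'o \<Rightarrow> ('i \<Rightarrow> 'a) \<Rightarrow> bool" where
  "jointly_fully_faithful B I P p \<longleftrightarrow>
     (\<forall>Z h h' \<sigma>. h \<in> arrs B Z P \<and> h' \<in> arrs B Z P \<and>
        (\<forall>i\<in>I. \<sigma> i \<in> cells B (p i \<odot>\<^bsub>B\<^esub> h) (p i \<odot>\<^bsub>B\<^esub> h')) \<longrightarrow>
        (\<exists>!\<phi>. \<phi> \<in> cells B h h' \<and> (\<forall>i\<in>I. p i \<rhd>\<^bsub>B\<^esub> \<phi> = \<sigma> i)))"

definition jointly_essentially_surjective ::
  "('o, 'a, 'c, 'z) bicat_scheme \<Rightarrow> 'i set \<Rightarrow> ('i \<Rightarrow> 'o) \<Rightarrow> 'o \<Rightarrow> ('i \<Rightarrow> 'a) \<Rightarrow> bool" where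
  "jointly_essentially_surjective B I X P p \<longleftrightarrow>
     (\<forall>Z\<in>Obj B. \<forall>k. (\<forall>i\<in>I. k i \<in> arrs B Z (X i)) \<longrightarrow>
        (\<exists>h\<in>arrs B Z P. \<forall>i\<in>I. \<exists>\<sigma>\<in>cells B (p i \<odot>\<^bsub>B\<^esub> h) (k i). iso_cell B \<sigma>))"

lemma hom_cat_simps [simp]:
  "objs (hom_cat B X Y) = arrs B X Y" "ident (hom_cat B X Y) = id2 B"
  "mcomp (hom_cat B X Y) = vcomp B"
  by (simp_all add: hom_cat_def)

context normal_bicategory
begin

lemma homset_hom_cat:
  "\<phi> \<in> homset (hom_cat B X Y) f g \<longleftrightarrow> \<phi> \<in> cells B f g \<and> f \<in> arrs B X Y \<and> g \<in> arrs B X Y"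
  by (auto simp: homset_def hom_cat_def cells_iff)

lemma iso_mor_hom_cat:
  assumes "\<phi> \<in> homset (hom_cat B X Y) f g"
  shows "iso_mor (hom_cat B X Y) \<phi> \<longleftrightarrow> iso_cell B \<phi>"
proof -
  have "mdom (hom_cat B X Y) \<phi> = f" "mcod (hom_cat B X Y) \<phi> = g" "\<phi> \<in> mors (hom_cat B X Y)"
    using assms by (auto simp: homset_def)
  then show ?thesis
    using assms unfolding iso_mor_def iso_cell_def
    by (auto simp: homset_hom_cat cells_iff Bex_def)
qed

text \<open>The form in which cones are both built and used below. It comes from
  \<open>equivalence_iff\<close>, applied to the functor out of each hom-category, with homsets and
  isomorphisms of the product category computed componentwise.\<close>

lemma product_cone_iff:
  "product_cone B I X P p \<longleftrightarrow>
     P \<in> Obj B \<and> (\<forall>i\<in>I. X i \<in> Obj B \<and> p i \<in> arrs B P (X i)) \<and>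
     jointly_fully_faithful B I P p \<and> jointly_essentially_surjective B I X P p"
proof (cases "P \<in> Obj B \<and> (\<forall>i\<in>I. X i \<in> Obj B \<and> p i \<in> arrs B P (X i))")
  case True
  then have P: "P \<in> Obj B" and X: "\<And>i. i \<in> I \<Longrightarrow> X i \<in> Obj B"
    and p: "\<And>i. i \<in> I \<Longrightarrow> p i \<in> arrs B P (X i)" by auto
  let ?F = "\<lambda>h. \<lambda>i\<in>I. p i \<odot> h" and ?M = "\<lambda>\<phi>. \<lambda>i\<in>I. p i \<rhd> \<phi>"
  let ?D = "\<lambda>Z. product_cat I (\<lambda>i. hom_cat B Z (X i))"
  have comp: "p i \<odot> h \<in> arrs B Z (X i)" if "i \<in> I" "h \<in> arrs B Z P" for i h Z
    using comp1_arr[OF that(2) p[OF that(1)]] .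
  have wh: "p i \<rhd> \<phi> \<in> cells B (p i \<odot> h) (p i \<odot> h')"
    if "i \<in> I" "h \<in> arrs B Z P" "\<phi> \<in> cells B h h'" for i h Z \<phi> h'
    using p[OF that(1)] that by (auto simp: cells_iff arrs_iff)
  have homD: "m \<in> homset (?D Z) (?F h) (?F h') \<longleftrightarrow> m \<in> (\<Pi>\<^sub>E i\<in>I. cells B (p i \<odot> h) (p i \<odot> h'))"
    if "h \<in> arrs B Z P" "h' \<in> arrs B Z P" for m Z h h'
    using comp that by (auto simp: homset_product_cat homset_hom_cat PiE_iff)
  have loc: "cat_functor (hom_cat B Z P) (?D Z) ?F ?M" if Z: "Z \<in> Obj B" for Z
  proof
    show "category (hom_cat B Z P)" using hom_category Z P by blast
    show "category (?D Z)" using hom_category Z X by (intro category_product_cat) blast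
    show "is_functor (hom_cat B Z P) (?D Z) ?F ?M"
      unfolding is_functor_def
    proof (intro conjI ballI allI impI)
      fix h assume h: "h \<in> objs (hom_cat B Z P)"
      show "?F h \<in> objs (?D Z)" using h comp by auto
      show "?M (ident (hom_cat B Z P) h) = ident (?D Z) (?F h)"
        using h p by (auto simp: arrs_iff intro!: restrict_ext)
    next
      fix h h' \<phi> assume "\<phi> \<in> homset (hom_cat B Z P) h h'"
      then show "?M \<phi> \<in> homset (?D Z) (?F h) (?F h')"
        using wh by (auto simp: homset_hom_cat homD)
    next
      fix h h' h'' \<phi> \<psi>
      assume "\<phi> \<in> homset (hom_cat B Z P) h h' \<and> \<psi> \<in> homset (hom_cat B Z P) h' h''"
      then show "?M (mcomp (hom_cat B Z P) \<psi> \<phi>) = mcomp (?D Z) (?M \<psi>) (?M \<phi>)"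
        using p by (auto simp: homset_hom_cat cells_iff arrs_iff whisker_vcomp intro!: restrict_ext)
    qed
  qed
  have ff: "fully_faithful (hom_cat B Z P) (?D Z) ?F ?M \<longleftrightarrow>
      (\<forall>h h' \<sigma>. h \<in> arrs B Z P \<and> h' \<in> arrs B Z P \<and> (\<forall>i\<in>I. \<sigma> i \<in> cells B (p i \<odot> h) (p i \<odot> h')) \<longrightarrow>
        (\<exists>!\<phi>. \<phi> \<in> cells B h h' \<and> (\<forall>i\<in>I. p i \<rhd> \<phi> = \<sigma> i)))" for Z
  proof -
    have "bij_betw ?M (homset (hom_cat B Z P) h h') (homset (?D Z) (?F h) (?F h')) \<longleftrightarrow>
       (\<forall>\<sigma>. (\<forall>i\<in>I. \<sigma> i \<in> cells B (p i \<odot> h) (p i \<odot> h')) \<longrightarrow>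
         (\<exists>!\<phi>. \<phi> \<in> cells B h h' \<and> (\<forall>i\<in>I. p i \<rhd> \<phi> = \<sigma> i)))" (is "?bij \<longleftrightarrow> ?all")
      if h: "h \<in> arrs B Z P" "h' \<in> arrs B Z P" for h h'
    proof -
      have H1: "homset (hom_cat B Z P) h h' = cells B h h'" using h by (auto simp: homset_hom_cat)
      have H2: "homset (?D Z) (?F h) (?F h') = (\<Pi>\<^sub>E i\<in>I. cells B (p i \<odot> h) (p i \<odot> h'))"
        using homD[OF h] by blast
      have M: "?M \<phi> \<in> (\<Pi>\<^sub>E i\<in>I. cells B (p i \<odot> h) (p i \<odot> h'))" if "\<phi> \<in> cells B h h'" for \<phi>
        using wh[OF _ h(1) that] by auto
      have eq: "?M \<phi> = (\<lambda>i\<in>I. \<sigma> i) \<longleftrightarrow> (\<forall>i\<in>I. p i \<rhd> \<phi> = \<sigma> i)" for \<phi> \<sigma>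
        by (auto simp: restrict_def fun_eq_iff)
      show ?thesis
        unfolding H1 H2
      proof
        assume b: "bij_betw ?M (cells B h h') (\<Pi>\<^sub>E i\<in>I. cells B (p i \<odot> h) (p i \<odot> h'))"
        show ?all
        proof (intro allI impI)
          fix \<sigma> assume "\<forall>i\<in>I. \<sigma> i \<in> cells B (p i \<odot> h) (p i \<odot> h')"
          then have "(\<lambda>i\<in>I. \<sigma> i) \<in> ?M ` cells B h h'"
            unfolding bij_betw_imp_surj_on[OF b] by auto
          then obtain \<phi> where \<phi>: "\<phi> \<in> cells B h h'" "?M \<phi> = (\<lambda>i\<in>I. \<sigma> i)"
            by (elim imageE) simp
          show "\<exists>!\<phi>. \<phi> \<in> cells B h h' \<and> (\<forall>i\<in>I. p i \<rhd> \<phi> = \<sigma> i)"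
          proof (rule ex1I[of _ \<phi>])
            show "\<phi> \<in> cells B h h' \<and> (\<forall>i\<in>I. p i \<rhd> \<phi> = \<sigma> i)" using \<phi> unfolding eq by blast
            fix \<psi> assume "\<psi> \<in> cells B h h' \<and> (\<forall>i\<in>I. p i \<rhd> \<psi> = \<sigma> i)"
            then have "\<psi> \<in> cells B h h'" "?M \<psi> = ?M \<phi>" using \<phi>(2) eq[of \<psi> \<sigma>] by auto
            then show "\<psi> = \<phi>" using inj_onD[OF bij_betw_imp_inj_on[OF b]] \<phi>(1) by blast
          qed
        qed
      next
        assume all: ?all
        show "bij_betw ?M (cells B h h') (\<Pi>\<^sub>E i\<in>I. cells B (p i \<odot> h) (p i \<odot> h'))"
        proof (rule bij_betwI')
          fix \<phi> \<psi> assume \<phi>: "\<phi> \<in> cells B h h'" and \<psi>: "\<psi> \<in> cells B h h'"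
          show "?M \<phi> = ?M \<psi> \<longleftrightarrow> \<phi> = \<psi>"
          proof
            assume "?M \<phi> = ?M \<psi>"
            then have "\<forall>i\<in>I. p i \<rhd> \<phi> = p i \<rhd> \<psi>" unfolding eq .
            moreover have "\<forall>i\<in>I. p i \<rhd> \<psi> \<in> cells B (p i \<odot> h) (p i \<odot> h')"
              using wh[OF _ h(1) \<psi>] by blast
            ultimately show "\<phi> = \<psi>" using all[rule_format, of "\<lambda>i. p i \<rhd> \<psi>"] \<phi> \<psi> by blast
          qed simp
        next
          fix \<phi> assume "\<phi> \<in> cells B h h'" then show "?M \<phi> \<in> (\<Pi>\<^sub>E i\<in>I. cells B (p i \<odot> h) (p i \<odot> h'))" by (rule M)
        next
          fix \<sigma> assume s: "\<sigma> \<in> (\<Pi>\<^sub>E i\<in>I. cells B (p i \<odot> h) (p i \<odot> h'))"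
          then obtain \<phi> where "\<phi> \<in> cells B h h'" "\<forall>i\<in>I. p i \<rhd> \<phi> = \<sigma> i"
            using all[rule_format, of \<sigma>] by (auto simp: PiE_iff)
          moreover have "(\<lambda>i\<in>I. \<sigma> i) = \<sigma>" using s by simp
          ultimately show "\<exists>\<phi>\<in>cells B h h'. \<sigma> = ?M \<phi>" using eq[of _ \<sigma>] by metis
        qed
      qed
    qed
    then show ?thesis unfolding fully_faithful_def by (simp add: Ball_def imp_conjL)
  qed
  have es: "essentially_surjective (hom_cat B Z P) (?D Z) ?F \<longleftrightarrow>
      (\<forall>k. (\<forall>i\<in>I. k i \<in> arrs B Z (X i)) \<longrightarrow>
        (\<exists>h\<in>arrs B Z P. \<forall>i\<in>I. \<exists>\<sigma>\<in>cells B (p i \<odot> h) (k i). iso_cell B \<sigma>))" if Z: "Z \<in> Obj B" for Z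
  proof -
    have "(\<exists>m \<in> homset (?D Z) (?F h) k. iso_mor (?D Z) m) \<longleftrightarrow>
        (\<forall>i\<in>I. \<exists>\<sigma>\<in>cells B (p i \<odot> h) (k i). iso_cell B \<sigma>)" (is "?L \<longleftrightarrow> ?R")
      if h: "h \<in> arrs B Z P" and k: "k \<in> (\<Pi>\<^sub>E i\<in>I. arrs B Z (X i))" for h k
    proof -
      have hs: "m \<in> homset (?D Z) (?F h) k \<longleftrightarrow> m \<in> (\<Pi>\<^sub>E i\<in>I. cells B (p i \<odot> h) (k i))" for m
        using comp[OF _ h] k by (auto simp: homset_product_cat homset_hom_cat PiE_iff)
      have iso: "iso_mor (?D Z) m \<longleftrightarrow> (\<forall>i\<in>I. iso_cell B (m i))"
        if m: "m \<in> (\<Pi>\<^sub>E i\<in>I. cells B (p i \<odot> h) (k i))" for m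
      proof -
        have "iso_mor (?D Z) m \<longleftrightarrow> (\<forall>i\<in>I. iso_mor (hom_cat B Z (X i)) (m i))"
          using m hs hom_category[OF Z X] by (intro iso_mor_product_cat) auto
        also have "\<dots> \<longleftrightarrow> (\<forall>i\<in>I. iso_cell B (m i))"
        proof (intro ball_cong refl iso_mor_hom_cat)
          fix i assume "i \<in> I"
          then show "m i \<in> homset (hom_cat B Z (X i)) (p i \<odot> h) (k i)"
            using m k comp[OF _ h] by (auto simp: homset_hom_cat PiE_iff)
        qed
        finally show ?thesis .
      qed
      show ?thesis
      proof
        assume ?L
        then show ?R using hs iso by (metis (no_types, lifting) PiE_mem)
      next
        assume ?R
        then obtain m where m: "\<forall>i\<in>I. m i \<in> cells B (p i \<odot> h) (k i) \<and> iso_cell B (m i)"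
          using bchoice[of I "\<lambda>i \<sigma>. \<sigma> \<in> cells B (p i \<odot> h) (k i) \<and> iso_cell B \<sigma>"] by blast
        then have "(\<lambda>i\<in>I. m i) \<in> (\<Pi>\<^sub>E i\<in>I. cells B (p i \<odot> h) (k i))" by auto
        with m show ?L using hs iso by (intro bexI[of _ "\<lambda>i\<in>I. m i"]) auto
      qed
    qed
    then have *: "essentially_surjective (hom_cat B Z P) (?D Z) ?F \<longleftrightarrow>
        (\<forall>k\<in>(\<Pi>\<^sub>E i\<in>I. arrs B Z (X i)). \<exists>h\<in>arrs B Z P. \<forall>i\<in>I. \<exists>\<sigma>\<in>cells B (p i \<odot> h) (k i). iso_cell B \<sigma>)"
      unfolding essentially_surjective_def by simp
    show ?thesis unfolding *
    proof (intro iffI allI impI ballI)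
      \<comment> \<open>The family \<open>k\<close> is arbitrary outside \<open>I\<close>; its
        restriction is the corresponding object of the product category.\<close>
      fix k assume k: "\<forall>i\<in>I. k i \<in> arrs B Z (X i)"
        and all: "\<forall>k\<in>(\<Pi>\<^sub>E i\<in>I. arrs B Z (X i)). \<exists>h\<in>arrs B Z P. \<forall>i\<in>I. \<exists>\<sigma>\<in>cells B (p i \<odot> h) (k i). iso_cell B \<sigma>"
      show "\<exists>h\<in>arrs B Z P. \<forall>i\<in>I. \<exists>\<sigma>\<in>cells B (p i \<odot> h) (k i). iso_cell B \<sigma>"
        using bspec[OF all, of "\<lambda>i\<in>I. k i"] k by auto
    qed (auto simp: PiE_iff)
  qed
  have "(\<forall>Z\<in>Obj B. is_equivalence (hom_cat B Z P) (?D Z) ?F ?M) \<longleftrightarrow>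
      (\<forall>Z\<in>Obj B. fully_faithful (hom_cat B Z P) (?D Z) ?F ?M) \<and>
      (\<forall>Z\<in>Obj B. essentially_surjective (hom_cat B Z P) (?D Z) ?F)"
    using cat_functor.equivalence_iff[OF loc] by auto
  also have "(\<forall>Z\<in>Obj B. essentially_surjective (hom_cat B Z P) (?D Z) ?F) \<longleftrightarrow>
      jointly_essentially_surjective B I X P p"
    unfolding jointly_essentially_surjective_def using es by simp
  also have "(\<forall>Z\<in>Obj B. fully_faithful (hom_cat B Z P) (?D Z) ?F ?M) \<longleftrightarrow> jointly_fully_faithful B I P p"
  proof -
    \<comment> \<open>\<open>jointly_fully_faithful\<close> ranges over all \<open>Z\<close>, but an
      arrow out of \<open>Z\<close> already makes it an object.\<close>
    have "h \<in> arrs B Z P \<Longrightarrow> Z \<in> Obj B" for h Z by (auto simp: arrs_iff)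
    then show ?thesis unfolding ff jointly_fully_faithful_def by blast
  qed
  finally have "(\<forall>Z\<in>Obj B. is_equivalence (hom_cat B Z P) (?D Z) ?F ?M) \<longleftrightarrow>
      jointly_fully_faithful B I P p \<and> jointly_essentially_surjective B I X P p" .
  then show ?thesis unfolding product_cone_def using True by blast
qed (auto simp: product_cone_def)

end

section \<open>Invertible 2-cells and isomorphic arrows\<close>

context normal_bicategory
begin

lemma iso_cellE:
  assumes "\<phi> \<in> cells B f g" "iso_cell B \<phi>"
  obtains \<psi> where "\<psi> \<in> cells B g f" "\<psi> \<cdot> \<phi> = id2 B f" "\<phi> \<cdot> \<psi> = id2 B g"
  using assms unfolding iso_cell_def by (auto simp: cells_iff)

lemma iso_cellI:
  assumes "\<phi> \<in> cells B f g" "\<psi> \<in> cells B g f" "\<psi> \<cdot> \<phi> = id2 B f" "\<phi> \<cdot> \<psi> = id2 B g"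
  shows "iso_cell B \<phi>"
  using assms unfolding iso_cell_def by (auto simp: cells_iff)

lemma vcomp_cells: "\<phi> \<in> cells B f g \<Longrightarrow> \<psi> \<in> cells B g h \<Longrightarrow> \<psi> \<cdot> \<phi> \<in> cells B f h"
  by (auto simp: cells_iff)

text \<open>Phrased as a bijection because later proofs need both halves: injectivity cancels
  \<open>\<theta>\<close>, and surjectivity solves an equation for a 2-cell composed with
  \<open>\<theta>\<close>.\<close>

lemma vcomp_iso_cell_left_bij:
  assumes \<theta>: "\<theta> \<in> cells B g h" "iso_cell B \<theta>"
  shows "bij_betw (\<lambda>\<phi>. \<theta> \<cdot> \<phi>) (cells B f g) (cells B f h)"
proof -
  obtain \<theta>' where *: "\<theta>' \<in> cells B h g" "\<theta>' \<cdot> \<theta> = id2 B g" "\<theta> \<cdot> \<theta>' = id2 B h"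
    using iso_cellE[OF \<theta>] .
  have "\<theta>' \<cdot> (\<theta> \<cdot> \<phi>) = \<phi>" if "\<phi> \<in> cells B f g" for \<phi>
    using reassoc[OF *(2)] * \<theta> that by (simp add: cells_iff)
  moreover have "\<theta> \<cdot> (\<theta>' \<cdot> \<phi>) = \<phi>" if "\<phi> \<in> cells B f h" for \<phi>
    using reassoc[OF *(3)] * \<theta> that by (simp add: cells_iff)
  ultimately show ?thesis
    using * \<theta> vcomp_cells by (intro bij_betw_byWitness[where f' = "\<lambda>\<phi>. \<theta>' \<cdot> \<phi>"]) auto
qed

lemma vcomp_iso_cell_right_bij:
  assumes \<theta>: "\<theta> \<in> cells B f g" "iso_cell B \<theta>"
  shows "bij_betw (\<lambda>\<phi>. \<phi> \<cdot> \<theta>) (cells B g h) (cells B f h)"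
proof -
  obtain \<theta>' where *: "\<theta>' \<in> cells B g f" "\<theta>' \<cdot> \<theta> = id2 B f" "\<theta> \<cdot> \<theta>' = id2 B g"
    using iso_cellE[OF \<theta>] .
  have "(\<phi> \<cdot> \<theta>) \<cdot> \<theta>' = \<phi>" if "\<phi> \<in> cells B g h" for \<phi>
    using * \<theta> that by (simp add: cells_iff)
  moreover have "(\<phi> \<cdot> \<theta>') \<cdot> \<theta> = \<phi>" if "\<phi> \<in> cells B f h" for \<phi>
    using * \<theta> that by (simp add: cells_iff)
  ultimately show ?thesis
    using * \<theta> vcomp_cells by (intro bij_betw_byWitness[where f' = "\<lambda>\<phi>. \<phi> \<cdot> \<theta>'"]) auto
qed

lemma iso_cell_vcomp:
  assumes "\<phi> \<in> cells B f g" "\<psi> \<in> cells B g h" "iso_cell B \<phi>" "iso_cell B \<psi>"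
  shows "iso_cell B (\<psi> \<cdot> \<phi>)"
proof -
  obtain \<phi>' where \<phi>': "\<phi>' \<in> cells B g f" "\<phi>' \<cdot> \<phi> = id2 B f" "\<phi> \<cdot> \<phi>' = id2 B g"
    using iso_cellE assms by metis
  obtain \<psi>' where \<psi>': "\<psi>' \<in> cells B h g" "\<psi>' \<cdot> \<psi> = id2 B g" "\<psi> \<cdot> \<psi>' = id2 B h"
    using iso_cellE assms by metis
  show ?thesis
  proof (rule iso_cellI[where \<psi> = "\<phi>' \<cdot> \<psi>'"])
    show "\<psi> \<cdot> \<phi> \<in> cells B f h" "\<phi>' \<cdot> \<psi>' \<in> cells B h f" using assms \<phi>' \<psi>' vcomp_cells by blast+
    show "(\<phi>' \<cdot> \<psi>') \<cdot> \<psi> \<cdot> \<phi> = id2 B f"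
      using reassoc[OF \<psi>'(2), of \<phi>] assms \<phi>' \<psi>' by (simp add: cells_iff)
    show "(\<psi> \<cdot> \<phi>) \<cdot> \<phi>' \<cdot> \<psi>' = id2 B h"
      using reassoc[OF \<phi>'(3), of \<psi>'] assms \<phi>' \<psi>' by (simp add: cells_iff)
  qed
qed

lemma iso_cell_lwhisker:
  assumes "\<phi> \<in> cells B f f'" "iso_cell B \<phi>" "g \<in> Arr B" "src B g = trg B f"
  shows "iso_cell B (g \<rhd> \<phi>)"
proof -
  obtain \<phi>' where \<phi>': "\<phi>' \<in> cells B f' f" "\<phi>' \<cdot> \<phi> = id2 B f" "\<phi> \<cdot> \<phi>' = id2 B f'"
    using iso_cellE assms by metis
  have [simp]: "trg B f' = trg B f" using cell_simps(4)[of \<phi>] assms(1) by (auto simp: cells_iff)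
  show ?thesis
    by (rule iso_cellI[of _ "g \<odot> f" "g \<odot> f'" "g \<rhd> \<phi>'"])
      (use assms \<phi>' in \<open>auto simp: cells_iff whisker_vcomp(1)[symmetric]\<close>)
qed

lemma iso_cell_rwhisker:
  assumes "\<phi> \<in> cells B f f'" "iso_cell B \<phi>" "g \<in> Arr B" "src B f = trg B g"
  shows "iso_cell B (\<phi> \<lhd> g)"
proof -
  obtain \<phi>' where \<phi>': "\<phi>' \<in> cells B f' f" "\<phi>' \<cdot> \<phi> = id2 B f" "\<phi> \<cdot> \<phi>' = id2 B f'"
    using iso_cellE assms by metis
  have [simp]: "src B f' = src B f" using cell_simps(3)[of \<phi>] assms(1) by (auto simp: cells_iff)
  show ?thesis
    by (rule iso_cellI[of _ "f \<odot> g" "f' \<odot> g" "\<phi>' \<lhd> g"])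
      (use assms \<phi>' in \<open>auto simp: cells_iff whisker_vcomp(2)[symmetric]\<close>)
qed

lemma iso_cell_assoc:
  assumes "f \<in> Arr B" "g \<in> Arr B" "h \<in> Arr B" "src B g = trg B f" "src B h = trg B g"
  shows "iso_cell B (assoc B h g f)" "iso_cell B (assoc_inv B h g f)"
  by (rule iso_cellI[of _ "(h \<odot> g) \<odot> f" "h \<odot> g \<odot> f" "assoc_inv B h g f"];
      use assms in \<open>simp add: cells_iff\<close>)
    (rule iso_cellI[of _ "h \<odot> g \<odot> f" "(h \<odot> g) \<odot> f" "assoc B h g f"];
      use assms in \<open>simp add: cells_iff\<close>)

definition isomorphic :: "'a \<Rightarrow> 'a \<Rightarrow> bool" where
  "isomorphic f g \<longleftrightarrow> (\<exists>\<phi> \<in> cells B f g. iso_cell B \<phi>)"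

lemma isomorphic_sym: "isomorphic f g \<Longrightarrow> isomorphic g f"
  unfolding isomorphic_def by (meson iso_cellE iso_cellI)

lemma isomorphic_trans [trans]: "isomorphic f g \<Longrightarrow> isomorphic g h \<Longrightarrow> isomorphic f h"
  unfolding isomorphic_def by (meson iso_cell_vcomp vcomp_cells)

lemma isomorphic_lwhisker:
  "isomorphic f f' \<Longrightarrow> g \<in> Arr B \<Longrightarrow> src B g = trg B f \<Longrightarrow> isomorphic (g \<odot> f) (g \<odot> f')"
  unfolding isomorphic_def by (erule bexE, rule bexI, rule iso_cell_lwhisker) (auto simp: cells_iff)

lemma isomorphic_rwhisker:
  "isomorphic f f' \<Longrightarrow> g \<in> Arr B \<Longrightarrow> src B f = trg B g \<Longrightarrow> isomorphic (f \<odot> g) (f' \<odot> g)"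
  unfolding isomorphic_def by (erule bexE, rule bexI, rule iso_cell_rwhisker) (auto simp: cells_iff)

lemma isomorphic_assoc:
  assumes "f \<in> Arr B" "g \<in> Arr B" "h \<in> Arr B" "src B g = trg B f" "src B h = trg B g"
  shows "isomorphic ((h \<odot> g) \<odot> f) (h \<odot> g \<odot> f)"
  unfolding isomorphic_def
  by (rule bexI[of _ "assoc B h g f"]) (use assms in \<open>auto simp: iso_cell_assoc cells_iff\<close>)


section \<open>Transposition along a map\<close>

text \<open>The pentagon with two of its edges inverted, in the form that the triangle identity
  \<open>rco_run_comp\<close> requires.\<close>

lemma pent3:
  assumes "f \<in> Arr B" "g \<in> Arr B" "h \<in> Arr B" "k \<in> Arr B" "src B g = trg B f" "src B h = trg B g" "src B k = trg B h"
  shows "(assoc B k h g \<lhd> f) \<cdot> assoc_inv B (k \<odot> h) g f =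
    assoc_inv B k (h \<odot> g) f \<cdot> (k \<rhd> assoc_inv B h g f) \<cdot> assoc B k h (g \<odot> f)"
proof (rule cancel_r[where a = "assoc B (k \<odot> h) g f" and b = "assoc_inv B (k \<odot> h) g f"])
  show "((assoc B k h g \<lhd> f) \<cdot> assoc_inv B (k \<odot> h) g f) \<cdot> assoc B (k \<odot> h) g f =
    (assoc_inv B k (h \<odot> g) f \<cdot> (k \<rhd> assoc_inv B h g f) \<cdot> assoc B k h (g \<odot> f)) \<cdot> assoc B (k \<odot> h) g f"
    using assms by (simp add: pent0 reassoc[OF whisker_cancel(2)])
qed (use assms in \<open>auto simp: whisker_cancel\<close>)

end

section \<open>The adjunctions on hom-categories induced by a map\<close>

context adj
begin

lemma un_nat:
  assumes "\<phi> \<in> Cell B" "trg B (cdom B \<phi>) = X" "k = cdom B \<phi>" "k' = ccod B \<phi>"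
  shows "(F \<rhd> (f \<rhd> \<phi>)) \<cdot> un k = un k' \<cdot> \<phi>"
proof -
  have "(F \<rhd> (f \<rhd> \<phi>)) \<cdot> un k = ((F \<rhd> (f \<rhd> \<phi>)) \<cdot> assoc B F f k) \<cdot> (\<eta> \<lhd> k)"
    unfolding un_def using assms by simp
  also have "(F \<rhd> (f \<rhd> \<phi>)) \<cdot> assoc B F f k = assoc B F f k' \<cdot> ((F \<odot> f) \<rhd> \<phi>)"
    using assms by (simp add: nat_l)
  also have "(assoc B F f k' \<cdot> ((F \<odot> f) \<rhd> \<phi>)) \<cdot> (\<eta> \<lhd> k) = assoc B F f k' \<cdot> (((F \<odot> f) \<rhd> \<phi>) \<cdot> (\<eta> \<lhd> k))"
    using assms by simp
  also have "((F \<odot> f) \<rhd> \<phi>) \<cdot> (\<eta> \<lhd> k) = (\<eta> \<lhd> k') \<cdot> \<phi>"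
    using assms slide[of \<phi> \<eta> k k'] by simp
  finally show ?thesis unfolding un_def using assms by simp
qed

text \<open>Composition with \<open>f\<close> on the left is left adjoint to composition with
  \<open>F\<close>. The inverse transposes back through \<open>un k\<close>, and the two round trips
  are naturality followed by the triangle identities \<open>T2\<close> and
  \<open>T1\<close>.\<close>

lemma left_transpose_bij:
  assumes "k \<in> Arr B" "trg B k = X" "m \<in> Arr B" "trg B m = Y"
  shows "bij_betw (\<lambda>\<gamma>. co m \<cdot> (f \<rhd> \<gamma>)) (cells B k (F \<odot> m)) (cells B (f \<odot> k) m)"
proof (rule bij_betw_byWitness[where f' = "\<lambda>\<delta>. (F \<rhd> \<delta>) \<cdot> un k"]; (intro ballI)?)
  fix \<gamma> assume "\<gamma> \<in> cells B k (F \<odot> m)"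
  then have \<gamma>: "\<gamma> \<in> Cell B" "cdom B \<gamma> = k" "ccod B \<gamma> = F \<odot> m" by (auto simp: cells_iff)
  have "(F \<rhd> (co m \<cdot> (f \<rhd> \<gamma>))) \<cdot> un k = (F \<rhd> co m) \<cdot> ((F \<rhd> (f \<rhd> \<gamma>)) \<cdot> un k)"
    using \<gamma> assms by (simp add: wv)
  also have "\<dots> = ((F \<rhd> co m) \<cdot> un (F \<odot> m)) \<cdot> \<gamma>"
    using \<gamma> assms by (simp add: un_nat)
  finally show "(F \<rhd> (co m \<cdot> (f \<rhd> \<gamma>))) \<cdot> un k = \<gamma>" using T2 \<gamma> assms by simp
next
  fix \<delta> assume "\<delta> \<in> cells B (f \<odot> k) m"
  then have \<delta>: "\<delta> \<in> Cell B" "cdom B \<delta> = f \<odot> k" "ccod B \<delta> = m" by (auto simp: cells_iff)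
  have "co m \<cdot> (f \<rhd> ((F \<rhd> \<delta>) \<cdot> un k)) = (co m \<cdot> (f \<rhd> (F \<rhd> \<delta>))) \<cdot> (f \<rhd> un k)"
    using \<delta> assms by (simp add: wv)
  also have "\<dots> = \<delta> \<cdot> (co (f \<odot> k) \<cdot> (f \<rhd> un k))"
    using \<delta> assms by (simp add: co_nat)
  finally show "co m \<cdot> (f \<rhd> ((F \<rhd> \<delta>) \<cdot> un k)) = \<delta>" using T1 \<delta> assms by simp
qed (use assms in \<open>auto simp: cells_iff\<close>)

text \<open>The counit \<open>co\<close> only acts on the left of its argument, so composing with
  \<open>k\<close> on the right commutes with it up to rebracketing. The pentagon makes the
  rebracketing precise.\<close>

lemma co_comp:
  assumes "m \<in> Arr B" "trg B m = Y" "k \<in> Arr B" "src B m = trg B k"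
  shows "(co m \<lhd> k) \<cdot> assoc_inv B f (F \<odot> m) k = co (m \<odot> k) \<cdot> (f \<rhd> assoc B F m k)"
proof -
  have "co (m \<odot> k) \<cdot> (f \<rhd> assoc B F m k) = (\<epsilon> \<lhd> (m \<odot> k)) \<cdot> (assoc_inv B f F (m \<odot> k) \<cdot> (f \<rhd> assoc B F m k))"
    using assms by (simp add: co_def)
  also have "\<dots> = ((\<epsilon> \<lhd> (m \<odot> k)) \<cdot> assoc B (f \<odot> F) m k) \<cdot> (assoc_inv B f F m \<lhd> k) \<cdot> assoc_inv B f (F \<odot> m) k"
    using assms by (simp add: pent1)
  also have "\<dots> = (co m \<lhd> k) \<cdot> assoc_inv B f (F \<odot> m) k"
    using assms by (simp add: co_def wv nat_r[symmetric])
  finally show ?thesis by simp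
qed

text \<open>The unit and counit of the adjunction between precomposition with \<open>F\<close> (on the left) and with \<open>f\<close>
  are \<open>run k : k \<rightarrow> (k F) f\<close> and \<open>rco W : (W f) F \<rightarrow> W\<close>.\<close>

definition "run k = assoc_inv B k F f \<cdot> (k \<rhd> \<eta>)"
definition "rco W = (W \<rhd> \<epsilon>) \<cdot> assoc B W f F"

lemma run_simps [simp]:
  assumes "k \<in> Arr B" "src B k = X"
  shows "run k \<in> Cell B" "cdom B (run k) = k" "ccod B (run k) = (k \<odot> F) \<odot> f"
  using assms by (auto simp: run_def)

lemma rco_simps [simp]:
  assumes "W \<in> Arr B" "src B W = Y"
  shows "rco W \<in> Cell B" "cdom B (rco W) = (W \<odot> f) \<odot> F" "ccod B (rco W) = W"
  using assms by (auto simp: rco_def)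

lemma run_nat:
  assumes "\<phi> \<in> Cell B" "src B (cdom B \<phi>) = X" "k = cdom B \<phi>" "k' = ccod B \<phi>"
  shows "((\<phi> \<lhd> F) \<lhd> f) \<cdot> run k = run k' \<cdot> \<phi>"
proof -
  have "((\<phi> \<lhd> F) \<lhd> f) \<cdot> run k = (((\<phi> \<lhd> F) \<lhd> f) \<cdot> assoc_inv B k F f) \<cdot> (k \<rhd> \<eta>)"
    unfolding run_def using assms by simp
  also have "((\<phi> \<lhd> F) \<lhd> f) \<cdot> assoc_inv B k F f = assoc_inv B k' F f \<cdot> (\<phi> \<lhd> (F \<odot> f))"
    using assms by (simp add: nat_r')
  also have "(assoc_inv B k' F f \<cdot> (\<phi> \<lhd> (F \<odot> f))) \<cdot> (k \<rhd> \<eta>) = assoc_inv B k' F f \<cdot> ((\<phi> \<lhd> (F \<odot> f)) \<cdot> (k \<rhd> \<eta>))"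
    using assms by simp
  also have "(\<phi> \<lhd> (F \<odot> f)) \<cdot> (k \<rhd> \<eta>) = (k' \<rhd> \<eta>) \<cdot> \<phi>"
    using assms slide[of \<eta> \<phi> _ _ k k'] by simp
  finally show ?thesis unfolding run_def using assms by simp
qed

lemma rco_nat:
  assumes "\<phi> \<in> Cell B" "src B (cdom B \<phi>) = Y" "W = cdom B \<phi>" "W' = ccod B \<phi>"
  shows "rco W' \<cdot> ((\<phi> \<lhd> f) \<lhd> F) = \<phi> \<cdot> rco W"
proof -
  have "rco W' \<cdot> ((\<phi> \<lhd> f) \<lhd> F) = (W' \<rhd> \<epsilon>) \<cdot> (assoc B W' f F \<cdot> ((\<phi> \<lhd> f) \<lhd> F))"
    unfolding rco_def using assms by simp
  also have "\<dots> = ((W' \<rhd> \<epsilon>) \<cdot> (\<phi> \<lhd> (f \<odot> F))) \<cdot> assoc B W f F"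
    using assms by (simp add: nat_r)
  also have "(W' \<rhd> \<epsilon>) \<cdot> (\<phi> \<lhd> (f \<odot> F)) = \<phi> \<cdot> (W \<rhd> \<epsilon>)"
    using assms slide[of \<epsilon> \<phi> _ _ W W'] by simp
  finally show ?thesis unfolding rco_def using assms by simp
qed

text \<open>This is the first triangle identity of \<open>f\<close>, whiskered by \<open>W\<close>,
  once \<open>pent3\<close> and naturality have brought the associators into position.\<close>

lemma rco_run_comp:
  assumes "W \<in> Arr B" "src B W = Y"
  shows "(rco W \<lhd> f) \<cdot> run (W \<odot> f) = id2 B (W \<odot> f)"
proof -
  have "(rco W \<lhd> f) \<cdot> run (W \<odot> f) =
     ((W \<rhd> \<epsilon>) \<lhd> f) \<cdot> ((assoc B W f F \<lhd> f) \<cdot> assoc_inv B (W \<odot> f) F f) \<cdot> ((W \<odot> f) \<rhd> \<eta>)"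
    using assms by (simp add: run_def rco_def wv)
  also have "\<dots> = (((W \<rhd> \<epsilon>) \<lhd> f) \<cdot> assoc_inv B W (f \<odot> F) f) \<cdot> (W \<rhd> assoc_inv B f F f) \<cdot>
      (assoc B W f (F \<odot> f) \<cdot> ((W \<odot> f) \<rhd> \<eta>))"
    using assms by (simp add: pent3)
  also have "((W \<rhd> \<epsilon>) \<lhd> f) \<cdot> assoc_inv B W (f \<odot> F) f = W \<rhd> (\<epsilon> \<lhd> f)"
    using nat_m'[of \<epsilon> f W] assms by simp
  also have "assoc B W f (F \<odot> f) \<cdot> ((W \<odot> f) \<rhd> \<eta>) = W \<rhd> (f \<rhd> \<eta>)"
    using assms by (simp add: nat_l)
  also have "(W \<rhd> (\<epsilon> \<lhd> f)) \<cdot> (W \<rhd> assoc_inv B f F f) \<cdot> (W \<rhd> (f \<rhd> \<eta>)) =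
      W \<rhd> ((\<epsilon> \<lhd> f) \<cdot> assoc_inv B f F f \<cdot> (f \<rhd> \<eta>))"
    using assms by (simp add: wv del: adj_simps(11))
  finally show ?thesis using assms by simp
qed

text \<open>The argument for right adjoints, done by hand: cells
  \<open>k \<rightarrow> W i f\<close> transpose to cells \<open>k F \<rightarrow> W i\<close>,
  where the universal property of \<open>R\<close> applies, and the result is transposed
  back.\<close>

lemma precomposition_preserves_products:
  assumes cone: "cat_product_cone (hom_cat B Y Q) I W R \<pi>"
    and "\<And>i. i \<in> I \<Longrightarrow> W i \<in> arrs B Y Q"
  shows "cat_product_cone (hom_cat B X Q) I (\<lambda>i. W i \<odot> f) (R \<odot> f) (\<lambda>i. \<pi> i \<lhd> f)"
  unfolding cat_product_cone_def homset_hom_cat hom_cat_simps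
proof (intro conjI ballI allI impI)
  have R: "R \<in> arrs B Y Q" and \<pi>: "\<And>i. i \<in> I \<Longrightarrow> \<pi> i \<in> cells B R (W i)"
    using cone unfolding cat_product_cone_def homset_hom_cat by auto
  have [simp]: "R \<in> Arr B" "src B R = Y" "trg B R = Q" using R by (auto simp: arrs_iff)
  have W: "W i \<in> Arr B" "src B (W i) = Y" "trg B (W i) = Q" if "i \<in> I" for i
    using assms(2)[OF that] by (auto simp: arrs_iff)
  show "R \<odot> f \<in> arrs B X Q" "R \<odot> f \<in> arrs B X Q" by (auto simp: arrs_iff)
  fix i assume i: "i \<in> I"
  show "\<pi> i \<lhd> f \<in> cells B (R \<odot> f) (W i \<odot> f)" using \<pi>[OF i] by (auto simp: cells_iff)
  show "W i \<odot> f \<in> arrs B X Q" using W[OF i] by (auto simp: arrs_iff)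
next
  fix k \<sigma> assume k: "k \<in> arrs B X Q"
    and "\<forall>i\<in>I. \<sigma> i \<in> cells B k (W i \<odot> f) \<and> k \<in> arrs B X Q \<and> W i \<odot> f \<in> arrs B X Q"
  then have \<sigma>: "\<sigma> i \<in> Cell B" "cdom B (\<sigma> i) = k" "ccod B (\<sigma> i) = W i \<odot> f" if "i \<in> I" for i
    using that by (auto simp: cells_iff)
  have R: "R \<in> arrs B Y Q" and \<pi>: "\<And>i. i \<in> I \<Longrightarrow> \<pi> i \<in> cells B R (W i)"
    using cone unfolding cat_product_cone_def homset_hom_cat by auto
  have [simp]: "R \<in> Arr B" "src B R = Y" "trg B R = Q" using R by (auto simp: arrs_iff)
  have W: "W i \<in> Arr B" "src B (W i) = Y" "trg B (W i) = Q" if "i \<in> I" for i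
    using assms(2)[OF that] by (auto simp: arrs_iff)
  have [simp]: "k \<in> Arr B" "src B k = X" "trg B k = Q" using k by (auto simp: arrs_iff)
  have \<pi>': "\<pi> i \<in> Cell B" "cdom B (\<pi> i) = R" "ccod B (\<pi> i) = W i" if "i \<in> I" for i
    using \<pi>[OF that] by (auto simp: cells_iff)
  have univ: "\<exists>!\<delta>. \<delta> \<in> cells B (k \<odot> F) R \<and> (\<forall>i\<in>I. \<pi> i \<cdot> \<delta> = \<rho> i)"
    if "\<And>i. i \<in> I \<Longrightarrow> \<rho> i \<in> cells B (k \<odot> F) (W i)" for \<rho>
  proof -
    have kF: "k \<odot> F \<in> arrs B Y Q" by (auto simp: arrs_iff)
    have "\<exists>!h. (h \<in> cells B (k \<odot> F) R \<and> k \<odot> F \<in> arrs B Y Q \<and> R \<in> arrs B Y Q) \<and> (\<forall>i\<in>I. \<pi> i \<cdot> h = \<rho> i)"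
      using cone kF that assms(2) unfolding cat_product_cone_def homset_hom_cat hom_cat_simps by blast
    then show ?thesis using kF R by simp
  qed
  \<comment> \<open>The transposes of the \<open>\<sigma> i\<close>.\<close>
  define \<rho> where "\<rho> i = rco (W i) \<cdot> (\<sigma> i \<lhd> F)" for i
  have \<rho>: "\<rho> i \<in> cells B (k \<odot> F) (W i)" if "i \<in> I" for i
    unfolding \<rho>_def using \<sigma>[OF that] W[OF that] by (auto simp: cells_iff)
  obtain \<delta> where \<delta>: "\<delta> \<in> cells B (k \<odot> F) R" "\<And>i. i \<in> I \<Longrightarrow> \<pi> i \<cdot> \<delta> = \<rho> i"
    using univ[OF \<rho>] by blast
  have d: "\<delta> \<in> Cell B" "cdom B \<delta> = k \<odot> F" "ccod B \<delta> = R" using \<delta> by (auto simp: cells_iff)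
  \<comment> \<open>The mediating cell is the transpose of \<open>\<delta>\<close> back along the
    unit \<open>run k\<close>.\<close>
  have "\<exists>!h. h \<in> cells B k (R \<odot> f) \<and> (\<forall>i\<in>I. (\<pi> i \<lhd> f) \<cdot> h = \<sigma> i)"
  proof (rule ex1I[of _ "(\<delta> \<lhd> f) \<cdot> run k"], intro conjI ballI)
    show "(\<delta> \<lhd> f) \<cdot> run k \<in> cells B k (R \<odot> f)" using d by (auto simp: cells_iff)
    fix i assume i: "i \<in> I"
    note [simp] = \<sigma>[OF i] W[OF i] \<pi>'[OF i] d
    have "(\<pi> i \<lhd> f) \<cdot> (\<delta> \<lhd> f) \<cdot> run k = ((\<pi> i \<cdot> \<delta>) \<lhd> f) \<cdot> run k" by (simp add: wv)
    also have "\<dots> = (rco (W i) \<lhd> f) \<cdot> (((\<sigma> i \<lhd> F) \<lhd> f) \<cdot> run k)"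
      unfolding \<delta>(2)[OF i] \<rho>_def by (simp add: wv)
    also have "\<dots> = ((rco (W i) \<lhd> f) \<cdot> run (W i \<odot> f)) \<cdot> \<sigma> i" by (simp add: run_nat)
    finally show "(\<pi> i \<lhd> f) \<cdot> (\<delta> \<lhd> f) \<cdot> run k = \<sigma> i" by (simp add: rco_run_comp)
  next
    fix \<beta> assume \<beta>: "\<beta> \<in> cells B k (R \<odot> f) \<and> (\<forall>i\<in>I. (\<pi> i \<lhd> f) \<cdot> \<beta> = \<sigma> i)"
    then have [simp]: "\<beta> \<in> Cell B" "cdom B \<beta> = k" "ccod B \<beta> = R \<odot> f" by (auto simp: cells_iff)
    \<comment> \<open>For uniqueness any competitor \<open>\<beta>\<close> is transposed. The
      transpose has the same components as \<open>\<delta>\<close>, hence equals it, and the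
      triangle identity recovers \<open>\<beta>\<close> from it.\<close>
    define \<delta>' where "\<delta>' = rco R \<cdot> (\<beta> \<lhd> F)"
    have "\<delta>' \<in> cells B (k \<odot> F) R" unfolding \<delta>'_def by (auto simp: cells_iff)
    moreover have "\<pi> i \<cdot> \<delta>' = \<rho> i" if i: "i \<in> I" for i
    proof -
      note [simp] = \<sigma>[OF i] W[OF i] \<pi>'[OF i]
      have "\<pi> i \<cdot> \<delta>' = (\<pi> i \<cdot> rco R) \<cdot> (\<beta> \<lhd> F)" unfolding \<delta>'_def by simp
      also have "\<dots> = (rco (W i) \<cdot> ((\<pi> i \<lhd> f) \<lhd> F)) \<cdot> (\<beta> \<lhd> F)" by (simp add: rco_nat)
      also have "\<dots> = rco (W i) \<cdot> (((\<pi> i \<lhd> f) \<cdot> \<beta>) \<lhd> F)" by (simp add: wv)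
      finally show ?thesis using \<beta> i by (simp add: \<rho>_def)
    qed
    ultimately have eq: "\<delta>' = \<delta>" using univ[OF \<rho>] \<delta> by blast
    have "(\<delta> \<lhd> f) \<cdot> run k = (rco R \<lhd> f) \<cdot> (((\<beta> \<lhd> F) \<lhd> f) \<cdot> run k)"
      unfolding eq[symmetric] \<delta>'_def by (simp add: wv)
    also have "\<dots> = ((rco R \<lhd> f) \<cdot> run (R \<odot> f)) \<cdot> \<beta>" by (simp add: run_nat)
    finally show "\<beta> = (\<delta> \<lhd> f) \<cdot> run k" by (simp add: rco_run_comp)
  qed
  moreover have "R \<odot> f \<in> arrs B X Q" by (auto simp: arrs_iff)
  ultimately show "\<exists>!h. (h \<in> cells B k (R \<odot> f) \<and> k \<in> arrs B X Q \<and> R \<odot> f \<in> arrs B X Q) \<and>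
      (\<forall>i\<in>I. (\<pi> i \<lhd> f) \<cdot> h = \<sigma> i)" using k by simp
qed

end

context adj
begin

text \<open>Up to invertible 2-cells, pasting with the transpose of \<open>\<pi>\<close> is composition with \<open>\<pi> g\<close>
  followed by transposition along \<open>f\<close>.\<close>

lemma pasting_transpose:
  assumes "S \<in> Arr B" "p \<in> Arr B" "R \<in> Arr B" "g \<in> Arr B" "u \<in> Arr B" "T \<in> Arr B"
    "trg B S = Y" "src B S = trg B p" "src B R = src B p" "trg B R = X" "trg B g = src B p"
    "trg B u = X" "src B u = trg B T" "src B T = src B g"
    and "\<pi> \<in> cells B R (F \<odot> S \<odot> p)" "\<beta> \<in> cells B (u \<odot> T) (R \<odot> g)"
  shows "pasting B T R S p (co (S \<odot> p) \<cdot> (f \<rhd> \<pi>)) f g \<beta> u =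
    (co (S \<odot> p \<odot> g) \<cdot>
      (f \<rhd> (((F \<rhd> assoc B S p g) \<cdot> assoc B F (S \<odot> p) g) \<cdot> (\<pi> \<lhd> g) \<cdot> \<beta>))) \<cdot> assoc B f u T"
proof -
  note [simp] = assms(1-14)
  have [simp]: "\<pi> \<in> Cell B" "cdom B \<pi> = R" "ccod B \<pi> = F \<odot> S \<odot> p"
    "\<beta> \<in> Cell B" "cdom B \<beta> = u \<odot> T" "ccod B \<beta> = R \<odot> g"
    using assms(15,16) by (auto simp: cells_iff)
  let ?r = "(f \<rhd> \<beta>) \<cdot> assoc B f u T"
  have "pasting B T R S p (co (S \<odot> p) \<cdot> (f \<rhd> \<pi>)) f g \<beta> u =
      assoc B S p g \<cdot> (co (S \<odot> p) \<lhd> g) \<cdot> (((f \<rhd> \<pi>) \<lhd> g) \<cdot> assoc_inv B f R g) \<cdot> ?r"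
    by (simp add: pasting_def wv)
  also have "((f \<rhd> \<pi>) \<lhd> g) \<cdot> assoc_inv B f R g = assoc_inv B f (F \<odot> S \<odot> p) g \<cdot> (f \<rhd> (\<pi> \<lhd> g))"
    by (simp add: nat_m')
  also have "assoc B S p g \<cdot> (co (S \<odot> p) \<lhd> g) \<cdot> (assoc_inv B f (F \<odot> S \<odot> p) g \<cdot> (f \<rhd> (\<pi> \<lhd> g))) \<cdot> ?r =
      assoc B S p g \<cdot> ((co (S \<odot> p) \<lhd> g) \<cdot> assoc_inv B f (F \<odot> S \<odot> p) g) \<cdot> (f \<rhd> (\<pi> \<lhd> g)) \<cdot> ?r"
    by simp
  also have "(co (S \<odot> p) \<lhd> g) \<cdot> assoc_inv B f (F \<odot> S \<odot> p) g =
      co ((S \<odot> p) \<odot> g) \<cdot> (f \<rhd> assoc B F (S \<odot> p) g)"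
    using co_comp[of "S \<odot> p" g] by simp
  also have "assoc B S p g \<cdot> (co ((S \<odot> p) \<odot> g) \<cdot> (f \<rhd> assoc B F (S \<odot> p) g)) \<cdot> (f \<rhd> (\<pi> \<lhd> g)) \<cdot> ?r =
      (assoc B S p g \<cdot> co ((S \<odot> p) \<odot> g)) \<cdot> (f \<rhd> assoc B F (S \<odot> p) g) \<cdot> (f \<rhd> (\<pi> \<lhd> g)) \<cdot> ?r"
    by simp
  also have "assoc B S p g \<cdot> co ((S \<odot> p) \<odot> g) = co (S \<odot> p \<odot> g) \<cdot> (f \<rhd> (F \<rhd> assoc B S p g))"
    by (simp add: co_nat)
  finally show ?thesis by (simp add: wv)
qed

text \<open>The map is the right-hand side of \<open>pasting_transpose\<close> with a free
  \<open>\<gamma>\<close> in place of \<open>(\<pi> \<lhd> g) \<cdot> \<beta>\<close>. It is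
  bijective as a composite of three bijections: rebracketing the codomain, transposing along
  \<open>f\<close>, and rebracketing the domain.\<close>

lemma pasting_transpose_bij:
  assumes "S \<in> Arr B" "p \<in> Arr B" "g \<in> Arr B" "u \<in> Arr B" "T \<in> Arr B"
    "trg B S = Y" "src B S = trg B p" "trg B g = src B p"
    "trg B u = X" "src B u = trg B T" "src B T = src B g"
  shows "bij_betw (\<lambda>\<gamma>. (co (S \<odot> p \<odot> g) \<cdot>
      (f \<rhd> (((F \<rhd> assoc B S p g) \<cdot> assoc B F (S \<odot> p) g) \<cdot> \<gamma>))) \<cdot> assoc B f u T)
    (cells B (u \<odot> T) ((F \<odot> S \<odot> p) \<odot> g)) (cells B ((f \<odot> u) \<odot> T) (S \<odot> p \<odot> g))"
proof -
  note [simp] = assms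
  let ?c = "(F \<rhd> assoc B S p g) \<cdot> assoc B F (S \<odot> p) g"
  have c: "?c \<in> cells B ((F \<odot> S \<odot> p) \<odot> g) (F \<odot> S \<odot> p \<odot> g)" by (auto simp: cells_iff)
  have "iso_cell B ?c"
    by (rule iso_cell_vcomp[of _ "(F \<odot> S \<odot> p) \<odot> g" "F \<odot> (S \<odot> p) \<odot> g" _ "F \<odot> S \<odot> p \<odot> g"];
      (rule iso_cell_lwhisker[of _ "(S \<odot> p) \<odot> g" "S \<odot> p \<odot> g"])?)
      (auto simp: cells_iff iso_cell_assoc)
  note b1 = vcomp_iso_cell_left_bij[OF c this, of "u \<odot> T"]
  have b2: "bij_betw (\<lambda>\<gamma>. co (S \<odot> p \<odot> g) \<cdot> (f \<rhd> \<gamma>)) (cells B (u \<odot> T) (F \<odot> S \<odot> p \<odot> g))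
      (cells B (f \<odot> u \<odot> T) (S \<odot> p \<odot> g))"
    by (rule left_transpose_bij) auto
  have "assoc B f u T \<in> cells B ((f \<odot> u) \<odot> T) (f \<odot> u \<odot> T)" by (auto simp: cells_iff)
  note b3 = vcomp_iso_cell_right_bij[OF this, of "S \<odot> p \<odot> g"]
  show ?thesis
    using bij_betw_trans[OF bij_betw_trans[OF b1 b2] b3] by (simp add: iso_cell_assoc comp_def)
qed

end

section \<open>Finite products in \<open>G\<close>\<close>

context precartesian_bicategory
begin

text \<open>Isolates the local construction, and its conclusion mentions neither adjoints nor local
  projections: a 2-cell into \<open>R g\<close> is the same as a family of 2-cells over the
  \<open>S i\<close>, the passage being pasting with the \<open>\<omega> i\<close>.\<close>

lemma local_product:
  fixes I :: "nat set"
  assumes "finite I" "P \<in> Obj B" "Q \<in> Obj B"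
    and p: "\<And>i. i \<in> I \<Longrightarrow> p i \<in> arrs B P (X i)"
    and q: "\<And>i. i \<in> I \<Longrightarrow> q i \<in> arrs B Q (A i) \<and> is_map B (q i)"
    and S: "\<And>i. i \<in> I \<Longrightarrow> S i \<in> arrs B (X i) (A i)"
  obtains R \<omega> where "R \<in> arrs B P Q" "\<forall>i\<in>I. \<omega> i \<in> cells B (q i \<odot> R) (S i \<odot> p i)"
    "\<forall>Z D T g u \<sigma>. T \<in> arrs B Z D \<and> g \<in> arrs B Z P \<and> is_map B g \<and> u \<in> arrs B D Q \<and>
      (\<forall>i\<in>I. \<sigma> i \<in> cells B ((q i \<odot> u) \<odot> T) (S i \<odot> p i \<odot> g)) \<longrightarrow>
      (\<exists>!\<beta>. \<beta> \<in> cells B (u \<odot> T) (R \<odot> g) \<and>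
        (\<forall>i\<in>I. pasting B T R (S i) (p i) (\<omega> i) (q i) g \<beta> u = \<sigma> i))"
proof -
  \<comment> \<open>Right adjoint, unit and counit are packed into one triple so that a single
    choice over \<open>I\<close> provides all three.\<close>
  have "\<forall>i\<in>I. \<exists>t. adjunction B (q i) (fst t) (fst (snd t)) (snd (snd t))"
    using q unfolding is_map_def by simp
  from bchoice[OF this] obtain t
    where t: "\<forall>i\<in>I. adjunction B (q i) (fst (t i)) (fst (snd (t i))) (snd (snd (t i)))" by blast
  define q' where "q' i = fst (t i)" for i
  define \<eta> where "\<eta> i = fst (snd (t i))" for i
  define \<epsilon> where "\<epsilon> i = snd (snd (t i))" for i
  have adj: "adj B (q i) (q' i) (\<eta> i) (\<epsilon> i)" if "i \<in> I" for i
    using t that unfolding q'_def \<eta>_def \<epsilon>_def by unfold_locales blast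
  define W where "W i = q' i \<odot> S i \<odot> p i" for i
  have s: "p i \<in> Arr B" "src B (p i) = P" "trg B (p i) = X i" "q i \<in> Arr B" "src B (q i) = Q"
    "trg B (q i) = A i" "S i \<in> Arr B" "src B (S i) = X i" "trg B (S i) = A i"
    "q' i \<in> Arr B" "src B (q' i) = A i" "trg B (q' i) = Q" if "i \<in> I" for i
    using p[OF that] q[OF that] S[OF that] adj.adj_simps(2-4)[OF adj[OF that]] by (auto simp: arrs_iff)
  have W: "W i \<in> arrs B P Q" if "i \<in> I" for i
    unfolding W_def using s[OF that] by (auto simp: arrs_iff)
  obtain R \<pi> where cone: "cat_product_cone (hom_cat B P Q) I W R \<pi>"
    using hom_finite_products[OF assms(2,3), unfolded cat_has_finite_products_def, rule_format, of I W]
      W assms(1) by auto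
  then have R: "R \<in> arrs B P Q" and \<pi>: "\<And>i. i \<in> I \<Longrightarrow> \<pi> i \<in> cells B R (W i)"
    unfolding cat_product_cone_def homset_hom_cat by auto
  \<comment> \<open>The transpose along \<open>q i\<close> of the local projection
    \<open>\<pi> i : R \<rightarrow> W i\<close>.\<close>
  define \<omega> where "\<omega> i = adj.co B (q i) (q' i) (\<epsilon> i) (S i \<odot> p i) \<cdot> (q i \<rhd> \<pi> i)" for i
  show thesis
  proof (rule that[OF R]; intro ballI allI impI; (elim conjE)?)
    fix i assume i: "i \<in> I"
    show "\<omega> i \<in> cells B (q i \<odot> R) (S i \<odot> p i)"
      unfolding \<omega>_def using adj.co_simps[OF adj[OF i], of "S i \<odot> p i"] s[OF i] \<pi>[OF i] R
      by (auto simp: cells_iff arrs_iff W_def)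
  next
    fix Z D T g u \<sigma>
    assume T: "T \<in> arrs B Z D" and g: "g \<in> arrs B Z P" "is_map B g" and u: "u \<in> arrs B D Q"
      and \<sigma>: "\<forall>i\<in>I. \<sigma> i \<in> cells B ((q i \<odot> u) \<odot> T) (S i \<odot> p i \<odot> g)"
    \<comment> \<open>\<open>K i\<close> identifies 2-cells into \<open>W i g\<close> with 2-cells
      into \<open>S i (p i g)\<close>. Pasting \<open>\<beta>\<close> with \<open>\<omega> i\<close>
      turns out to be \<open>K i\<close> applied to the component
      \<open>(\<pi> i \<lhd> g) \<cdot> \<beta>\<close>.\<close>
    define K where "K i \<gamma> = (adj.co B (q i) (q' i) (\<epsilon> i) (S i \<odot> p i \<odot> g) \<cdot>
      (q i \<rhd> (((q' i \<rhd> assoc B (S i) (p i) g) \<cdot> assoc B (q' i) (S i \<odot> p i) g) \<cdot> \<gamma>))) \<cdot>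
      assoc B (q i) u T" for i \<gamma>
    have K: "bij_betw (K i) (cells B (u \<odot> T) (W i \<odot> g)) (cells B ((q i \<odot> u) \<odot> T) (S i \<odot> p i \<odot> g))"
      if i: "i \<in> I" for i
      unfolding K_def W_def
      by (rule adj.pasting_transpose_bij[OF adj[OF i]]) (use s[OF i] T g u in \<open>auto simp: arrs_iff\<close>)
    have pasting: "pasting B T R (S i) (p i) (\<omega> i) (q i) g \<beta> u = K i ((\<pi> i \<lhd> g) \<cdot> \<beta>)"
      if i: "i \<in> I" and \<beta>: "\<beta> \<in> cells B (u \<odot> T) (R \<odot> g)" for i \<beta>
      unfolding K_def \<omega>_def
      by (rule adj.pasting_transpose[OF adj[OF i]])
        (use s[OF i] T g u \<beta> R \<pi>[OF i] in \<open>auto simp: arrs_iff W_def\<close>)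
    obtain F \<eta>' \<epsilon>' where "adjunction B g F \<eta>' \<epsilon>'" using g unfolding is_map_def by blast
    then interpret g: adj B g F \<eta>' \<epsilon>' by unfold_locales
    have [simp]: "src B g = Z" "trg B g = P" using g by (auto simp: arrs_iff)
    have cone': "cat_product_cone (hom_cat B Z Q) I (\<lambda>i. W i \<odot> g) (R \<odot> g) (\<lambda>i. \<pi> i \<lhd> g)"
      using g.precomposition_preserves_products[of Q I W R \<pi>] cone W by simp
    have uT: "u \<odot> T \<in> arrs B Z Q" using u T comp1_arr by blast
    have Wg: "W i \<odot> g \<in> arrs B Z Q" if "i \<in> I" for i using comp1_arr[OF g(1) W[OF that]] .
    have Rg: "R \<odot> g \<in> arrs B Z Q" using comp1_arr[OF g(1) R] .
    \<comment> \<open>Surjectivity of \<open>K i\<close> pulls each prescribed pasting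
      \<open>\<sigma> i\<close> back to a component \<open>\<gamma> i\<close> of a cone over the
      local product.\<close>
    have "\<forall>i\<in>I. \<exists>\<gamma>. \<gamma> \<in> cells B (u \<odot> T) (W i \<odot> g) \<and> K i \<gamma> = \<sigma> i"
      using K \<sigma> bij_betw_imp_surj_on by (metis (no_types, lifting) imageE)
    from bchoice[OF this] obtain \<gamma>
      where \<gamma>: "\<forall>i\<in>I. \<gamma> i \<in> cells B (u \<odot> T) (W i \<odot> g) \<and> K i (\<gamma> i) = \<sigma> i" by blast
    have "\<exists>!\<beta>. \<beta> \<in> homset (hom_cat B Z Q) (u \<odot> T) (R \<odot> g) \<and> (\<forall>i\<in>I. (\<pi> i \<lhd> g) \<cdot> \<beta> = \<gamma> i)"
      using cone' uT Wg \<gamma> unfolding cat_product_cone_def homset_hom_cat hom_cat_simps by blast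
    then have ex: "\<exists>!\<beta>. \<beta> \<in> cells B (u \<odot> T) (R \<odot> g) \<and> (\<forall>i\<in>I. (\<pi> i \<lhd> g) \<cdot> \<beta> = \<gamma> i)"
      using uT Rg by (simp add: homset_hom_cat)
    \<comment> \<open>Injectivity of \<open>K i\<close> makes prescribing the pastings equivalent to
      prescribing the components, so unique existence transfers.\<close>
    have "(\<pi> i \<lhd> g) \<cdot> \<beta> = \<gamma> i \<longleftrightarrow> pasting B T R (S i) (p i) (\<omega> i) (q i) g \<beta> u = \<sigma> i"
      if i: "i \<in> I" and \<beta>: "\<beta> \<in> cells B (u \<odot> T) (R \<odot> g)" for i \<beta>
    proof -
      have "\<pi> i \<lhd> g \<in> cells B (R \<odot> g) (W i \<odot> g)"
        using cone' i unfolding cat_product_cone_def homset_hom_cat by blast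
      then have "(\<pi> i \<lhd> g) \<cdot> \<beta> \<in> cells B (u \<odot> T) (W i \<odot> g)" using \<beta> vcomp_cells by blast
      then show ?thesis
        unfolding pasting[OF i \<beta>] using inj_onD[OF bij_betw_imp_inj_on[OF K[OF i]]] \<gamma> i by auto
    qed
    then show "\<exists>!\<beta>. \<beta> \<in> cells B (u \<odot> T) (R \<odot> g) \<and>
        (\<forall>i\<in>I. pasting B T R (S i) (p i) (\<omega> i) (q i) g \<beta> u = \<sigma> i)"
      using ex by (simp cong: conj_cong)
  qed
qed

end

section \<open>Uniqueness and preservation of product cones\<close>

lemma jointly_fully_faithfulD:
  assumes "jointly_fully_faithful B I P p" "h \<in> arrs B Z P" "h' \<in> arrs B Z P"
    "\<And>i. i \<in> I \<Longrightarrow> \<sigma> i \<in> cells B (p i \<odot>\<^bsub>B\<^esub> h) (p i \<odot>\<^bsub>B\<^esub> h')"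
  shows "\<exists>!\<phi>. \<phi> \<in> cells B h h' \<and> (\<forall>i\<in>I. p i \<rhd>\<^bsub>B\<^esub> \<phi> = \<sigma> i)"
  using assms unfolding jointly_fully_faithful_def by blast

context normal_bicategory
begin

lemma lwhisker_cells:
  "\<phi> \<in> cells B h h' \<Longrightarrow> g \<in> Arr B \<Longrightarrow> trg B h = src B g \<Longrightarrow> g \<rhd> \<phi> \<in> cells B (g \<odot> h) (g \<odot> h')"
  by (auto simp: cells_iff)

text \<open>Invertible cells \<open>\<theta> i : p i \<rightarrow> p' i\<close> conjugate families
  of 2-cells for \<open>p'\<close> into families for \<open>p\<close>. By interchange the conjugated
  lifting problem has the same solutions \<open>\<phi>\<close>.\<close>

lemma jointly_fully_faithful_isomorphic:
  assumes ff: "jointly_fully_faithful B I P p" and p: "\<And>i. i \<in> I \<Longrightarrow> p i \<in> Arr B \<and> src B (p i) = P"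
    and iso: "\<And>i. i \<in> I \<Longrightarrow> isomorphic (p i) (p' i)"
  shows "jointly_fully_faithful B I P p'"
  unfolding jointly_fully_faithful_def
proof (intro allI impI; elim conjE)
  fix Z h h' \<sigma>
  assume h: "h \<in> arrs B Z P" "h' \<in> arrs B Z P" and \<sigma>: "\<forall>i\<in>I. \<sigma> i \<in> cells B (p' i \<odot> h) (p' i \<odot> h')"
  obtain \<theta> where \<theta>: "\<forall>i\<in>I. \<theta> i \<in> cells B (p i) (p' i) \<and> iso_cell B (\<theta> i)"
    using iso bchoice[of I "\<lambda>i \<theta>. \<theta> \<in> cells B (p i) (p' i) \<and> iso_cell B \<theta>"]
    unfolding isomorphic_def by blast
  have \<theta>h: "\<theta> i \<lhd> k \<in> cells B (p i \<odot> k) (p' i \<odot> k)" "iso_cell B (\<theta> i \<lhd> k)"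
    if "i \<in> I" "k \<in> arrs B Z P" for i k
    using \<theta> p[OF that(1)] that by (auto simp: cells_iff arrs_iff intro!: iso_cell_rwhisker)
  \<comment> \<open>\<open>\<tau> i\<close> is \<open>\<sigma> i\<close> conjugated by whiskerings
    of \<open>\<theta> i\<close>.\<close>
  have "\<forall>i\<in>I. \<exists>\<tau>. \<tau> \<in> cells B (p i \<odot> h) (p i \<odot> h') \<and> (\<theta> i \<lhd> h') \<cdot> \<tau> = \<sigma> i \<cdot> (\<theta> i \<lhd> h)"
  proof
    fix i assume i: "i \<in> I"
    have "\<sigma> i \<cdot> (\<theta> i \<lhd> h) \<in> cells B (p i \<odot> h) (p' i \<odot> h')"
      using vcomp_cells \<theta>h(1)[OF i h(1)] \<sigma> i by blast
    then show "\<exists>\<tau>. \<tau> \<in> cells B (p i \<odot> h) (p i \<odot> h') \<and> (\<theta> i \<lhd> h') \<cdot> \<tau> = \<sigma> i \<cdot> (\<theta> i \<lhd> h)"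
      unfolding bij_betw_imp_surj_on[OF vcomp_iso_cell_left_bij[OF \<theta>h[OF i h(2)]], symmetric]
      by auto
  qed
  from bchoice[OF this] obtain \<tau> where \<tau>: "\<forall>i\<in>I. \<tau> i \<in> cells B (p i \<odot> h) (p i \<odot> h') \<and>
      (\<theta> i \<lhd> h') \<cdot> \<tau> i = \<sigma> i \<cdot> (\<theta> i \<lhd> h)" by blast
  have "p i \<rhd> \<phi> = \<tau> i \<longleftrightarrow> p' i \<rhd> \<phi> = \<sigma> i" if i: "i \<in> I" and \<phi>: "\<phi> \<in> cells B h h'" for i \<phi>
  proof -
    have c: "\<phi> \<in> Cell B" "cdom B \<phi> = h" "ccod B \<phi> = h'" "trg B h = P" "src B (p' i) = P"
      "p' i \<in> Arr B" "\<theta> i \<in> Cell B" "cdom B (\<theta> i) = p i" "ccod B (\<theta> i) = p' i"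
      using \<phi> h \<theta> p i cell_simps(2,3)[of "\<theta> i"] by (auto simp: cells_iff arrs_iff)
    have nat: "(\<theta> i \<lhd> h') \<cdot> (p i \<rhd> \<phi>) = (p' i \<rhd> \<phi>) \<cdot> (\<theta> i \<lhd> h)"
      by (rule slide) (use c p[OF i] in auto)
    have pc: "p i \<rhd> \<phi> \<in> cells B (p i \<odot> h) (p i \<odot> h')" "p' i \<rhd> \<phi> \<in> cells B (p' i \<odot> h) (p' i \<odot> h')"
      using lwhisker_cells[OF \<phi>] c p[OF i] by auto
    have "p i \<rhd> \<phi> = \<tau> i \<longleftrightarrow> (\<theta> i \<lhd> h') \<cdot> (p i \<rhd> \<phi>) = (\<theta> i \<lhd> h') \<cdot> \<tau> i"
      using inj_on_eq_iff[OF bij_betw_imp_inj_on[OF vcomp_iso_cell_left_bij[OF \<theta>h[OF i h(2)]]] pc(1), of "\<tau> i"] \<tau> i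
      by blast
    also have "\<dots> \<longleftrightarrow> (p' i \<rhd> \<phi>) \<cdot> (\<theta> i \<lhd> h) = \<sigma> i \<cdot> (\<theta> i \<lhd> h)" using \<tau> i nat by simp
    also have "\<dots> \<longleftrightarrow> p' i \<rhd> \<phi> = \<sigma> i"
      using inj_on_eq_iff[OF bij_betw_imp_inj_on[OF vcomp_iso_cell_right_bij[OF \<theta>h[OF i h(1)]]] pc(2), of "\<sigma> i"] \<sigma> i
      by blast
    finally show ?thesis .
  qed
  moreover have "\<exists>!\<phi>. \<phi> \<in> cells B h h' \<and> (\<forall>i\<in>I. p i \<rhd> \<phi> = \<tau> i)"
    using jointly_fully_faithfulD[OF ff h, of \<tau>] \<tau> by blast
  ultimately show "\<exists>!\<phi>. \<phi> \<in> cells B h h' \<and> (\<forall>i\<in>I. p' i \<rhd> \<phi> = \<sigma> i)"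
    by (simp cong: conj_cong)
qed

text \<open>Whiskering by a composite and whiskering twice differ by conjugation with associators.
  The cell \<open>\<tau>\<close> does not depend on \<open>\<phi>\<close>, so a whole lifting
  problem for \<open>g \<odot> f\<close> becomes one for successive whiskering.\<close>

lemma lwhisker_comp:
  assumes "f \<in> arrs B P Q" "g \<in> Arr B" "src B g = Q" "h \<in> arrs B Z P" "h' \<in> arrs B Z P"
    "\<sigma> \<in> cells B ((g \<odot> f) \<odot> h) ((g \<odot> f) \<odot> h')"
  obtains \<tau> where "\<tau> \<in> cells B (g \<odot> f \<odot> h) (g \<odot> f \<odot> h')"
    "\<And>\<phi>. \<phi> \<in> cells B h h' \<Longrightarrow> (g \<odot> f) \<rhd> \<phi> = \<sigma> \<longleftrightarrow> g \<rhd> (f \<rhd> \<phi>) = \<tau>"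
proof -
  let ?a = "assoc B g f h" and ?a' = "assoc B g f h'"
  have s: "f \<in> Arr B" "src B f = P" "trg B f = Q" "h \<in> Arr B" "src B h = Z" "trg B h = P"
    "h' \<in> Arr B" "src B h' = Z" "trg B h' = P" using assms by (auto simp: arrs_iff)
  have a: "?a \<in> cells B ((g \<odot> f) \<odot> h) (g \<odot> f \<odot> h)" "iso_cell B ?a"
    "?a' \<in> cells B ((g \<odot> f) \<odot> h') (g \<odot> f \<odot> h')" "iso_cell B ?a'"
    using s assms by (auto simp: cells_iff iso_cell_assoc)
  note L = vcomp_iso_cell_left_bij[OF a(3,4), of "(g \<odot> f) \<odot> h"]
  note R = vcomp_iso_cell_right_bij[OF a(1,2), of "g \<odot> f \<odot> h'"]
  have "?a' \<cdot> \<sigma> \<in> cells B ((g \<odot> f) \<odot> h) (g \<odot> f \<odot> h')" using vcomp_cells assms a by blast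
  then obtain \<tau> where \<tau>: "\<tau> \<in> cells B (g \<odot> f \<odot> h) (g \<odot> f \<odot> h')" "?a' \<cdot> \<sigma> = \<tau> \<cdot> ?a"
    unfolding bij_betw_imp_surj_on[OF R, symmetric] by auto
  show thesis
  proof (rule that[OF \<tau>(1)])
    fix \<phi> assume \<phi>: "\<phi> \<in> cells B h h'"
    then have c: "\<phi> \<in> Cell B" "cdom B \<phi> = h" "ccod B \<phi> = h'" by (auto simp: cells_iff)
    have nat: "?a' \<cdot> ((g \<odot> f) \<rhd> \<phi>) = (g \<rhd> (f \<rhd> \<phi>)) \<cdot> ?a"
      by (rule nat_l) (use c s assms in auto)
    have wc: "(g \<odot> f) \<rhd> \<phi> \<in> cells B ((g \<odot> f) \<odot> h) ((g \<odot> f) \<odot> h')"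
      "g \<rhd> (f \<rhd> \<phi>) \<in> cells B (g \<odot> f \<odot> h) (g \<odot> f \<odot> h')"
      using c s assms by (auto simp: cells_iff)
    have "(g \<odot> f) \<rhd> \<phi> = \<sigma> \<longleftrightarrow> ?a' \<cdot> ((g \<odot> f) \<rhd> \<phi>) = ?a' \<cdot> \<sigma>"
      using inj_onD[OF bij_betw_imp_inj_on[OF L]] wc assms(6) by blast
    also have "\<dots> \<longleftrightarrow> (g \<rhd> (f \<rhd> \<phi>)) \<cdot> ?a = \<tau> \<cdot> ?a" using nat \<tau> by simp
    also have "\<dots> \<longleftrightarrow> g \<rhd> (f \<rhd> \<phi>) = \<tau>"
      using inj_onD[OF bij_betw_imp_inj_on[OF R]] wc \<tau> by blast
    finally show "(g \<odot> f) \<rhd> \<phi> = \<sigma> \<longleftrightarrow> g \<rhd> (f \<rhd> \<phi>) = \<tau>" .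
  qed
qed

section \<open>Equivalences inside a bicategory and transport of cones along them\<close>

definition equivalence_pair :: "'o \<Rightarrow> 'o \<Rightarrow> 'a \<Rightarrow> 'a \<Rightarrow> bool" where
  "equivalence_pair P Q e e' \<longleftrightarrow> e \<in> arrs B P Q \<and> e' \<in> arrs B Q P \<and>
     isomorphic (e \<odot> e') (id1 B Q) \<and> isomorphic (e' \<odot> e) (id1 B P)"

text \<open>The identity is trivially fully faithful on 2-cells. Regarding it and \<open>k\<close>
  as families over the one-element set \<open>{()}\<close> lets
  \<open>jointly_fully_faithful_isomorphic\<close> transfer this to \<open>k\<close>.\<close>

lemma isomorphic_id_fully_faithful:
  assumes "P \<in> Obj B" "isomorphic k (id1 B P)" "h \<in> arrs B Z P" "h' \<in> arrs B Z P"
    "\<sigma> \<in> cells B (k \<odot> h) (k \<odot> h')"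
  shows "\<exists>!\<phi>. \<phi> \<in> cells B h h' \<and> k \<rhd> \<phi> = \<sigma>"
proof -
  have "jointly_fully_faithful B {()} P (\<lambda>_. id1 B P)"
    unfolding jointly_fully_faithful_def
  proof (intro allI impI; elim conjE)
    fix Z h h' and \<sigma> :: "unit \<Rightarrow> _"
    assume h: "h \<in> arrs B Z P" "h' \<in> arrs B Z P"
      and \<sigma>: "\<forall>i\<in>{()}. \<sigma> i \<in> cells B (id1 B P \<odot> h) (id1 B P \<odot> h')"
    then show "\<exists>!\<phi>. \<phi> \<in> cells B h h' \<and> (\<forall>i\<in>{()}. id1 B P \<rhd> \<phi> = \<sigma> i)"
      by (intro ex1I[of _ "\<sigma> ()"]) (auto simp: arrs_iff cells_iff)
  qed
  then have "jointly_fully_faithful B {()} P (\<lambda>_. k)"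
    by (rule jointly_fully_faithful_isomorphic) (use assms isomorphic_sym in auto)
  from jointly_fully_faithfulD[OF this assms(3,4), of "\<lambda>_. \<sigma>"] show ?thesis using assms(5) by simp
qed

text \<open>Whiskering with \<open>e\<close> is faithful because whiskering with
  \<open>e' e\<close>, isomorphic to an identity, is. For fullness,
  \<open>e' \<rhd> \<sigma>\<close> is lifted along \<open>e' e\<close>; by symmetry
  \<open>e'\<close> is faithful too, so the lift has image \<open>\<sigma>\<close> under
  \<open>e\<close>.\<close>

lemma equivalence_fully_faithful:
  assumes e: "equivalence_pair P Q e e'" and h: "h \<in> arrs B Z P" "h' \<in> arrs B Z P"
    and \<sigma>: "\<sigma> \<in> cells B (e \<odot> h) (e \<odot> h')"
  shows "\<exists>!\<phi>. \<phi> \<in> cells B h h' \<and> e \<rhd> \<phi> = \<sigma>"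
proof -
  have faithful: "\<phi> = \<psi>"
    if e: "equivalence_pair P Q e e'" and h: "h \<in> arrs B Z P" "h' \<in> arrs B Z P"
      and \<phi>: "\<phi> \<in> cells B h h'" "\<psi> \<in> cells B h h'" "e \<rhd> \<phi> = e \<rhd> \<psi>" for P Q e e' h h' \<phi> \<psi>
  proof -
    have e1: "e \<in> arrs B P Q" "e' \<in> Arr B" "src B e' = Q" "P \<in> Obj B" "isomorphic (e' \<odot> e) (id1 B P)"
      using e unfolding equivalence_pair_def by (auto simp: arrs_iff)
    have c: "(e' \<odot> e) \<rhd> \<phi> \<in> cells B ((e' \<odot> e) \<odot> h) ((e' \<odot> e) \<odot> h')"
      using \<phi> h e1 by (auto simp: cells_iff arrs_iff)
    from lwhisker_comp[OF e1(1-3) h this] obtain \<tau> where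
      \<tau>: "\<And>\<chi>. \<chi> \<in> cells B h h' \<Longrightarrow> (e' \<odot> e) \<rhd> \<chi> = (e' \<odot> e) \<rhd> \<phi> \<longleftrightarrow> e' \<rhd> (e \<rhd> \<chi>) = \<tau>" by metis
    then have "(e' \<odot> e) \<rhd> \<psi> = (e' \<odot> e) \<rhd> \<phi>" using \<phi> by metis
    then show ?thesis using isomorphic_id_fully_faithful[OF e1(4,5) h c] \<phi> by blast
  qed
  have e': "equivalence_pair Q P e' e" using e unfolding equivalence_pair_def by blast
  have e1: "e \<in> arrs B P Q" "e' \<in> Arr B" "src B e' = Q" "P \<in> Obj B" "isomorphic (e' \<odot> e) (id1 B P)"
    using e unfolding equivalence_pair_def by (auto simp: arrs_iff)
  have eh: "e \<odot> h \<in> arrs B Z Q" "e \<odot> h' \<in> arrs B Z Q" using comp1_arr h e1 by auto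
  have \<tau>: "e' \<rhd> \<sigma> \<in> cells B (e' \<odot> e \<odot> h) (e' \<odot> e \<odot> h')"
    using lwhisker_cells[OF \<sigma>] e1 eh by (auto simp: arrs_iff)
  \<comment> \<open>Here \<open>\<rho>\<close> is \<open>e' \<rhd> \<sigma>\<close> rebracketed into
    a cell between composites with \<open>e' \<odot> e\<close>, which is where full faithfulness is
    known.\<close>
  have "\<exists>\<phi>\<in>cells B h h'. e' \<rhd> (e \<rhd> \<phi>) = e' \<rhd> \<sigma>"
  proof -
    let ?a = "assoc B e' e h" and ?a' = "assoc B e' e h'"
    have a: "?a \<in> cells B ((e' \<odot> e) \<odot> h) (e' \<odot> e \<odot> h)" "iso_cell B ?a"
      "?a' \<in> cells B ((e' \<odot> e) \<odot> h') (e' \<odot> e \<odot> h')" "iso_cell B ?a'"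
      using h e1 by (auto simp: cells_iff arrs_iff iso_cell_assoc)
    have "(e' \<rhd> \<sigma>) \<cdot> ?a \<in> cells B ((e' \<odot> e) \<odot> h) (e' \<odot> e \<odot> h')" using vcomp_cells \<tau> a by blast
    then obtain \<rho> where \<rho>: "\<rho> \<in> cells B ((e' \<odot> e) \<odot> h) ((e' \<odot> e) \<odot> h')" "(e' \<rhd> \<sigma>) \<cdot> ?a = ?a' \<cdot> \<rho>"
      unfolding bij_betw_imp_surj_on[OF vcomp_iso_cell_left_bij[OF a(3,4)], symmetric] by auto
    obtain \<phi> where \<phi>: "\<phi> \<in> cells B h h'" "(e' \<odot> e) \<rhd> \<phi> = \<rho>"
      using isomorphic_id_fully_faithful[OF e1(4,5) h \<rho>(1)] by blast
    have "?a' \<cdot> ((e' \<odot> e) \<rhd> \<phi>) = (e' \<rhd> (e \<rhd> \<phi>)) \<cdot> ?a"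
      by (rule nat_l) (use \<phi> h e1 in \<open>auto simp: cells_iff arrs_iff\<close>)
    then have "(e' \<rhd> (e \<rhd> \<phi>)) \<cdot> ?a = (e' \<rhd> \<sigma>) \<cdot> ?a" using \<phi> \<rho> by simp
    moreover have "e' \<rhd> (e \<rhd> \<phi>) \<in> cells B (e' \<odot> e \<odot> h) (e' \<odot> e \<odot> h')"
      using \<phi> h e1 by (auto simp: cells_iff arrs_iff)
    ultimately show ?thesis
      using inj_onD[OF bij_betw_imp_inj_on[OF vcomp_iso_cell_right_bij[OF a(1,2)]]] \<tau> \<phi> by blast
  qed
  then obtain \<phi> where \<phi>: "\<phi> \<in> cells B h h'" "e' \<rhd> (e \<rhd> \<phi>) = e' \<rhd> \<sigma>" by blast
  have "e \<rhd> \<phi> \<in> cells B (e \<odot> h) (e \<odot> h')"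
    using lwhisker_cells[OF \<phi>(1)] e1 h by (auto simp: arrs_iff)
  then have "e \<rhd> \<phi> = \<sigma>" using faithful[OF e' eh _ \<sigma> \<phi>(2)] by blast
  then show ?thesis using \<phi> faithful[OF e h] by blast
qed

text \<open>The inverses of the given cells form a family of their own and lift as well; uniqueness
  of lifts of identities makes the two lifts mutually inverse.\<close>

lemma jointly_fully_faithful_reflects_isomorphic:
  assumes ff: "jointly_fully_faithful B I P p" and p: "\<And>i. i \<in> I \<Longrightarrow> p i \<in> Arr B \<and> src B (p i) = P"
    and h: "h \<in> arrs B Z P" "h' \<in> arrs B Z P" and iso: "\<And>i. i \<in> I \<Longrightarrow> isomorphic (p i \<odot> h) (p i \<odot> h')"
  shows "isomorphic h h'"
proof -
  have "\<forall>i\<in>I. \<exists>\<sigma>. \<sigma> \<in> cells B (p i \<odot> h) (p i \<odot> h') \<and> iso_cell B \<sigma>"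
    using iso unfolding isomorphic_def by blast
  from bchoice[OF this] obtain \<sigma>
    where \<sigma>: "\<forall>i\<in>I. \<sigma> i \<in> cells B (p i \<odot> h) (p i \<odot> h') \<and> iso_cell B (\<sigma> i)" by blast
  then have "\<forall>i\<in>I. \<exists>\<tau>. \<tau> \<in> cells B (p i \<odot> h') (p i \<odot> h) \<and>
      \<tau> \<cdot> \<sigma> i = id2 B (p i \<odot> h) \<and> \<sigma> i \<cdot> \<tau> = id2 B (p i \<odot> h')"
    by (meson iso_cellE)
  from bchoice[OF this] obtain \<tau> where \<tau>: "\<forall>i\<in>I. \<tau> i \<in> cells B (p i \<odot> h') (p i \<odot> h) \<and>
      \<tau> i \<cdot> \<sigma> i = id2 B (p i \<odot> h) \<and> \<sigma> i \<cdot> \<tau> i = id2 B (p i \<odot> h')" by blast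
  obtain \<phi> where \<phi>: "\<phi> \<in> cells B h h'" "\<forall>i\<in>I. p i \<rhd> \<phi> = \<sigma> i"
    using jointly_fully_faithfulD[OF ff h, of \<sigma>] \<sigma> by blast
  obtain \<psi> where \<psi>: "\<psi> \<in> cells B h' h" "\<forall>i\<in>I. p i \<rhd> \<psi> = \<tau> i"
    using jointly_fully_faithfulD[OF ff h(2,1), of \<tau>] \<tau> by blast
  have inverse: "\<psi> \<cdot> \<phi> = id2 B h"
    if h: "h \<in> arrs B Z P" "h' \<in> arrs B Z P" and \<phi>: "\<phi> \<in> cells B h h'" and \<psi>: "\<psi> \<in> cells B h' h"
      and eq: "\<And>i. i \<in> I \<Longrightarrow> (p i \<rhd> \<psi>) \<cdot> (p i \<rhd> \<phi>) = id2 B (p i \<odot> h)" for h h' \<phi> \<psi>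
  proof -
    have "p i \<rhd> (\<psi> \<cdot> \<phi>) = id2 B (p i \<odot> h) \<and> p i \<rhd> id2 B h = id2 B (p i \<odot> h) \<and>
        id2 B (p i \<odot> h) \<in> cells B (p i \<odot> h) (p i \<odot> h)" if "i \<in> I" for i
      using eq[OF that] p[OF that] \<phi> \<psi> h whisker_vcomp(1)[of \<phi> \<psi> "p i"]
      by (auto simp: cells_iff arrs_iff)
    moreover have "\<psi> \<cdot> \<phi> \<in> cells B h h" "id2 B h \<in> cells B h h"
      using vcomp_cells \<phi> \<psi> h by (auto simp: cells_iff arrs_iff)
    ultimately show ?thesis
      using jointly_fully_faithfulD[OF ff h(1) h(1), of "\<lambda>i. id2 B (p i \<odot> h)"] by blast
  qed
  have "iso_cell B \<phi>"
    by (rule iso_cellI[OF \<phi>(1) \<psi>(1)]; rule inverse; use h \<phi> \<psi> \<tau> in simp)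
  then show ?thesis unfolding isomorphic_def using \<phi>(1) by blast
qed

lemma jointly_essentially_surjective_iff:
  "jointly_essentially_surjective B I X P p \<longleftrightarrow>
     (\<forall>Z\<in>Obj B. \<forall>k. (\<forall>i\<in>I. k i \<in> arrs B Z (X i)) \<longrightarrow>
        (\<exists>h\<in>arrs B Z P. \<forall>i\<in>I. isomorphic (p i \<odot> h) (k i)))"
  unfolding jointly_essentially_surjective_def isomorphic_def ..

lemma product_cone_equivalence:
  assumes cone: "product_cone B I X Q q" and e: "equivalence_pair P Q e e'"
    and p: "\<And>i. i \<in> I \<Longrightarrow> isomorphic (q i \<odot> e) (p i)" "\<And>i. i \<in> I \<Longrightarrow> p i \<in> arrs B P (X i)"
  shows "product_cone B I X P p"
proof -
  have e1: "e \<in> arrs B P Q" "e' \<in> arrs B Q P" "isomorphic (e \<odot> e') (id1 B Q)"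
    "P \<in> Obj B" using e unfolding equivalence_pair_def by (auto simp: arrs_iff)
  have e2: "e \<in> Arr B" "src B e = P" "trg B e = Q" "e' \<in> Arr B" "src B e' = Q" "trg B e' = P"
    using e1 by (auto simp: arrs_iff)
  have X: "\<And>i. i \<in> I \<Longrightarrow> X i \<in> Obj B"
    and q: "\<And>i. i \<in> I \<Longrightarrow> q i \<in> Arr B \<and> src B (q i) = Q \<and> trg B (q i) = X i"
    and ff: "jointly_fully_faithful B I Q q" and es: "jointly_essentially_surjective B I X Q q"
    using cone unfolding product_cone_iff by (auto simp: arrs_iff)
  have "jointly_fully_faithful B I P (\<lambda>i. q i \<odot> e)"
    unfolding jointly_fully_faithful_def
  proof (intro allI impI; elim conjE)
    fix Z h h' \<sigma>
    assume h: "h \<in> arrs B Z P" "h' \<in> arrs B Z P"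
      and \<sigma>: "\<forall>i\<in>I. \<sigma> i \<in> cells B ((q i \<odot> e) \<odot> h) ((q i \<odot> e) \<odot> h')"
    \<comment> \<open>The family is rebracketed so that the cone at \<open>Q\<close> glues it to one
      cell \<open>\<psi>\<close>, and \<open>\<psi>\<close> is then lifted along \<open>e\<close>.
      Both steps have unique solutions.\<close>
    have "\<forall>i\<in>I. \<exists>\<tau>. \<tau> \<in> cells B (q i \<odot> e \<odot> h) (q i \<odot> e \<odot> h') \<and>
        (\<forall>\<phi>\<in>cells B h h'. (q i \<odot> e) \<rhd> \<phi> = \<sigma> i \<longleftrightarrow> q i \<rhd> (e \<rhd> \<phi>) = \<tau>)"
      using lwhisker_comp[OF e1(1) _ _ h] q \<sigma> by metis
    from bchoice[OF this] obtain \<tau> where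
      \<tau>: "\<And>i. i \<in> I \<Longrightarrow> \<tau> i \<in> cells B (q i \<odot> e \<odot> h) (q i \<odot> e \<odot> h')"
      "\<And>i \<phi>. i \<in> I \<Longrightarrow> \<phi> \<in> cells B h h' \<Longrightarrow> (q i \<odot> e) \<rhd> \<phi> = \<sigma> i \<longleftrightarrow> q i \<rhd> (e \<rhd> \<phi>) = \<tau> i"
      by blast
    have eh: "e \<odot> h \<in> arrs B Z Q" "e \<odot> h' \<in> arrs B Z Q" using comp1_arr h e1 by auto
    note ex = jointly_fully_faithfulD[OF ff eh \<tau>(1)]
    obtain \<psi> where \<psi>: "\<psi> \<in> cells B (e \<odot> h) (e \<odot> h')" "\<forall>i\<in>I. q i \<rhd> \<psi> = \<tau> i" using ex by blast
    have ex': "\<exists>!\<phi>. \<phi> \<in> cells B h h' \<and> e \<rhd> \<phi> = \<psi>" by (rule equivalence_fully_faithful[OF e h \<psi>(1)])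
    have "(\<forall>i\<in>I. (q i \<odot> e) \<rhd> \<phi> = \<sigma> i) \<longleftrightarrow> e \<rhd> \<phi> = \<psi>" if \<phi>: "\<phi> \<in> cells B h h'" for \<phi>
    proof -
      have "e \<rhd> \<phi> \<in> cells B (e \<odot> h) (e \<odot> h')" using lwhisker_cells[OF \<phi>] e2 h by (auto simp: arrs_iff)
      then have "(\<forall>i\<in>I. q i \<rhd> (e \<rhd> \<phi>) = \<tau> i) \<longleftrightarrow> e \<rhd> \<phi> = \<psi>" using ex \<psi> by blast
      then show ?thesis using \<tau>(2)[OF _ \<phi>] by simp
    qed
    then show "\<exists>!\<phi>. \<phi> \<in> cells B h h' \<and> (\<forall>i\<in>I. (q i \<odot> e) \<rhd> \<phi> = \<sigma> i)"
      using ex' by (simp cong: conj_cong)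
  qed
  then have "jointly_fully_faithful B I P p"
    by (rule jointly_fully_faithful_isomorphic) (use q e2 p in auto)
  moreover have "jointly_essentially_surjective B I X P p"
    unfolding jointly_essentially_surjective_iff
  proof (intro ballI allI impI)
    fix Z k assume Z: "Z \<in> Obj B" and k: "\<forall>i\<in>I. k i \<in> arrs B Z (X i)"
    obtain h where h: "h \<in> arrs B Z Q" "\<forall>i\<in>I. isomorphic (q i \<odot> h) (k i)"
      using es Z k unfolding jointly_essentially_surjective_iff by blast
    have h1: "h \<in> Arr B" "src B h = Z" "trg B h = Q" using h by (auto simp: arrs_iff)
    \<comment> \<open>An arrow into \<open>Q\<close> is turned into one into \<open>P\<close> by
      composing with \<open>e'\<close>; the isomorphism from \<open>e \<odot> e'\<close> to the
      identity absorbs the detour.\<close>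
    show "\<exists>h\<in>arrs B Z P. \<forall>i\<in>I. isomorphic (p i \<odot> h) (k i)"
    proof (intro bexI ballI)
      show "e' \<odot> h \<in> arrs B Z P" using comp1_arr h e1 by blast
      fix i assume i: "i \<in> I"
      have pi: "p i \<in> Arr B" "src B (p i) = P" using p(2)[OF i] by (auto simp: arrs_iff)
      have "isomorphic (p i \<odot> e' \<odot> h) ((q i \<odot> e) \<odot> e' \<odot> h)"
        by (rule isomorphic_rwhisker[OF isomorphic_sym[OF p(1)[OF i]]]) (use pi e2 h1 in auto)
      also have "isomorphic \<dots> (q i \<odot> e \<odot> e' \<odot> h)"
        by (rule isomorphic_assoc) (use q[OF i] e2 h1 in auto)
      also have "isomorphic \<dots> (q i \<odot> (e \<odot> e') \<odot> h)"
        by (rule isomorphic_lwhisker[OF isomorphic_sym[OF isomorphic_assoc]]) (use q[OF i] e2 h1 in auto)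
      also have "isomorphic \<dots> (q i \<odot> id1 B Q \<odot> h)"
        by (rule isomorphic_lwhisker[OF isomorphic_rwhisker[OF e1(3)]]) (use q[OF i] e2 h1 in auto)
      also have "isomorphic \<dots> (k i)" using h(2) h1 i by simp
      finally show "isomorphic (p i \<odot> e' \<odot> h) (k i)" .
    qed
  qed
  ultimately show ?thesis unfolding product_cone_iff using e1 X p by blast
qed

text \<open>Each cone factors through the other up to isomorphism. Both composites are compared with
  identities by joint reflection of isomorphisms; \<open>inverse\<close> is stated for arbitrary
  cones so that it covers the two composites by symmetry.\<close>

lemma product_cone_unique:
  assumes "product_cone B I X P p" "product_cone B I X Q q"
  obtains e e' where "equivalence_pair P Q e e'" "\<forall>i\<in>I. isomorphic (q i \<odot> e) (p i)"
proof -
  have ex: "\<exists>e\<in>arrs B P Q. \<forall>i\<in>I. isomorphic (q i \<odot> e) (p i)"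
    if "product_cone B I X P p" "product_cone B I X Q q" for P p Q q
    using that unfolding product_cone_iff jointly_essentially_surjective_iff by blast
  obtain e where e: "e \<in> arrs B P Q" "\<forall>i\<in>I. isomorphic (q i \<odot> e) (p i)" using ex[OF assms] by blast
  obtain e' where e': "e' \<in> arrs B Q P" "\<forall>i\<in>I. isomorphic (p i \<odot> e') (q i)"
    using ex[OF assms(2,1)] by blast
  have inverse: "isomorphic (e \<odot> e') (id1 B Q)"
    if P: "product_cone B I X P p" and Q: "product_cone B I X Q q"
      and e: "e \<in> arrs B P Q" "\<forall>i\<in>I. isomorphic (q i \<odot> e) (p i)"
      and e': "e' \<in> arrs B Q P" "\<forall>i\<in>I. isomorphic (p i \<odot> e') (q i)" for P p Q q e e'
  proof (rule jointly_fully_faithful_reflects_isomorphic)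
    show "jointly_fully_faithful B I Q q" using Q unfolding product_cone_iff by blast
    have s: "e \<in> Arr B" "src B e = P" "trg B e = Q" "e' \<in> Arr B" "src B e' = Q" "trg B e' = P" "Q \<in> Obj B"
      using e e' by (auto simp: arrs_iff)
    show "e \<odot> e' \<in> arrs B Q Q" "id1 B Q \<in> arrs B Q Q" using s by (auto simp: arrs_iff)
    fix i assume i: "i \<in> I"
    have qi: "q i \<in> Arr B" "src B (q i) = Q" using Q i unfolding product_cone_iff by (auto simp: arrs_iff)
    then show "q i \<in> Arr B \<and> src B (q i) = Q" by blast
    have "isomorphic (q i \<odot> e \<odot> e') ((q i \<odot> e) \<odot> e')"
      by (rule isomorphic_sym[OF isomorphic_assoc]) (use qi s in auto)
    also have "isomorphic \<dots> (p i \<odot> e')"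
      by (rule isomorphic_rwhisker) (use e i qi s in auto)
    also have "isomorphic \<dots> (q i)" using e' i by blast
    finally show "isomorphic (q i \<odot> e \<odot> e') (q i \<odot> id1 B Q)" using qi by simp
  qed
  show thesis
    using that[of e e'] inverse[OF assms e e'] inverse[OF assms(2,1) e' e] e e'
    unfolding equivalence_pair_def by blast
qed

end

section \<open>Pseudofunctors on isomorphic arrows, equivalences and cones\<close>

context pseudofunctor
begin

lemma on_arr_arrs: "f \<in> arrs B X Y \<Longrightarrow> on_arr F f \<in> arrs C (on_obj F X) (on_obj F Y)"
  using on_hom[of X Y] B.arr_obj unfolding is_functor_def by (auto simp: arrs_iff)

lemma on_arr_isomorphic:
  assumes "f \<in> arrs B X Y" "B.isomorphic f g"
  shows "C.isomorphic (on_arr F f) (on_arr F g)"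
proof -
  obtain \<phi> where \<phi>: "\<phi> \<in> cells B f g" "iso_cell B \<phi>" using assms unfolding B.isomorphic_def by blast
  obtain \<psi> where \<psi>: "\<psi> \<in> cells B g f" "\<psi> \<cdot> \<phi> = id2 B f" "\<phi> \<cdot> \<psi> = id2 B g"
    using B.iso_cellE[OF \<phi>] .
  have g: "g \<in> arrs B X Y" using \<phi>(1) assms(1) B.cell_simps(2-4)[of \<phi>] by (auto simp: cells_iff arrs_iff)
  have XY: "X \<in> Obj B" "Y \<in> Obj B" using assms by (auto simp: arrs_iff)
  interpret cat_functor "hom_cat B X Y" "hom_cat C (on_obj F X) (on_obj F Y)" "on_arr F" "on_cell F"
    using on_hom[OF XY] B.hom_category[OF XY] C.hom_category[OF on_obj on_obj, OF XY] by unfold_locales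
  have h: "\<phi> \<in> homset (hom_cat B X Y) f g" "\<psi> \<in> homset (hom_cat B X Y) g f"
    using \<phi> \<psi> g assms(1) by (auto simp: B.homset_hom_cat)
  have "on_cell F \<psi> \<cdot>\<^bsub>C\<^esub> on_cell F \<phi> = id2 C (on_arr F f)" "on_cell F \<phi> \<cdot>\<^bsub>C\<^esub> on_cell F \<psi> = id2 C (on_arr F g)"
    using functor_mcomp[OF h] functor_mcomp[OF h(2,1)] functor_ident[of f] functor_ident[of g] \<psi> g assms(1)
    by auto
  moreover have "on_cell F \<phi> \<in> cells C (on_arr F f) (on_arr F g)" "on_cell F \<psi> \<in> cells C (on_arr F g) (on_arr F f)"
    using functor_mor[OF h(1)] functor_mor[OF h(2)] by (auto simp: C.homset_hom_cat)
  ultimately show ?thesis unfolding C.isomorphic_def using C.iso_cellI by blast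
qed

lemma on_arr_comp_isomorphic:
  "f \<in> arrs B X Y \<Longrightarrow> g \<in> arrs B Y Z \<Longrightarrow> C.isomorphic (on_arr F g \<odot>\<^bsub>C\<^esub> on_arr F f) (on_arr F (g \<odot> f))"
  unfolding C.isomorphic_def using pf_comp_cell by blast

lemma on_arr_id_isomorphic: "X \<in> Obj B \<Longrightarrow> C.isomorphic (on_arr F (id1 B X)) (id1 C (on_obj F X))"
  by (rule C.isomorphic_sym) (use pf_unit_cell in \<open>auto simp: C.isomorphic_def\<close>)

lemma on_arr_equivalence:
  assumes "B.equivalence_pair P Q e e'"
  shows "C.equivalence_pair (on_obj F P) (on_obj F Q) (on_arr F e) (on_arr F e')"
proof -
  have inverse: "C.isomorphic (on_arr F e \<odot>\<^bsub>C\<^esub> on_arr F e') (id1 C (on_obj F Q))"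
    if "e \<in> arrs B P Q" "e' \<in> arrs B Q P" "B.isomorphic (e \<odot> e') (id1 B Q)" for P Q e e'
  proof -
    have "C.isomorphic (on_arr F e \<odot>\<^bsub>C\<^esub> on_arr F e') (on_arr F (e \<odot> e'))"
      using on_arr_comp_isomorphic that by blast
    also have "C.isomorphic \<dots> (on_arr F (id1 B Q))"
      using on_arr_isomorphic[OF B.comp1_arr] that by blast
    also have "C.isomorphic \<dots> (id1 C (on_obj F Q))"
      by (rule on_arr_id_isomorphic) (use that in \<open>auto simp: arrs_iff\<close>)
    finally show ?thesis .
  qed
  show ?thesis
    using assms inverse on_arr_arrs unfolding B.equivalence_pair_def C.equivalence_pair_def by blast
qed

text \<open>The comparison equivalence between the two cones survives \<open>F\<close>, and
  \<open>pf_comp\<close> supplies the isomorphisms over which its image commutes with the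
  projections, so the image of one cone is transported to the image of the other.\<close>

lemma preserves_product_cone_if_one:
  assumes P: "product_cone B I X P p" and Q: "product_cone B I X Q q"
    and FQ: "product_cone C I (\<lambda>i. on_obj F (X i)) (on_obj F Q) (\<lambda>i. on_arr F (q i))"
  shows "product_cone C I (\<lambda>i. on_obj F (X i)) (on_obj F P) (\<lambda>i. on_arr F (p i))"
proof -
  obtain e e' where "B.equivalence_pair P Q e e'" "\<forall>i\<in>I. B.isomorphic (q i \<odot> e) (p i)"
    using B.product_cone_unique[OF P Q] .
  then have e: "B.equivalence_pair P Q e e'" "\<And>i. i \<in> I \<Longrightarrow> B.isomorphic (q i \<odot> e) (p i)"
    by auto
  have e1: "e \<in> arrs B P Q" using e unfolding B.equivalence_pair_def by blast
  show ?thesis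
  proof (rule C.product_cone_equivalence[OF FQ on_arr_equivalence[OF e(1)]])
    fix i assume i: "i \<in> I"
    have "q i \<in> arrs B Q (X i)" using Q i unfolding product_cone_def by blast
    then have "C.isomorphic (on_arr F (q i) \<odot>\<^bsub>C\<^esub> on_arr F e) (on_arr F (q i \<odot> e))"
      "C.isomorphic (on_arr F (q i \<odot> e)) (on_arr F (p i))"
      using on_arr_comp_isomorphic[OF e1] on_arr_isomorphic[OF B.comp1_arr[OF e1] e(2)[OF i]] by blast+
    then show "C.isomorphic (on_arr F (q i) \<odot>\<^bsub>C\<^esub> on_arr F e) (on_arr F (p i))"
      by (rule C.isomorphic_trans)
    show "on_arr F (p i) \<in> arrs C (on_obj F P) (on_obj F (X i))"
      using P i on_arr_arrs unfolding product_cone_def by blast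
  qed
qed

end

section \<open>The product cone in \<open>G\<close>\<close>

context normal_bicategory
begin

lemma Map_arrs: "f \<in> arrs (Map_bicat B) X Y \<longleftrightarrow> f \<in> arrs B X Y \<and> is_map B f"
  by (auto simp: arrs_iff)

lemma Map_cells: "\<phi> \<in> cells (Map_bicat B) f g \<longleftrightarrow> \<phi> \<in> cells B f g \<and> is_map B f \<and> is_map B g"
  by (auto simp: cells_iff)

lemma iso_cell_Map: "iso_cell (Map_bicat B) \<phi> \<Longrightarrow> iso_cell B \<phi>"
  unfolding iso_cell_def by (auto simp: Map_cells)

text \<open>\<open>Map_bicat B\<close> is locally full, so 2-cells between maps are exactly those of
  \<open>B\<close>. The universal property can thus be stated in \<open>B\<close>, with the map
  conditions placed on arrows alone.\<close>

lemma Map_product_coneD: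
  assumes cone: "product_cone (Map_bicat B) I X P p"
  shows "P \<in> Obj B" "\<And>i. i \<in> I \<Longrightarrow> p i \<in> arrs B P (X i) \<and> is_map B (p i)"
    "\<And>Z f f' \<sigma>. \<lbrakk>f \<in> arrs B Z P; is_map B f; f' \<in> arrs B Z P; is_map B f';
        \<And>i. i \<in> I \<Longrightarrow> \<sigma> i \<in> cells B (p i \<odot> f) (p i \<odot> f')\<rbrakk> \<Longrightarrow>
      \<exists>!\<phi>. \<phi> \<in> cells B f f' \<and> (\<forall>i\<in>I. p i \<rhd> \<phi> = \<sigma> i)"
    "\<And>Z k. \<lbrakk>Z \<in> Obj B; \<And>i. i \<in> I \<Longrightarrow> k i \<in> arrs B Z (X i) \<and> is_map B (k i)\<rbrakk> \<Longrightarrow>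
      \<exists>f\<in>arrs B Z P. is_map B f \<and> (\<forall>i\<in>I. \<exists>\<sigma>\<in>cells B (p i \<odot> f) (k i). iso_cell B \<sigma>)"
proof -
  interpret M: normal_bicategory "Map_bicat B" by (rule normal_bicategory_Map)
  have c: "P \<in> Obj B" "\<forall>i\<in>I. p i \<in> arrs B P (X i) \<and> is_map B (p i)"
    "jointly_fully_faithful (Map_bicat B) I P p" "jointly_essentially_surjective (Map_bicat B) I X P p"
    using cone unfolding M.product_cone_iff by (auto simp: Map_arrs)
  show "P \<in> Obj B" "\<And>i. i \<in> I \<Longrightarrow> p i \<in> arrs B P (X i) \<and> is_map B (p i)" using c by auto
  show "\<exists>!\<phi>. \<phi> \<in> cells B f f' \<and> (\<forall>i\<in>I. p i \<rhd> \<phi> = \<sigma> i)"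
    if f: "f \<in> arrs B Z P" "is_map B f" "f' \<in> arrs B Z P" "is_map B f'"
      and \<sigma>: "\<And>i. i \<in> I \<Longrightarrow> \<sigma> i \<in> cells B (p i \<odot> f) (p i \<odot> f')" for Z f f' \<sigma>
  proof -
    have "\<sigma> i \<in> cells (Map_bicat B) (p i \<odot> f) (p i \<odot> f')" if "i \<in> I" for i
      using \<sigma>[OF that] c(2) f that by (auto simp: Map_cells arrs_iff is_map_comp)
    then show ?thesis
      using jointly_fully_faithfulD[OF c(3), of f Z f' \<sigma>] f by (simp add: Map_arrs Map_cells)
  qed
  show "\<exists>f\<in>arrs B Z P. is_map B f \<and> (\<forall>i\<in>I. \<exists>\<sigma>\<in>cells B (p i \<odot> f) (k i). iso_cell B \<sigma>)"
    if Z: "Z \<in> Obj B" and k: "\<And>i. i \<in> I \<Longrightarrow> k i \<in> arrs B Z (X i) \<and> is_map B (k i)" for Z k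
  proof -
    have "\<exists>f\<in>arrs (Map_bicat B) Z P. \<forall>i\<in>I. \<exists>\<sigma>\<in>cells (Map_bicat B) (p i \<odot> f) (k i). iso_cell (Map_bicat B) \<sigma>"
      using c(4) Z k unfolding jointly_essentially_surjective_def by (simp add: Map_arrs)
    then show ?thesis using iso_cell_Map unfolding Bex_def Map_arrs Map_cells by blast
  qed
qed

text \<open>The pair of inverses is again a 2-cell of \<open>G\<close>, because the compatibility
  equation can be conjugated by the invertible whiskerings (\<open>conj_eq\<close>).\<close>

lemma G_iso_cellI:
  assumes s: "(a, (\<phi>, \<psi>), b) \<in> cells (G_bicat B) a b" and a: "a \<in> arrs (G_bicat B) x y"
    and iso: "iso_cell B \<phi>" "iso_cell B \<psi>"
  shows "iso_cell (G_bicat B) (a, (\<phi>, \<psi>), b)"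
proof -
  interpret G: normal_bicategory "G_bicat B" by (rule normal_bicategory_G)
  obtain X R A Y S C where xy: "x = (X, R, A)" "y = (Y, S, C)" by (metis prod_cases3)
  obtain f \<alpha> u f' \<alpha>' u' where ab: "a = ((X, R, A), (f, \<alpha>, u), (Y, S, C))" "b = ((X, R, A), (f', \<alpha>', u'), (Y, S, C))"
    and ob: "X = src B R" "A = trg B R" "Y = src B S" "C = trg B S"
    and maps: "is_map B f" "is_map B u" "is_map B f'" "is_map B u'"
    and sq: "sq R S f \<alpha> u" "sq R S f' \<alpha>' u'"
    and c: "\<phi> \<in> cells B f f'" "\<psi> \<in> cells B u u'" "(S \<rhd> \<phi>) \<cdot> \<alpha> = \<alpha>' \<cdot> (\<psi> \<lhd> R)"
    by (rule G_cellE[OF s a[unfolded xy]]) auto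
  obtain \<phi>' where \<phi>': "\<phi>' \<in> cells B f' f" "\<phi>' \<cdot> \<phi> = id2 B f" "\<phi> \<cdot> \<phi>' = id2 B f'"
    using iso_cellE[OF c(1) iso(1)] .
  obtain \<psi>' where \<psi>': "\<psi>' \<in> cells B u' u" "\<psi>' \<cdot> \<psi> = id2 B u" "\<psi> \<cdot> \<psi>' = id2 B u'"
    using iso_cellE[OF c(2) iso(2)] .
  have "\<alpha> \<cdot> (\<psi>' \<lhd> R) = (S \<rhd> \<phi>') \<cdot> \<alpha>'"
    by (rule conj_eq[OF c(3)])
      (use sqD[OF sq(1)] sqD[OF sq(2)] cellsD[OF c(1)] cellsD[OF c(2)] cellsD[OF \<phi>'(1)] cellsD[OF \<psi>'(1)]
         \<phi>'(2) \<psi>'(3) in \<open>simp_all add: whisker_vcomp[symmetric]\<close>)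
  then have inv: "(b, (\<phi>', \<psi>'), a) \<in> cells (G_bicat B) b a"
    unfolding G_cells_iff ab G_cell_iff using ob maps sq \<phi>' \<psi>' by simp
  show ?thesis
    by (rule G.iso_cellI[OF s inv]) (use \<phi>' \<psi>' in \<open>simp_all add: ab\<close>)
qed

lemma sq_lwhisker:
  assumes "sq T R f \<alpha> u" "\<phi> \<in> cells B f f'"
  shows "sq T R f' ((R \<rhd> \<phi>) \<cdot> \<alpha>) u"
  using sqD[OF assms(1)] cellsD[OF assms(2)] cell_simps(2-4)[of \<phi>] unfolding sq_def by auto

lemma sq_rwhisker:
  assumes "sq T R f \<alpha> u'" "\<psi> \<in> cells B u u'"
  shows "sq T R f (\<alpha> \<cdot> (\<psi> \<lhd> T)) u"
  using sqD[OF assms(1)] cellsD[OF assms(2)] cell_simps(1,3,4)[of \<psi>] unfolding sq_def by auto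

text \<open>An instance of \<open>pasting_cell\<close> with identity 2-cells on \<open>p\<close>,
  \<open>q\<close> and \<open>u\<close>. Together with \<open>pasting_rwhisker\<close> it pushes
  either side of the compatibility equation of \<open>G\<close> through pasting with a
  projection.\<close>

lemma pasting_lwhisker:
  assumes \<alpha>: "sq T R f \<alpha> u" and \<omega>: "sq R S p \<omega> q" and \<phi>: "\<phi> \<in> cells B f f'"
  shows "pasting B T R S p \<omega> q f' ((R \<rhd> \<phi>) \<cdot> \<alpha>) u = (S \<rhd> (p \<rhd> \<phi>)) \<cdot> pasting B T R S p \<omega> q f \<alpha> u"
proof -
  note \<alpha>' = sq_lwhisker[OF \<alpha> \<phi>] and t = sqD[OF \<alpha>] sqD[OF \<omega>]
  have "(S \<rhd> (id2 B p \<star> \<phi>)) \<cdot> pasting B T R S p \<omega> q f \<alpha> u =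
      pasting B T R S p \<omega> q f' ((R \<rhd> \<phi>) \<cdot> \<alpha>) u \<cdot> ((id2 B q \<star> id2 B u) \<lhd> T)"
    by (rule pasting_cell[OF \<alpha> \<omega> \<alpha>' \<omega> \<phi>]) (use t sqD[OF \<alpha>'] in \<open>auto simp: cells_iff\<close>)
  then show ?thesis using t sqD[OF sq_pasting[OF \<alpha>' \<omega>]] by (simp add: lwhisker_def[of B p])
qed

lemma pasting_rwhisker:
  assumes \<alpha>: "sq T R f \<alpha> u'" and \<omega>: "sq R S p \<omega> q" and \<psi>: "\<psi> \<in> cells B u u'"
  shows "pasting B T R S p \<omega> q f (\<alpha> \<cdot> (\<psi> \<lhd> T)) u = pasting B T R S p \<omega> q f \<alpha> u' \<cdot> ((q \<rhd> \<psi>) \<lhd> T)"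
proof -
  note \<alpha>' = sq_rwhisker[OF \<alpha> \<psi>] and t = sqD[OF \<alpha>] sqD[OF \<omega>]
  have "(S \<rhd> (id2 B p \<star> id2 B f)) \<cdot> pasting B T R S p \<omega> q f (\<alpha> \<cdot> (\<psi> \<lhd> T)) u =
      pasting B T R S p \<omega> q f \<alpha> u' \<cdot> ((id2 B q \<star> \<psi>) \<lhd> T)"
    by (rule pasting_cell[OF \<alpha>' \<omega> \<alpha> \<omega> _ \<psi>]) (use t sqD[OF \<alpha>'] in \<open>auto simp: cells_iff\<close>)
  then show ?thesis using t sqD[OF sq_pasting[OF \<alpha>' \<omega>]] by (simp add: lwhisker_def[of B q])
qed

end

section \<open>Construction of product cones in \<open>G\<close> together with their
  boundaries\<close>

context precartesian_bicategory
begin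

text \<open>The three cones are delivered by one statement because preservation needs a cone in
  \<open>G\<close> whose boundaries are already known to be product cones.\<close>

lemma G_product:
  fixes I :: "nat set"
  assumes I: "finite I" and x: "\<And>i. i \<in> I \<Longrightarrow> x i \<in> Obj (G_bicat B)"
  obtains Pr pr where "product_cone (G_bicat B) I x Pr pr"
    "product_cone (Map_bicat B) I (\<lambda>i. on_obj (\<partial>\<^sub>0 B) (x i)) (on_obj (\<partial>\<^sub>0 B) Pr) (\<lambda>i. on_arr (\<partial>\<^sub>0 B) (pr i))"
    "product_cone (Map_bicat B) I (\<lambda>i. on_obj (\<partial>\<^sub>1 B) (x i)) (on_obj (\<partial>\<^sub>1 B) Pr) (\<lambda>i. on_arr (\<partial>\<^sub>1 B) (pr i))"
proof -
  interpret G: normal_bicategory "G_bicat B" by (rule normal_bicategory_G)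
  define X where "X i = fst (x i)" for i
  define S where "S i = fst (snd (x i))" for i
  define A where "A i = snd (snd (x i))" for i
  have x_eq: "x i = (X i, S i, A i)" for i by (simp add: X_def S_def A_def)
  have S: "S i \<in> Arr B" "src B (S i) = X i" "trg B (S i) = A i" if "i \<in> I" for i
    using x[OF that] unfolding x_eq by (auto simp: G_obj_iff)
  have ob: "X i \<in> Obj B" "A i \<in> Obj B" if "i \<in> I" for i
    using arr_simps[OF S(1)[OF that]] S(2,3)[OF that] by auto
  obtain P p where P: "product_cone (Map_bicat B) I X P p"
    using Map_finite_products[unfolded has_finite_products_def, rule_format, of I X] I ob
    by auto
  obtain Q q where Q: "product_cone (Map_bicat B) I A Q q"
    using Map_finite_products[unfolded has_finite_products_def, rule_format, of I A] I ob
    by auto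
  note PD = Map_product_coneD[OF P] and QD = Map_product_coneD[OF Q]
  have S_arrs: "S i \<in> arrs B (X i) (A i)" if "i \<in> I" for i using S[OF that] by (auto simp: arrs_iff)
  obtain R \<omega> where R: "R \<in> arrs B P Q" and \<omega>': "\<forall>i\<in>I. \<omega> i \<in> cells B (q i \<odot> R) (S i \<odot> p i)"
    and key': "\<forall>Z D T g u \<sigma>. T \<in> arrs B Z D \<and> g \<in> arrs B Z P \<and> is_map B g \<and> u \<in> arrs B D Q \<and>
      (\<forall>i\<in>I. \<sigma> i \<in> cells B ((q i \<odot> u) \<odot> T) (S i \<odot> p i \<odot> g)) \<longrightarrow>
      (\<exists>!\<beta>. \<beta> \<in> cells B (u \<odot> T) (R \<odot> g) \<and>
        (\<forall>i\<in>I. pasting B T R (S i) (p i) (\<omega> i) (q i) g \<beta> u = \<sigma> i))"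
    using local_product[OF I PD(1) QD(1) PD(2)[THEN conjunct1] QD(2) S_arrs] .
  note \<omega> = bspec[OF \<omega>']
  have key: "\<exists>!\<beta>. \<beta> \<in> cells B (u \<odot> T) (R \<odot> g) \<and>
      (\<forall>i\<in>I. pasting B T R (S i) (p i) (\<omega> i) (q i) g \<beta> u = \<sigma> i)"
    if "T \<in> arrs B Z D" "g \<in> arrs B Z P" "is_map B g" "u \<in> arrs B D Q"
      "\<And>i. i \<in> I \<Longrightarrow> \<sigma> i \<in> cells B ((q i \<odot> u) \<odot> T) (S i \<odot> p i \<odot> g)" for Z D T g u \<sigma>
    using key'[rule_format, of T Z D g u \<sigma>] that by blast
  have s: "p i \<in> Arr B" "src B (p i) = P" "trg B (p i) = X i" "is_map B (p i)"
    "q i \<in> Arr B" "src B (q i) = Q" "trg B (q i) = A i" "is_map B (q i)" if "i \<in> I" for i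
    using PD(2)[OF that] QD(2)[OF that] by (auto simp: arrs_iff)
  have R': "R \<in> Arr B" "src B R = P" "trg B R = Q" using R by (auto simp: arrs_iff)
  have \<omega>_sq: "sq R (S i) (p i) (\<omega> i) (q i)" if "i \<in> I" for i
    using s[OF that] R' S[OF that] \<omega>[OF that] by (simp add: sq_def cells_iff)
  let ?Pr = "(P, R, Q)"
  define pr where "pr i = (?Pr, (p i, \<omega> i, q i), x i)" for i
  have pr: "pr i \<in> arrs (G_bicat B) ?Pr (x i)" if "i \<in> I" for i
    unfolding pr_def x_eq G_arrs_iff G_arr_iff using \<omega>_sq[OF that] s[OF that] R' S[OF that] by simp
  have comp: "G_comp1 B (pr i) ((Z, T, D), (f, \<alpha>, u), ?Pr) =
      ((Z, T, D), (p i \<odot> f, pasting B T R (S i) (p i) (\<omega> i) (q i) f \<alpha> u, q i \<odot> u), x i)"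
    for i Z T D f \<alpha> u by (simp add: pr_def x_eq)
  have whisker: "pr i \<rhd>\<^bsub>G_bicat B\<^esub> (h, (\<phi>, \<psi>), h') =
      (G_comp1 B (pr i) h, (p i \<rhd> \<phi>, q i \<rhd> \<psi>), G_comp1 B (pr i) h')" for i h \<phi> \<psi> h'
    by (simp add: G_whisker pr_def lwhisker_def)
  have "jointly_fully_faithful (G_bicat B) I ?Pr pr"
    unfolding jointly_fully_faithful_def
  proof (intro allI impI; elim conjE)
    fix z h h' \<sigma>
    assume h: "h \<in> arrs (G_bicat B) z ?Pr" "h' \<in> arrs (G_bicat B) z ?Pr"
      and "\<forall>i\<in>I. \<sigma> i \<in> cells (G_bicat B) (pr i \<odot>\<^bsub>G_bicat B\<^esub> h) (pr i \<odot>\<^bsub>G_bicat B\<^esub> h')"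
    then have \<sigma>: "\<sigma> i \<in> cells (G_bicat B) (G_comp1 B (pr i) h) (G_comp1 B (pr i) h')" if "i \<in> I" for i
      using that by simp
    obtain T f \<alpha> u where z: "z = (src B T, T, trg B T)" and h_eq: "h = (z, (f, \<alpha>, u), ?Pr)"
      and fu: "is_map B f" "is_map B u" and \<alpha>: "sq T R f \<alpha> u"
      using h(1) by (elim G_arrE) auto
    obtain f' \<alpha>' u' where h'_eq: "h' = (z, (f', \<alpha>', u'), ?Pr)"
      and fu': "is_map B f'" "is_map B u'" and \<alpha>': "sq T R f' \<alpha>' u'"
      using h(2) z by (elim G_arrE) auto
    let ?past = "\<lambda>i. pasting B T R (S i) (p i) (\<omega> i) (q i)"
    \<comment> \<open>The endpoints stored in a 2-cell of \<open>G\<close> are known here, so each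
      \<open>\<sigma> i\<close> is determined by its pair of components \<open>t i\<close>, subject
      to the compatibility equation for the pasted squares.\<close>
    have "\<forall>i\<in>I. \<exists>t. \<sigma> i = (G_comp1 B (pr i) h, t, G_comp1 B (pr i) h') \<and>
        fst t \<in> cells B (p i \<odot> f) (p i \<odot> f') \<and> snd t \<in> cells B (q i \<odot> u) (q i \<odot> u') \<and>
        (S i \<rhd> fst t) \<cdot> ?past i f \<alpha> u = ?past i f' \<alpha>' u' \<cdot> (snd t \<lhd> T)"
    proof
      fix i assume i: "i \<in> I"
      have a: "G_comp1 B (pr i) h \<in> arrs (G_bicat B) (src B T, T, trg B T) (X i, S i, A i)"
        using G.comp1_arr[OF h(1) pr[OF i]] unfolding z x_eq by simp
      show "\<exists>t. \<sigma> i = (G_comp1 B (pr i) h, t, G_comp1 B (pr i) h') \<and>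
          fst t \<in> cells B (p i \<odot> f) (p i \<odot> f') \<and> snd t \<in> cells B (q i \<odot> u) (q i \<odot> u') \<and>
          (S i \<rhd> fst t) \<cdot> ?past i f \<alpha> u = ?past i f' \<alpha>' u' \<cdot> (snd t \<lhd> T)"
        by (rule G_cellE[OF \<sigma>[OF i] a]) (auto simp: h_eq h'_eq z comp)
    qed
    from bchoice[OF this] obtain t where t: "\<forall>i\<in>I. \<sigma> i = (G_comp1 B (pr i) h, t i, G_comp1 B (pr i) h') \<and>
        fst (t i) \<in> cells B (p i \<odot> f) (p i \<odot> f') \<and> snd (t i) \<in> cells B (q i \<odot> u) (q i \<odot> u') \<and>
        (S i \<rhd> fst (t i)) \<cdot> ?past i f \<alpha> u = ?past i f' \<alpha>' u' \<cdot> (snd (t i) \<lhd> T)" by blast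
    have ar: "T \<in> arrs B (src B T) (trg B T)" "f \<in> arrs B (src B T) P" "f' \<in> arrs B (src B T) P"
      "u \<in> arrs B (trg B T) Q" "u' \<in> arrs B (trg B T) Q"
      using sqD[OF \<alpha>] sqD[OF \<alpha>'] R' by (auto simp: arrs_iff)
    have exP: "\<exists>!\<phi>. \<phi> \<in> cells B f f' \<and> (\<forall>i\<in>I. p i \<rhd> \<phi> = fst (t i))"
      by (rule PD(3)[OF ar(2) fu(1) ar(3) fu'(1)]) (use t in blast)
    have exQ: "\<exists>!\<psi>. \<psi> \<in> cells B u u' \<and> (\<forall>i\<in>I. q i \<rhd> \<psi> = snd (t i))"
      by (rule QD(3)[OF ar(4) fu(2) ar(5) fu'(2)]) (use t in blast)
    obtain \<phi> where \<phi>: "\<phi> \<in> cells B f f'" "\<forall>i\<in>I. p i \<rhd> \<phi> = fst (t i)" using exP by blast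
    obtain \<psi> where \<psi>: "\<psi> \<in> cells B u u'" "\<forall>i\<in>I. q i \<rhd> \<psi> = snd (t i)" using exQ by blast
    \<comment> \<open>\<open>P\<close> and \<open>Q\<close> force the components
      \<open>\<phi>\<close> and \<open>\<psi>\<close> separately. Nothing so far relates them; that
      they form a 2-cell of \<open>G\<close> is exactly the equation
      \<open>?\<beta> = ?\<beta>'\<close>.\<close>
    let ?\<beta> = "(R \<rhd> \<phi>) \<cdot> \<alpha>" and ?\<beta>' = "\<alpha>' \<cdot> (\<psi> \<lhd> T)"
    note \<beta> = sq_lwhisker[OF \<alpha> \<phi>(1)] and \<beta>' = sq_rwhisker[OF \<alpha>' \<psi>(1)]
    have eq: "?past i f' ?\<beta> u = ?past i f' ?\<beta>' u" if i: "i \<in> I" for i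
      unfolding pasting_lwhisker[OF \<alpha> \<omega>_sq[OF i] \<phi>(1)] pasting_rwhisker[OF \<alpha>' \<omega>_sq[OF i] \<psi>(1)]
      using t \<phi>(2) \<psi>(2) i by simp
    \<comment> \<open>Both sides have the same pastings with all projections, so the uniqueness half
      of \<open>key\<close>, with the pastings of \<open>?\<beta>\<close> as prescribed family,
      identifies them.\<close>
    have square: "?\<beta> = ?\<beta>'"
    proof -
      have "?past i f' ?\<beta> u \<in> cells B ((q i \<odot> u) \<odot> T) (S i \<odot> p i \<odot> f')" if "i \<in> I" for i
        using sqD[OF sq_pasting[OF \<beta> \<omega>_sq[OF that]]] by (simp add: cells_iff)
      from key[OF ar(1,3) fu'(1) ar(4) this]
      have "\<exists>!\<gamma>. \<gamma> \<in> cells B (u \<odot> T) (R \<odot> f') \<and> (\<forall>i\<in>I. ?past i f' \<gamma> u = ?past i f' ?\<beta> u)" .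
      moreover have "?\<beta> \<in> cells B (u \<odot> T) (R \<odot> f')" "?\<beta>' \<in> cells B (u \<odot> T) (R \<odot> f')"
        using sqD[OF \<beta>] sqD[OF \<beta>'] by (simp_all add: cells_iff)
      moreover have "\<forall>i\<in>I. ?past i f' ?\<beta>' u = ?past i f' ?\<beta> u" using eq by simp
      ultimately show ?thesis by blast
    qed
    show "\<exists>!s. s \<in> cells (G_bicat B) h h' \<and> (\<forall>i\<in>I. pr i \<rhd>\<^bsub>G_bicat B\<^esub> s = \<sigma> i)"
    proof (rule ex1I[of _ "(h, (\<phi>, \<psi>), h')"])
      have "(h, (\<phi>, \<psi>), h') \<in> cells (G_bicat B) h h'"
        unfolding G_cells_iff h_eq h'_eq z G_cell_iff
        using R' fu fu' \<alpha> \<alpha>' \<phi>(1) \<psi>(1) square by simp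
      moreover have "pr i \<rhd>\<^bsub>G_bicat B\<^esub> (h, (\<phi>, \<psi>), h') = \<sigma> i" if "i \<in> I" for i
        using t \<phi>(2) \<psi>(2) that by (simp add: whisker)
      ultimately show "(h, (\<phi>, \<psi>), h') \<in> cells (G_bicat B) h h' \<and>
          (\<forall>i\<in>I. pr i \<rhd>\<^bsub>G_bicat B\<^esub> (h, (\<phi>, \<psi>), h') = \<sigma> i)" by blast
    next
      fix s assume s: "s \<in> cells (G_bicat B) h h' \<and> (\<forall>i\<in>I. pr i \<rhd>\<^bsub>G_bicat B\<^esub> s = \<sigma> i)"
      obtain \<phi>' \<psi>' where s_eq: "s = (h, (\<phi>', \<psi>'), h')" and c: "\<phi>' \<in> cells B f f'" "\<psi>' \<in> cells B u u'"
        by (rule G_cellE[OF conjunct1[OF s] h(1)[unfolded z]]) (auto simp: h_eq h'_eq z)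
      have "p i \<rhd> \<phi>' = fst (t i) \<and> q i \<rhd> \<psi>' = snd (t i)" if i: "i \<in> I" for i
      proof -
        have "(G_comp1 B (pr i) h, (p i \<rhd> \<phi>', q i \<rhd> \<psi>'), G_comp1 B (pr i) h') =
            (G_comp1 B (pr i) h, t i, G_comp1 B (pr i) h')"
          using s t i unfolding s_eq whisker by metis
        then have "(p i \<rhd> \<phi>', q i \<rhd> \<psi>') = t i" by simp
        then show ?thesis by (metis fst_conv snd_conv)
      qed
      then have "\<phi>' = \<phi>" "\<psi>' = \<psi>" using exP exQ \<phi> \<psi> c by blast+
      then show "s = (h, (\<phi>, \<psi>), h')" using s_eq by simp
    qed
  qed
  moreover have "jointly_essentially_surjective (G_bicat B) I x ?Pr pr"
    unfolding jointly_essentially_surjective_def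
  proof (intro ballI allI impI)
    fix z k assume z: "z \<in> Obj (G_bicat B)" and k: "\<forall>i\<in>I. k i \<in> arrs (G_bicat B) z (x i)"
    obtain Z T D where z_eq: "z = (Z, T, D)" by (metis prod_cases3)
    have T: "T \<in> Arr B" "src B T = Z" "trg B T = D" using z unfolding z_eq by (auto simp: G_obj_iff)
    define f where "f i = fst (fst (snd (k i)))" for i
    define \<alpha> where "\<alpha> i = fst (snd (fst (snd (k i))))" for i
    define u where "u i = snd (snd (fst (snd (k i))))" for i
    have k': "k i = (z, (f i, \<alpha> i, u i), x i)" "is_map B (f i)" "is_map B (u i)" "sq T (S i) (f i) (\<alpha> i) (u i)"
      if "i \<in> I" for i
    proof -
      have ki: "k i \<in> arrs (G_bicat B) z (x i)" using k that by blast
      show "k i = (z, (f i, \<alpha> i, u i), x i)" "is_map B (f i)" "is_map B (u i)" "sq T (S i) (f i) (\<alpha> i) (u i)"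
        by (rule G_arrE[OF ki]; simp add: f_def \<alpha>_def u_def z_eq x_eq)+
    qed
    have fk: "f i \<in> arrs B Z (X i) \<and> is_map B (f i)" "u i \<in> arrs B D (A i) \<and> is_map B (u i)" if "i \<in> I" for i
      using sqD[OF k'(4)[OF that]] k'(2,3)[OF that] S[OF that] T by (auto simp: arrs_iff)
    have ZD: "Z \<in> Obj B" "D \<in> Obj B" using arr_simps[OF T(1)] T(2,3) by auto
    obtain g where g: "g \<in> arrs B Z P" "is_map B g" "\<forall>i\<in>I. \<exists>\<sigma>. \<sigma> \<in> cells B (p i \<odot> g) (f i) \<and> iso_cell B \<sigma>"
      using PD(4)[OF ZD(1) fk(1)] unfolding Bex_def by blast
    obtain v where v: "v \<in> arrs B D Q" "is_map B v" "\<forall>i\<in>I. \<exists>\<sigma>. \<sigma> \<in> cells B (q i \<odot> v) (u i) \<and> iso_cell B \<sigma>"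
      using QD(4)[OF ZD(2) fk(2)] unfolding Bex_def by blast
    obtain \<phi> where \<phi>: "\<forall>i\<in>I. \<phi> i \<in> cells B (p i \<odot> g) (f i) \<and> iso_cell B (\<phi> i)" using bchoice[OF g(3)] by blast
    obtain \<psi> where \<psi>: "\<forall>i\<in>I. \<psi> i \<in> cells B (q i \<odot> v) (u i) \<and> iso_cell B (\<psi> i)" using bchoice[OF v(3)] by blast
    have gv: "g \<in> Arr B" "src B g = Z" "trg B g = P" "v \<in> Arr B" "src B v = D" "trg B v = Q"
      using g(1) v(1) by (auto simp: arrs_iff)
    \<comment> \<open>The cones at \<open>P\<close> and \<open>Q\<close> reproduce
      \<open>f i\<close> and \<open>u i\<close> only up to invertible cells. Solving for
      \<open>\<beta> i\<close> carries \<open>\<alpha> i\<close> across them, in the one way that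
      makes \<open>(\<phi> i, \<psi> i)\<close> a 2-cell of \<open>G\<close>.\<close>
    have "\<forall>i\<in>I. \<exists>\<beta>. \<beta> \<in> cells B ((q i \<odot> v) \<odot> T) (S i \<odot> p i \<odot> g) \<and> (S i \<rhd> \<phi> i) \<cdot> \<beta> = \<alpha> i \<cdot> (\<psi> i \<lhd> T)"
    proof
      fix i assume i: "i \<in> I"
      note si = s[OF i] S[OF i] gv T sqD[OF k'(4)[OF i]]
      have c: "\<phi> i \<in> Cell B" "cdom B (\<phi> i) = p i \<odot> g" "ccod B (\<phi> i) = f i"
        "\<psi> i \<in> Cell B" "cdom B (\<psi> i) = q i \<odot> v" "ccod B (\<psi> i) = u i"
        using \<phi> \<psi> i by (auto simp: cells_iff)
      have w: "S i \<rhd> \<phi> i \<in> cells B (S i \<odot> p i \<odot> g) (S i \<odot> f i)" using c si by (auto simp: cells_iff)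
      have iso: "iso_cell B (S i \<rhd> \<phi> i)"
        by (rule iso_cell_lwhisker) (use \<phi> i si in auto)
      have "\<alpha> i \<cdot> (\<psi> i \<lhd> T) \<in> cells B ((q i \<odot> v) \<odot> T) (S i \<odot> f i)"
        using c si by (auto simp: cells_iff)
      then show "\<exists>\<beta>. \<beta> \<in> cells B ((q i \<odot> v) \<odot> T) (S i \<odot> p i \<odot> g) \<and> (S i \<rhd> \<phi> i) \<cdot> \<beta> = \<alpha> i \<cdot> (\<psi> i \<lhd> T)"
        unfolding bij_betw_imp_surj_on[OF vcomp_iso_cell_left_bij[OF w iso], symmetric] by auto
    qed
    from bchoice[OF this] obtain \<beta> where
      \<beta>: "\<forall>i\<in>I. \<beta> i \<in> cells B ((q i \<odot> v) \<odot> T) (S i \<odot> p i \<odot> g) \<and> (S i \<rhd> \<phi> i) \<cdot> \<beta> i = \<alpha> i \<cdot> (\<psi> i \<lhd> T)"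
      by blast
    have T_arr: "T \<in> arrs B Z D" using T by (auto simp: arrs_iff)
    \<comment> \<open>The existence half of \<open>key\<close> glues the \<open>\<beta> i\<close>
      into the middle 2-cell of the mediating arrow.\<close>
    have "\<exists>!\<gamma>. \<gamma> \<in> cells B (v \<odot> T) (R \<odot> g) \<and>
        (\<forall>i\<in>I. pasting B T R (S i) (p i) (\<omega> i) (q i) g \<gamma> v = \<beta> i)"
      by (rule key[OF T_arr g(1,2) v(1)]) (use \<beta> in blast)
    then obtain \<gamma> where \<gamma>: "\<gamma> \<in> cells B (v \<odot> T) (R \<odot> g)"
      "\<forall>i\<in>I. pasting B T R (S i) (p i) (\<omega> i) (q i) g \<gamma> v = \<beta> i" by blast
    have \<gamma>_sq: "sq T R g \<gamma> v" using \<gamma>(1) T gv R' by (auto simp: sq_def cells_iff)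
    let ?h = "(z, (g, \<gamma>, v), ?Pr)"
    have h: "?h \<in> arrs (G_bicat B) z ?Pr"
      unfolding z_eq G_arrs_iff G_arr_iff using \<gamma>_sq T R' g(2) v(2) by simp
    show "\<exists>h\<in>arrs (G_bicat B) z ?Pr. \<forall>i\<in>I. \<exists>\<sigma>\<in>cells (G_bicat B) (pr i \<odot>\<^bsub>G_bicat B\<^esub> h) (k i). iso_cell (G_bicat B) \<sigma>"
    proof (intro bexI[OF _ h] ballI)
      fix i assume i: "i \<in> I"
      let ?a = "G_comp1 B (pr i) ?h"
      have a: "?a \<in> arrs (G_bicat B) z (x i)" using G.comp1_arr[OF h pr[OF i]] by simp
      have \<beta>_sq: "sq T (S i) (p i \<odot> g) (\<beta> i) (q i \<odot> v)"
        using sq_pasting[OF \<gamma>_sq \<omega>_sq[OF i]] \<gamma>(2) i by simp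
      have maps: "is_map B (p i \<odot> g)" "is_map B (q i \<odot> v)"
        using s[OF i] gv g(2) v(2) by (auto intro: is_map_comp)
      have c: "(?a, (\<phi> i, \<psi> i), k i) \<in> cells (G_bicat B) ?a (k i)"
        unfolding G_cells_iff k'(1)[OF i] z_eq comp x_eq G_cell_iff
        using k'(2-4)[OF i] \<beta>_sq maps \<phi> \<psi> \<beta> \<gamma>(2) i T S[OF i] by simp
      show "\<exists>\<sigma>\<in>cells (G_bicat B) (pr i \<odot>\<^bsub>G_bicat B\<^esub> ?h) (k i). iso_cell (G_bicat B) \<sigma>"
        using c G_iso_cellI[OF c a] \<phi> \<psi> i by auto
    qed
  qed
  moreover have "?Pr \<in> Obj (G_bicat B)" using R' by (simp add: G_obj_iff)
  ultimately have "product_cone (G_bicat B) I x ?Pr pr"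
    unfolding G.product_cone_iff using x pr by blast
  then show thesis
    by (rule that) (use P Q in \<open>simp_all add: boundary0_def boundary1_def x_eq pr_def\<close>)
qed

end

theorem theorem3p9:
  fixes B :: "('o, 'a, 'c) bicat"
  assumes "precartesian_bicategory B"
  shows "has_finite_products (G_bicat B) \<and>
    preserves_finite_products (G_bicat B) (Map_bicat B) (\<partial>\<^sub>0 B) \<and>
    preserves_finite_products (G_bicat B) (Map_bicat B) (\<partial>\<^sub>1 B)"
proof -
  interpret precartesian_bicategory B by (rule assms)
  interpret d0: pseudofunctor "G_bicat B" "Map_bicat B" "\<partial>\<^sub>0 B" by (rule pseudofunctor_boundary0)
  interpret d1: pseudofunctor "G_bicat B" "Map_bicat B" "\<partial>\<^sub>1 B" by (rule pseudofunctor_boundary1)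
  have "has_finite_products (G_bicat B)"
    unfolding has_finite_products_def
  proof (intro allI impI, elim conjE)
    fix I :: "nat set" and x assume "finite I" "\<forall>i\<in>I. x i \<in> Obj (G_bicat B)"
    then show "\<exists>Pr pr. product_cone (G_bicat B) I x Pr pr" using G_product[of I x] by blast
  qed
  moreover have "preserves_finite_products (G_bicat B) (Map_bicat B) (\<partial>\<^sub>0 B)"
    "preserves_finite_products (G_bicat B) (Map_bicat B) (\<partial>\<^sub>1 B)"
    unfolding preserves_finite_products_def
  proof (safe)
    fix I :: "nat set" and x Pr pr
    assume I: "finite I" and cone: "product_cone (G_bicat B) I x Pr pr"
    then have x: "x i \<in> Obj (G_bicat B)" if "i \<in> I" for i using that unfolding product_cone_def by blast
    \<comment> \<open>The given cone is arbitrary, so its boundaries are compared with those of the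
      constructed cone over the same family.\<close>
    obtain Pr' pr' where c: "product_cone (G_bicat B) I x Pr' pr'"
      "product_cone (Map_bicat B) I (\<lambda>i. on_obj (\<partial>\<^sub>0 B) (x i)) (on_obj (\<partial>\<^sub>0 B) Pr') (\<lambda>i. on_arr (\<partial>\<^sub>0 B) (pr' i))"
      "product_cone (Map_bicat B) I (\<lambda>i. on_obj (\<partial>\<^sub>1 B) (x i)) (on_obj (\<partial>\<^sub>1 B) Pr') (\<lambda>i. on_arr (\<partial>\<^sub>1 B) (pr' i))"
      using G_product[OF I x] .
    show "product_cone (Map_bicat B) I (\<lambda>i. on_obj (\<partial>\<^sub>0 B) (x i)) (on_obj (\<partial>\<^sub>0 B) Pr) (\<lambda>i. on_arr (\<partial>\<^sub>0 B) (pr i))"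
      by (rule d0.preserves_product_cone_if_one[OF cone c(1,2)])
    show "product_cone (Map_bicat B) I (\<lambda>i. on_obj (\<partial>\<^sub>1 B) (x i)) (on_obj (\<partial>\<^sub>1 B) Pr) (\<lambda>i. on_arr (\<partial>\<^sub>1 B) (pr i))"
      by (rule d1.preserves_product_cone_if_one[OF cone c(1,3)])
  qed
  ultimately show ?thesis by blast
qed

end
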